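(* Let $\Bbbk$ be a field, $S=\Bbbk[x_1,\ldots,x_n]$, and let $\mathfrak{a}=\mathfrak{f}+(G)\subseteq S$ be an almost complete intersection of degrees $(\mathbf{d};D)=(d_1,\ldots,d_h;D)$ with $D<\sigma=\sum_{i=1}^h(d_i-1)$. Let $\tau_-=\lfloor\frac{\sigma+D-1}{2}\rfloor$ and $\tau^+=\lceil\frac{\sigma+D-1}{2}\rceil$. Then $\operatorname{e}(S/\mathfrak{a})\le\prod_{i=1}^h d_i-\sum_{m=D+1}^{\tau_-}\varphi_m-\sum_{m=D+1}^{\tau^+}\varphi_m-2.$
   Context: $\operatorname{HF}(M;j)=\dim_\Bbbk M_j$; $\operatorname{e}$ is multiplicity. An almost complete intersection of degrees $(\mathbf{d};D)=(d_1,\ldots,d_h;D)$ is a homogeneous ideal $\mathfrak{a}$ of height $h$ with $\mathfrak{a}=\mathfrak{f}+(G)$, $\mathfrak{f}$ generated by a homogeneous regular sequence of degrees $d_1\le\cdots\le d_h$, $G$ homogeneous of degree $D$, $G\notin\mathfrak{f}$. In $\overline{S}=\Bbbk[x_1,\ldots,x_h]$ let $(\mathsf{x}^{\mathbf{d}})=(x_1^{d_1},\ldots,x_h^{d_h})$; for $E\le\sigma$ let $U_E$ be the lex-largest monomial ($x_1>\cdots>x_h$) of degree $E$ not in $(\mathsf{x}^{\mathbf{d}})$ and $\mathcal{L}(\mathbf{d};E)=(\mathsf{x}^{\mathbf{d}})+(U_E)$. Define $\varphi_m=\operatorname{HF}(\overline{S}/(\mathsf{x}^{\mathbf{d}});m)-\operatorname{HF}(\overline{S}/\mathcal{L}(\mathbf{d};m-1);m)$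 for $2\le m\le\sigma$ and $\varphi_m=0$ otherwise. Empty sums are $0$. *)

theory Defs
  imports Complex_Main "HOL-Library.Poly_Mapping" "HOL-Library.Extended_Nat"
begin

(* Polynomials over a field 'k in the variables x_0, x_1, x_2, ... (indexed by nat).
   A monomial is an exponent vector  nat \<Rightarrow>\<^sub>0 nat;  a polynomial maps monomials to coefficients.
   The polynomial ring k[x_1,...,x_n] of the paper is the subring  PR {0..<n}. *)
type_synonym 'k mpoly = "(nat \<Rightarrow>\<^sub>0 nat) \<Rightarrow>\<^sub>0 'k"

definition pscale :: "'k::field \<Rightarrow> 'k mpoly \<Rightarrow> 'k mpoly" where
  "pscale c p = Poly_Mapping.map (\<lambda>a. c * a) p"

definition kdim :: "'k::field mpoly set \<Rightarrow> nat" where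
  "kdim A = vector_space.dim pscale A"

definition mdeg :: "(nat \<Rightarrow>\<^sub>0 nat) \<Rightarrow> nat" where
  "mdeg m = (\<Sum>i\<in>Poly_Mapping.keys m. Poly_Mapping.lookup m i)"

definition PR :: "nat set \<Rightarrow> 'k::field mpoly set" where
  "PR V = {p. \<forall>m\<in>Poly_Mapping.keys p. Poly_Mapping.keys m \<subseteq> V}"

(* homogeneous of degree d (the zero polynomial is homogeneous of every degree) *)
definition homog :: "nat \<Rightarrow> 'k::field mpoly \<Rightarrow> bool" where
  "homog d p \<longleftrightarrow> (\<forall>m\<in>Poly_Mapping.keys p. mdeg m = d)"

definition graded_piece :: "nat set \<Rightarrow> nat \<Rightarrow> 'k::field mpoly set" where
  "graded_piece V j = {p \<in> PR V. homog j p}"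

definition ideal_gen :: "nat set \<Rightarrow> 'k::field mpoly set \<Rightarrow> 'k mpoly set" where
  "ideal_gen V A = {(\<Sum>a\<in>F. c a * a) | F c. finite F \<and> F \<subseteq> A \<and> (\<forall>a\<in>F. c a \<in> PR V)}"

definition is_ideal :: "nat set \<Rightarrow> 'k::field mpoly set \<Rightarrow> bool" where
  "is_ideal V I \<longleftrightarrow> I \<subseteq> PR V \<and> 0 \<in> I \<and> (\<forall>a\<in>I. \<forall>b\<in>I. a + b \<in> I)
     \<and> (\<forall>r\<in>PR V. \<forall>a\<in>I. r * a \<in> I)"

definition prime_ideal :: "nat set \<Rightarrow> 'k::field mpoly set \<Rightarrow> bool" where
  "prime_ideal V P \<longleftrightarrow> is_ideal V P \<and> P \<noteq> PR V
     \<and> (\<forall>a\<in>PR V. \<forall>b\<in>PR V. a * b \<in> P \<longrightarrow> a \<in> P \<or> b \<in> P)"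

definition height_prime :: "nat set \<Rightarrow> 'k::field mpoly set \<Rightarrow> enat" where
  "height_prime V P = Sup (enat ` {l. \<exists>c :: nat \<Rightarrow> 'k mpoly set.
      (\<forall>i\<le>l. prime_ideal V (c i)) \<and> (\<forall>i<l. c i \<subset> c (Suc i)) \<and> c l = P})"

definition height_ideal :: "nat set \<Rightarrow> 'k::field mpoly set \<Rightarrow> enat" where
  "height_ideal V I = (INF P\<in>{P. prime_ideal V P \<and> I \<subseteq> P}. height_prime V P)"

definition krull_dim_quot :: "nat set \<Rightarrow> 'k::field mpoly set \<Rightarrow> enat" where
  "krull_dim_quot V I = Sup (enat ` {l. \<exists>c :: nat \<Rightarrow> 'k mpoly set.
      (\<forall>i\<le>l. prime_ideal V (c i) \<and> I \<subseteq> c i) \<and> (\<forall>i<l. c i \<subset> c (Suc i))})"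

(* Hilbert function HF(PR V / I; j) = dim_k (PR V)_j - dim_k I_j  (for homogeneous I) *)
definition HF :: "nat set \<Rightarrow> 'k::field mpoly set \<Rightarrow> nat \<Rightarrow> nat" where
  "HF V I j = kdim (graded_piece V j :: 'k mpoly set) - kdim (I \<inter> graded_piece V j)"

definition multiplicity :: "nat set \<Rightarrow> 'k::field mpoly set \<Rightarrow> real" where
  "multiplicity V I = (let d = the_enat (krull_dim_quot V I) in
     lim (\<lambda>j. real (fact d) * real (\<Sum>i\<le>j. HF V I i) / real j ^ d))"

definition homog_regular_seq :: "nat set \<Rightarrow> 'k::field mpoly list \<Rightarrow> nat list \<Rightarrow> bool" where
  "homog_regular_seq V fs ds \<longleftrightarrow> length fs = length ds
     \<and> (\<forall>i<length fs. fs ! i \<in> PR V \<and> homog (ds ! i) (fs ! i))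
     \<and> ideal_gen V (set fs) \<noteq> PR V
     \<and> (\<forall>i<length fs. \<forall>g\<in>PR V.
           fs ! i * g \<in> ideal_gen V (set (take i fs)) \<longrightarrow> g \<in> ideal_gen V (set (take i fs)))"

definition almost_ci :: "nat set \<Rightarrow> 'k::field mpoly list \<Rightarrow> 'k mpoly \<Rightarrow> nat list \<Rightarrow> nat \<Rightarrow> bool" where
  "almost_ci V fs G ds D \<longleftrightarrow> sorted ds \<and> homog_regular_seq V fs ds
     \<and> G \<in> PR V \<and> homog D G \<and> G \<notin> ideal_gen V (set fs)
     \<and> height_ideal V (ideal_gen V (insert G (set fs))) = enat (length ds)"

definition sigma :: "nat list \<Rightarrow> nat" where
  "sigma ds = (\<Sum>d\<leftarrow>ds. d - 1)"

definition xpow :: "nat \<Rightarrow> nat \<Rightarrow> 'k::field mpoly" where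
  "xpow i e = Poly_Mapping.single (Poly_Mapping.single i e) 1"

definition xd_ideal :: "nat list \<Rightarrow> 'k::field mpoly set" where
  "xd_ideal ds = ideal_gen {0..<length ds} ((\<lambda>i. xpow i (ds ! i)) ` {0..<length ds})"

definition lex_gt :: "(nat \<Rightarrow>\<^sub>0 nat) \<Rightarrow> (nat \<Rightarrow>\<^sub>0 nat) \<Rightarrow> bool" where
  "lex_gt m m' \<longleftrightarrow> (\<exists>i. (\<forall>j<i. Poly_Mapping.lookup m j = Poly_Mapping.lookup m' j) \<and> Poly_Mapping.lookup m' i < Poly_Mapping.lookup m i)"

definition U_mon :: "'k::field itself \<Rightarrow> nat list \<Rightarrow> nat \<Rightarrow> (nat \<Rightarrow>\<^sub>0 nat)" where
  "U_mon _ ds E = (THE m. Poly_Mapping.keys m \<subseteq> {0..<length ds} \<and> mdeg m = E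
       \<and> (Poly_Mapping.single m (1::'k) \<notin> xd_ideal ds)
       \<and> (\<forall>m'. Poly_Mapping.keys m' \<subseteq> {0..<length ds} \<and> mdeg m' = E
              \<and> (Poly_Mapping.single m' (1::'k) \<notin> xd_ideal ds) \<and> m' \<noteq> m \<longrightarrow> lex_gt m m'))"

definition L_ideal :: "nat list \<Rightarrow> nat \<Rightarrow> 'k::field mpoly set" where
  "L_ideal ds E = ideal_gen {0..<length ds}
     (insert (Poly_Mapping.single (U_mon TYPE('k) ds E) 1)
             ((\<lambda>i. xpow i (ds ! i)) ` {0..<length ds}))"

definition phi :: "'k::field itself \<Rightarrow> nat list \<Rightarrow> nat \<Rightarrow> int" where
  "phi _ ds m = (if 2 \<le> m \<and> m \<le> sigma ds then
       int (HF {0..<length ds} (xd_ideal ds :: 'k mpoly set) m)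
       - int (HF {0..<length ds} (L_ideal ds (m - 1) :: 'k mpoly set) m)
     else 0)"

end

theory Submission
  imports "HOL-Computational_Algebra.Polynomial" "HOL-Computational_Algebra.Fraction_Field"
    "HOL-Library.FuncSet" "HOL-Library.Infinite_Set" Defs
begin

text \<open>
  Let \<open>I\<close> be the ideal of the regular sequence and \<open>R = S/I\<close>. Since \<open>G R \<cong> S/(I : G)\<close> up to a shift, the
  multiplicity of \<open>S/(I + (G))\<close> is \<open>\<Prod>d\<^sub>i - e(S/(I : G))\<close>, so the growth of \<open>S/(I : G)\<close> has to be bounded from below.
  After extending the field to an infinite one, \<open>R\<close> is cut down by generic linear forms \<open>l\<close>; writing
  \<open>G = l^s G'\<close> with \<open>G'\<close> nonzero modulo \<open>l\<close>, each step replaces \<open>(I, G)\<close> by \<open>(I + (l), G')\<close> and does not increase the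
  growth, so in the end one needs a lower bound for the length of \<open>u R\<close>, where \<open>R\<close> is an artinian complete
  intersection with socle degree \<open>\<sigma>\<close> and \<open>u \<noteq> 0\<close> may be taken of degree \<open>D\<close>. The Hilbert function of \<open>u R\<close> is
  symmetric around \<open>(\<sigma> + D) / 2\<close>, equals \<open>1\<close> in degrees \<open>D\<close> and \<open>\<sigma>\<close>, and is at least \<open>\<phi>\<^sub>m\<close> in the degrees \<open>m\<close> in
  between: a nonzero element killed by \<open>t\<close> independent linear forms has degree at least the sum of the \<open>t\<close>
  smallest \<open>d\<^sub>i - 1\<close>, and the lex-largest monomial attains this bound.
\<close>

subsection \<open>Codimensions in vector spaces\<close>

text \<open>No dimension theory of rings is presupposed: the degree of the eventual polynomial of
  \<open>HF_sum\<close> serves as the dimension, and primes appear only where they produce generic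
  forms or where \<open>multiplicity\<close> and \<open>height_ideal\<close> force them in. These
  two speak of arbitrary primes, so chains of non-homogeneous primes have to be bounded as well, and
  the Krull dimension that normalises \<open>multiplicity\<close> has to be related to the Hilbert
  polynomial. The field extension shapes the statements. Generic sections are taken over k(x),
  whereas \<open>phi\<close> lives over k, and a colon ideal has no known generators that could be
  carried over. The lower bounds are therefore proved for an arbitrary integer function
  \<open>\<psi>\<close> with one numerical property, which \<open>phi_le\<close> supplies over k,
  and colon ideals are compared only through Hilbert functions of ideals with explicit
  generators.\<close>

locale vspace = vector_space scale for scale :: "'a::field \<Rightarrow> 'b::ab_group_add \<Rightarrow> 'b"
begin

text \<open>The polynomial ring is infinite-dimensional over the field, and counting arguments with
  \<open>dim\<close> are valid only inside a finitely generated span; every graded piece satisfies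
  this.\<close>

definition fin_span :: "'b set \<Rightarrow> bool" where
  "fin_span B \<longleftrightarrow> (\<exists>F. finite F \<and> B \<subseteq> span F)"

lemma fin_span_mono: "fin_span B \<Longrightarrow> A \<subseteq> B \<Longrightarrow> fin_span A"
  unfolding fin_span_def by blast

lemma fin_span_independent:
  assumes "fin_span B" "C \<subseteq> B" "independent C"
  shows "finite C" "card C \<le> local.dim B"
proof -
  obtain F where F: "finite F" "B \<subseteq> span F" using assms(1) unfolding fin_span_def by blast
  show fC: "finite C" using independent_span_bound[OF F(1) assms(3)] assms(2) F(2) by blast
  obtain D where D: "D \<subseteq> B" "independent D" "B \<subseteq> span D" "card D = local.dim B" by (rule basis_exists)
  have "finite D" using independent_span_bound[OF F(1) D(2)] D(1) F(2) by blast
  then show "card C \<le> local.dim B" using independent_span_bound[OF _ assms(3), of D] assms(2) D by auto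
qed

text \<open>\<open>C\<close> is a basis of \<open>B\<close> modulo \<open>A\<close>, so
  \<open>card C\<close> is a codimension and no quotient space has to be formed. The codimension
  counts below start from such a pair.\<close>

lemma extend_basis:
  assumes "fin_span B" "A \<subseteq> B"
  obtains P C where "P \<subseteq> A" "C \<subseteq> B" "independent (P \<union> C)" "A \<subseteq> span P" "B \<subseteq> span (P \<union> C)"
    "finite P" "finite C" "P \<inter> C = {}" "card P = local.dim A" "card P + card C = local.dim B"
proof -
  obtain P where P: "P \<subseteq> A" "independent P" "A \<subseteq> span P" "card P = local.dim A" by (rule basis_exists)
  obtain Q where Q: "P \<subseteq> Q" "Q \<subseteq> B" "independent Q" "B \<subseteq> span Q"
    using maximal_independent_subset_extend[of P B] P assms by blast
  have fQ: "finite Q" using fin_span_independent[OF assms(1) Q(2,3)] by blast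
  have cQ: "card Q = local.dim B" using basis_card_eq_dim[OF Q(2,4,3)] .
  have e: "P \<union> (Q - P) = Q" using Q by blast
  show thesis
  proof (rule that[of P "Q - P"])
    show "card P + card (Q - P) = local.dim B"
      using cQ Q(1) fQ by (metis card_Diff_subset card_mono finite_subset le_add_diff_inverse)
    show "finite P" using Q(1) fQ finite_subset by blast
    show "independent (P \<union> (Q - P))" "B \<subseteq> span (P \<union> (Q - P))" unfolding e by (fact Q)+
  qed (use P Q(2) fQ in auto)
qed

lemma dim_mono_fin: "fin_span B \<Longrightarrow> A \<subseteq> B \<Longrightarrow> local.dim A \<le> local.dim B"
  by (rule extend_basis[of B A]) (assumption | linarith)+

lemma subspace_eq_of_dim:
  assumes "fin_span B" "A \<subseteq> B" "subspace A" "local.dim B \<le> local.dim A"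
  shows "A = B"
proof -
  obtain P C where PC: "P \<subseteq> A" "C \<subseteq> B" "independent (P \<union> C)" "A \<subseteq> span P"
    "B \<subseteq> span (P \<union> C)" "finite P" "finite C" "P \<inter> C = {}" "card P = local.dim A" "card P + card C = local.dim B"
    by (rule extend_basis[OF assms(1,2)])
  then have "card C = 0" using assms(4) by linarith
  then have "C = {}" using PC(7) by simp
  then have "B \<subseteq> span P" using PC(5) by simp
  also have "\<dots> \<subseteq> A" using PC(1) assms(3) by (simp add: span_minimal)
  finally show ?thesis using assms(2) by blast
qed

text \<open>Vectors of \<open>B\<close> independent modulo \<open>A\<close> have images independent
  modulo \<open>A'\<close>, because a relation among the images pulls back through
  \<open>inj\<close>. The inequality between codimensions is written additively since
  \<open>dim\<close> takes natural values.\<close>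

lemma codim_le_of_inj:
  assumes lin: "Vector_Spaces.linear scale scale T"
    and B: "fin_span B" "A \<subseteq> B" "subspace B" and B': "fin_span B'" "A' \<subseteq> B'" "subspace A'"
    and im: "\<And>x. x \<in> B \<Longrightarrow> T x \<in> B'"
    and inj: "\<And>x. x \<in> B \<Longrightarrow> T x \<in> A' \<Longrightarrow> x \<in> A"
  shows "local.dim B + local.dim A' \<le> local.dim B' + local.dim A"
proof -
  interpret T: Vector_Spaces.linear scale scale T by (rule lin)
  obtain P C where PC: "P \<subseteq> A" "C \<subseteq> B" "independent (P \<union> C)" "A \<subseteq> span P"
    "B \<subseteq> span (P \<union> C)" "finite P" "finite C" "P \<inter> C = {}" "card P = local.dim A" "card P + card C = local.dim B"
    by (rule extend_basis[OF B(1,2)])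
  obtain P' where P': "P' \<subseteq> A'" "independent P'" "A' \<subseteq> span P'" "card P' = local.dim A'" 
    by (rule basis_exists)
  have fP': "finite P'" by (rule fin_span_independent(1)[OF B'(1) _ P'(2)]) (use P'(1) B'(2) in blast)
  have spA': "span P' = A'" by (rule span_subspace[OF P'(1,3) B'(3)])
  have "independent (P' \<union> T ` D) \<and> card (P' \<union> T ` D) = card P' + card D" if "finite D" "D \<subseteq> C" for D
    using that
  proof (induction D rule: finite_induct)
    case empty then show ?case using P' by simp
  next
    case (insert c D)
    have "T c \<notin> span (P' \<union> T ` D)"
    proof
      assume "T c \<in> span (P' \<union> T ` D)"
      then obtain a y where ay: "T c = a + T y" "a \<in> A'" "y \<in> span D"
        unfolding span_Un T.span_image spA' by blast
      have yB: "y \<in> B" using ay(3) insert.prems PC(2) B(3) span_minimal[of D B] by auto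
      have cB: "c \<in> B" using insert.prems PC(2) by auto
      have "T (c - y) \<in> A'" using ay by (simp add: T.diff)
      then have "c - y \<in> A" using inj B(3) yB cB subspace_diff by blast
      then have "c - y \<in> span (P \<union> D)" using PC(4) span_mono[of P "P \<union> D"] by blast
      moreover have "y \<in> span (P \<union> D)" using ay(3) span_mono[of D "P \<union> D"] by blast
      ultimately have c: "c \<in> span (P \<union> D)" using span_add by fastforce
      have "P \<union> D \<subseteq> P \<union> C - {c}" using insert PC(8) by auto
      then have "c \<in> span (P \<union> C - {c})" using c span_mono by blast
      then show False using PC(3) insert.prems unfolding dependent_def by blast
    qed
    then have n: "T c \<notin> P' \<union> T ` D" using span_base[of "T c" "P' \<union> T ` D"] by blast
    have e: "P' \<union> T ` insert c D = insert (T c) (P' \<union> T ` D)" by blast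
    have "finite (P' \<union> T ` D)" using fP' insert.hyps by simp
    then have "card (P' \<union> T ` insert c D) = card P' + card (insert c D)"
      unfolding e using insert n by simp
    moreover have "independent (P' \<union> T ` insert c D)"
      unfolding e using insert \<open>T c \<notin> span (P' \<union> T ` D)\<close> by (simp add: independent_insertI)
    ultimately show ?case by blast
  qed
  from this[OF PC(7)] have ind: "independent (P' \<union> T ` C)" "card (P' \<union> T ` C) = card P' + card C" by auto
  have "P' \<union> T ` C \<subseteq> B'" using P'(1) B'(2) im PC(2) by blast
  then have "card P' + card C \<le> local.dim B'" using fin_span_independent(2)[OF B'(1) _ ind(1)] unfolding ind(2) by blast
  then show ?thesis using P' PC by linarith
qed

lemma codim_ge_of_surj:
  assumes lin: "Vector_Spaces.linear scale scale T"
    and B: "fin_span B" "A \<subseteq> B" and B': "fin_span B'" "A' \<subseteq> B'" "subspace A'"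
    and im: "\<And>x. x \<in> A \<Longrightarrow> T x \<in> A'"
    and surj: "\<And>y. y \<in> B' \<Longrightarrow> \<exists>x\<in>B. y - T x \<in> A'"
  shows "local.dim B' + local.dim A \<le> local.dim B + local.dim A'"
proof -
  interpret T: Vector_Spaces.linear scale scale T by (rule lin)
  obtain P C where PC: "P \<subseteq> A" "C \<subseteq> B" "independent (P \<union> C)" "A \<subseteq> span P"
    "B \<subseteq> span (P \<union> C)" "finite P" "finite C" "P \<inter> C = {}" "card P = local.dim A" "card P + card C = local.dim B"
    by (rule extend_basis[OF B(1,2)])
  obtain P' where P': "P' \<subseteq> A'" "independent P'" "A' \<subseteq> span P'" "card P' = local.dim A'" 
    by (rule basis_exists)
  have fP': "finite P'" by (rule fin_span_independent(1)[OF B'(1) _ P'(2)]) (use P'(1) B'(2) in blast)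
  have spA': "span P' = A'" by (rule span_subspace[OF P'(1,3) B'(3)])
  have "B' \<subseteq> span (P' \<union> T ` C)"
  proof
    fix y assume "y \<in> B'"
    then obtain x where x: "x \<in> B" "y - T x \<in> A'" using surj by blast
    have "T x \<in> span (T ` (P \<union> C))" using x PC(5) T.span_image by blast
    also have "T ` (P \<union> C) \<subseteq> span (P' \<union> T ` C)"
    proof -
      have "T ` P \<subseteq> A'" using PC(1) im by blast
      also have "A' \<subseteq> span (P' \<union> T ` C)" using P'(3) span_mono[of P' "P' \<union> T ` C"] by blast
      finally show ?thesis by (auto simp: span_base)
    qed
    then have "span (T ` (P \<union> C)) \<subseteq> span (P' \<union> T ` C)" by (simp add: span_minimal)
    finally have 1: "T x \<in> span (P' \<union> T ` C)" .
    have "y - T x \<in> span (P' \<union> T ` C)" using x(2) P'(3) span_mono[of P' "P' \<union> T ` C"] by blast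
    from span_add[OF this 1] show "y \<in> span (P' \<union> T ` C)" by simp
  qed
  then have "local.dim B' \<le> card (P' \<union> T ` C)" using dim_le_card fP' PC(7) by blast
  also have "\<dots> \<le> card P' + card C" by (meson card_Un_le card_image_le PC(7) add_left_mono order_trans)
  finally show ?thesis using P' PC by linarith
qed

text \<open>One half of the duality for a bilinear pairing; exchanging the arguments gives the
  other. The \<open>card C\<close> functionals coming from a complement \<open>C\<close> of the left
  kernel already cut out the right kernel, and each of them lowers the dimension by at most
  one.\<close>

lemma codim_bilinear_kernels:
  assumes V: "fin_span V" "subspace V" and W: "fin_span W" "subspace W"
    and lV: "\<And>w. w \<in> W \<Longrightarrow> Vector_Spaces.linear scale (*) (\<lambda>v. f v w)"
    and lW: "\<And>v. v \<in> V \<Longrightarrow> Vector_Spaces.linear scale (*) (\<lambda>w. f v w)"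
  defines "K \<equiv> {v\<in>V. \<forall>w\<in>W. f v w = 0}" and "L \<equiv> {w\<in>W. \<forall>v\<in>V. f v w = 0}"
  shows "local.dim W + local.dim K \<le> local.dim V + local.dim L"
proof -
  have KV: "K \<subseteq> V" unfolding K_def by blast
  obtain P C where PC: "P \<subseteq> K" "C \<subseteq> V" "independent (P \<union> C)" "K \<subseteq> span P"
    "V \<subseteq> span (P \<union> C)" "finite P" "finite C" "P \<inter> C = {}" "card P = local.dim K" "card P + card C = local.dim V"
    by (rule extend_basis[OF V(1) KV])
  define M where "M = (\<lambda>D. {w\<in>W. \<forall>c\<in>D. f c w = 0})"
  have subM: "subspace (M D)" if "D \<subseteq> V" for D
  proof -
    have "f c 0 = 0" "f c (x + y) = f c x + f c y" "f c (scale r x) = r * f c x" if "c \<in> D" for c x y r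
    proof -
      interpret c: Vector_Spaces.linear scale "(*)" "\<lambda>w. f c w" using that \<open>D \<subseteq> V\<close> lW by blast
      show "f c 0 = 0" "f c (x + y) = f c x + f c y" "f c (scale r x) = r * f c x"
        by (simp_all add: c.add c.scale)
    qed
    then show ?thesis unfolding M_def using W(2) by (auto simp: subspace_def)
  qed
  have "local.dim W \<le> local.dim (M D) + card D" if "finite D" "D \<subseteq> V" for D
    using that
  proof (induction D rule: finite_induct)
    case empty then show ?case by (simp add: M_def)
  next
    case (insert c D)
    interpret c: Vector_Spaces.linear scale "(*)" "\<lambda>w. f c w" using insert.prems lW by blast
    have MW: "fin_span (M D)" using W(1) fin_span_mono unfolding M_def by fastforce
    have sub: "M (insert c D) \<subseteq> M D" unfolding M_def by blast
    have "local.dim (M D) \<le> local.dim (M (insert c D)) + 1"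
    proof (cases "M (insert c D) = M D")
      case False
      then obtain w0 where w0: "w0 \<in> M D" "f c w0 \<noteq> 0" unfolding M_def by blast
      obtain Q where Q: "Q \<subseteq> M (insert c D)" "independent Q" "M (insert c D) \<subseteq> span Q"
        "card Q = local.dim (M (insert c D))" by (rule basis_exists)
      have fQ: "finite Q" by (rule fin_span_independent(1)[OF MW _ Q(2)]) (use Q(1) sub in blast)
      have "M D \<subseteq> span (insert w0 Q)"
      proof
        fix w assume w: "w \<in> M D"
        let ?r = "f c w / f c w0"
        have "f c (w - scale ?r w0) = 0" using w0 by (simp add: c.diff c.scale)
        moreover have "w - scale ?r w0 \<in> M D" using w w0 subM insert.prems
          by (meson subspace_diff subspace_scale insert_subset)
        ultimately have "w - scale ?r w0 \<in> M (insert c D)" unfolding M_def by auto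
        then have "w - scale ?r w0 \<in> span Q" using Q by blast
        then show "w \<in> span (insert w0 Q)" using span_breakdown_eq by blast
      qed
      then have "local.dim (M D) \<le> card (insert w0 Q)" using dim_le_card fQ by blast
      also have "\<dots> \<le> card Q + 1" using fQ by (simp add: card_insert_if)
      finally show ?thesis using Q by simp
    qed simp
    then show ?case using insert by auto
  qed
  from this[OF PC(7,2)] have d: "local.dim W \<le> local.dim (M C) + card C" .
  have "M C \<subseteq> L"
  proof
    fix w assume w: "w \<in> M C"
    then have wW: "w \<in> W" by (simp add: M_def)
    interpret c: Vector_Spaces.linear scale "(*)" "\<lambda>v. f v w" using wW lV by blast
    have "subspace {v. f v w = 0}" by (auto simp: subspace_def c.add c.scale)
    moreover have "P \<union> C \<subseteq> {v. f v w = 0}" using PC(1) w unfolding K_def M_def by blast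
    ultimately have "span (P \<union> C) \<subseteq> {v. f v w = 0}" by (simp add: span_minimal)
    then show "w \<in> L" unfolding L_def using wW PC(5) by blast
  qed
  moreover have "fin_span L" using W(1) fin_span_mono unfolding L_def by fastforce
  ultimately have "local.dim (M C) \<le> local.dim L" by (simp add: dim_mono_fin)
  then show ?thesis using d PC by linarith
qed

end

subsection \<open>Homogeneous ideals and Hilbert functions\<close>

lemma pscale_eq: "pscale c p = Poly_Mapping.single 0 c * p"
  unfolding pscale_def by (rule mult_map_scale_conv_mult)

interpretation pm: vspace "pscale :: 'k::field \<Rightarrow> 'k mpoly \<Rightarrow> 'k mpoly"
  by unfold_locales (simp_all add: pscale_eq algebra_simps single_add mult_single flip: mult.assoc)

lemma lookup_pscale: "Poly_Mapping.lookup (pscale c p) m = c * Poly_Mapping.lookup p m"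
  unfolding pscale_def by (simp add: Poly_Mapping.map.rep_eq when_def)

lemma linear_mult: "Vector_Spaces.linear pscale pscale (\<lambda>p::'k::field mpoly. a * p)"
  by unfold_locales (simp_all add: pscale_eq algebra_simps)

lemma mdeg_eq_sum: "finite A \<Longrightarrow> Poly_Mapping.keys m \<subseteq> A \<Longrightarrow> mdeg m = (\<Sum>i\<in>A. Poly_Mapping.lookup m i)"
  unfolding mdeg_def by (rule sum.mono_neutral_left) (auto simp: in_keys_iff)

lemma keys_add_nat: "Poly_Mapping.keys (m + m') = Poly_Mapping.keys m \<union> Poly_Mapping.keys (m' :: 'a \<Rightarrow>\<^sub>0 nat)"
  by (auto simp: in_keys_iff lookup_add)

lemma mdeg_add [simp]: "mdeg (m + m') = mdeg m + mdeg m'"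
proof -
  let ?A = "Poly_Mapping.keys m \<union> Poly_Mapping.keys m'"
  have "mdeg (m + m') = (\<Sum>i\<in>?A. Poly_Mapping.lookup (m + m') i)"
    by (rule mdeg_eq_sum) (auto simp: keys_add_nat)
  moreover have "mdeg m = (\<Sum>i\<in>?A. Poly_Mapping.lookup m i)" "mdeg m' = (\<Sum>i\<in>?A. Poly_Mapping.lookup m' i)"
    by (auto intro: mdeg_eq_sum)
  ultimately show ?thesis by (simp add: lookup_add sum.distrib)
qed

lemma mdeg_0 [simp]: "mdeg 0 = 0" by (simp add: mdeg_def)
lemma mdeg_single [simp]: "mdeg (Poly_Mapping.single i e) = e" by (simp add: mdeg_def)
lemma mdeg_eq_0_iff [simp]: "mdeg m = 0 \<longleftrightarrow> m = 0"
proof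
  assume "mdeg m = 0"
  then show "m = 0" unfolding mdeg_def by (intro poly_mapping_eqI) (auto simp: in_keys_iff)
qed simp

lemma PR_0 [simp]: "0 \<in> PR V" by (simp add: PR_def)
lemma PR_1 [simp]: "1 \<in> PR V" by (simp add: PR_def)
lemma PR_add: "p \<in> PR V \<Longrightarrow> q \<in> PR V \<Longrightarrow> p + q \<in> PR V"
  unfolding PR_def using keys_add[of p q] by blast
lemma PR_uminus: "p \<in> PR V \<Longrightarrow> - p \<in> PR V"
  unfolding PR_def by simp
lemma PR_diff: "p \<in> PR V \<Longrightarrow> q \<in> PR V \<Longrightarrow> p - q \<in> PR V"
  using PR_add[of p V "-q"] PR_uminus[of q V] by simp
lemma PR_mult: "p \<in> PR V \<Longrightarrow> q \<in> PR V \<Longrightarrow> p * q \<in> PR V"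
  unfolding PR_def using keys_mult[of p q] by (fastforce simp: keys_add_nat)
lemma PR_single: "Poly_Mapping.keys m \<subseteq> V \<Longrightarrow> Poly_Mapping.single m c \<in> PR V"
  by (simp add: PR_def)
lemma PR_pscale: "p \<in> PR V \<Longrightarrow> pscale c p \<in> PR V"
  unfolding pscale_eq by (intro PR_mult PR_single) auto
lemma PR_power: "p \<in> PR V \<Longrightarrow> p ^ k \<in> PR V"
  by (induction k) (auto intro: PR_mult)

lemma homog_0 [simp]: "homog d 0" by (simp add: homog_def)
lemma homog_1 [simp]: "homog 0 1" by (simp add: homog_def)
lemma homog_add: "homog d p \<Longrightarrow> homog d q \<Longrightarrow> homog d (p + q)"
  unfolding homog_def using keys_add[of p q] by blast
lemma homog_uminus: "homog d p \<Longrightarrow> homog d (- p)"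
  unfolding homog_def by simp
lemma homog_diff: "homog d p \<Longrightarrow> homog d q \<Longrightarrow> homog d (p - q)"
  using homog_add[of d p "-q"] homog_uminus[of d q] by simp
lemma homog_mult: "homog d p \<Longrightarrow> homog e q \<Longrightarrow> homog (d + e) (p * q)"
  unfolding homog_def using keys_mult[of p q] by fastforce
lemma homog_single: "mdeg m = d \<Longrightarrow> homog d (Poly_Mapping.single m c)"
  by (simp add: homog_def)
lemma homog_pscale: "homog d p \<Longrightarrow> homog d (pscale c p)"
  unfolding pscale_eq using homog_mult[OF homog_single[of 0 0 c]] by simp
lemma keys_nonempty: "p \<noteq> 0 \<Longrightarrow> \<exists>m. m \<in> Poly_Mapping.keys p"
  by (metis in_keys_iff lookup_zero poly_mapping_eqI)

section \<open>Homogeneous components\<close>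

definition hcomp :: "nat \<Rightarrow> 'k::field mpoly \<Rightarrow> 'k mpoly" where
  "hcomp j p = (\<Sum>m\<in>{m\<in>Poly_Mapping.keys p. mdeg m = j}. Poly_Mapping.single m (Poly_Mapping.lookup p m))"

lemma lookup_hcomp: "Poly_Mapping.lookup (hcomp j p) m = (if mdeg m = j then Poly_Mapping.lookup p m else 0)"
proof -
  have "Poly_Mapping.lookup (hcomp j p) m =
     (\<Sum>m'\<in>{m\<in>Poly_Mapping.keys p. mdeg m = j}. if m' = m then Poly_Mapping.lookup p m else 0)"
    unfolding hcomp_def lookup_sum by (rule sum.cong) (auto simp: lookup_single when_def)
  then show ?thesis by (auto simp: in_keys_iff)
qed

lemma hcomp_add: "hcomp j (p + q) = hcomp j p + hcomp j q"
  by (rule poly_mapping_eqI) (simp add: lookup_hcomp lookup_add)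
lemma hcomp_0 [simp]: "hcomp j 0 = 0"
  by (rule poly_mapping_eqI) (simp add: lookup_hcomp)
lemma hcomp_sum: "hcomp j (sum f A) = (\<Sum>i\<in>A. hcomp j (f i))"
  by (induction A rule: infinite_finite_induct) (auto simp: hcomp_add)
lemma keys_hcomp: "Poly_Mapping.keys (hcomp j p) = {m\<in>Poly_Mapping.keys p. mdeg m = j}"
  by (auto simp: in_keys_iff lookup_hcomp split: if_splits)
lemma homog_hcomp [simp]: "homog j (hcomp j p)"
  by (simp add: homog_def keys_hcomp)
lemma PR_hcomp: "p \<in> PR V \<Longrightarrow> hcomp j p \<in> PR V"
  by (simp add: PR_def keys_hcomp)
lemma hcomp_homog: "homog d p \<Longrightarrow> hcomp j p = (if j = d then p else 0)"
  unfolding homog_def by (intro poly_mapping_eqI) (auto simp: lookup_hcomp in_keys_iff)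

lemma sum_hcomp: "\<exists>N. p = (\<Sum>j\<le>N. hcomp j p)"
proof
  let ?N = "Max (insert 0 (mdeg ` Poly_Mapping.keys p))"
  show "p = (\<Sum>j\<le>?N. hcomp j p)"
  proof (rule poly_mapping_eqI)
    fix m
    have "mdeg m \<le> ?N" if "Poly_Mapping.lookup p m \<noteq> 0"
      using that by (intro Max_ge) (auto simp: in_keys_iff)
    then show "Poly_Mapping.lookup p m = Poly_Mapping.lookup (\<Sum>j\<le>?N. hcomp j p) m"
      by (auto simp: lookup_sum lookup_hcomp)
  qed
qed

lemma hcomp_mult_left: 
  assumes "homog e a"
  shows "hcomp j (p * a) = (if e \<le> j then hcomp (j - e) p * a else 0)"
proof -
  obtain N where N: "p = (\<Sum>i\<le>N. hcomp i p)" using sum_hcomp by blast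
  have "p * a = (\<Sum>i\<le>N. hcomp i p * a)" by (subst N) (simp add: sum_distrib_right)
  then have "hcomp j (p * a) = (\<Sum>i\<le>N. hcomp j (hcomp i p * a))" by (simp add: hcomp_sum)
  also have "\<dots> = (\<Sum>i\<le>N. if j = i + e then hcomp i p * a else 0)"
    by (intro sum.cong refl hcomp_homog homog_mult homog_hcomp assms)
  also have "\<dots> = (\<Sum>i\<le>N. if e \<le> j then hcomp (j - e) (hcomp i p) * a else 0)"
    by (rule sum.cong) (auto simp: hcomp_homog[OF homog_hcomp])
  also have "\<dots> = (if e \<le> j then hcomp (j - e) (\<Sum>i\<le>N. hcomp i p) * a else 0)"
    by (simp add: hcomp_sum sum_distrib_right)
  finally show ?thesis using N by simp
qed

lemma graded_piece_iff: "p \<in> graded_piece V j \<longleftrightarrow> p \<in> PR V \<and> homog j p"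
  by (simp add: graded_piece_def)

section \<open>Monomial bases of graded pieces\<close>

definition mons :: "nat set \<Rightarrow> nat \<Rightarrow> (nat \<Rightarrow>\<^sub>0 nat) set" where
  "mons V j = {m. Poly_Mapping.keys m \<subseteq> V \<and> mdeg m = j}"

lemma mons_le_bound:
  assumes "finite V"
  shows "finite {m. Poly_Mapping.keys m \<subseteq> V \<and> mdeg m \<le> j}"
    and "card {m. Poly_Mapping.keys m \<subseteq> V \<and> mdeg m \<le> j} \<le> (j + 1) ^ card V"
proof -
  let ?A = "{m. Poly_Mapping.keys m \<subseteq> V \<and> mdeg m \<le> j}"
  let ?f = "\<lambda>m :: nat \<Rightarrow>\<^sub>0 nat. restrict (Poly_Mapping.lookup m) V"
  have inj: "inj_on ?f ?A"
  proof (rule inj_onI)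
    fix m m' assume a: "m \<in> ?A" "m' \<in> ?A" "?f m = ?f m'"
    show "m = m'"
    proof (rule poly_mapping_eqI)
      fix i show "Poly_Mapping.lookup m i = Poly_Mapping.lookup m' i"
      proof (cases "i \<in> V")
        case True then show ?thesis using fun_cong[OF a(3), of i] by simp
      next
        case False
        then have "i \<notin> Poly_Mapping.keys m" "i \<notin> Poly_Mapping.keys m'" using a(1,2) by auto
        then show ?thesis by (simp add: in_keys_iff)
      qed
    qed
  qed
  have im: "?f ` ?A \<subseteq> PiE V (\<lambda>_. {0..j})"
  proof
    fix g assume "g \<in> ?f ` ?A"
    then obtain m where m: "m \<in> ?A" "g = ?f m" by blast
    have "Poly_Mapping.lookup m i \<le> j" if "i \<in> V" for i
    proof -
      have "Poly_Mapping.lookup m i \<le> (\<Sum>i\<in>V. Poly_Mapping.lookup m i)"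
        using that assms by (intro member_le_sum) auto
      then show ?thesis using m(1) mdeg_eq_sum[OF assms, of m] by simp
    qed
    then show "g \<in> PiE V (\<lambda>_. {0..j})" using m(2) by auto
  qed
  have f: "finite (PiE V (\<lambda>_. {0..j}))" using assms by (intro finite_PiE) auto
  show "finite ?A" using inj im f by (meson finite_imageD finite_subset)
  have "card ?A \<le> card (PiE V (\<lambda>_. {0..j}))" using card_inj_on_le[OF inj im f] .
  then show "card ?A \<le> (j + 1) ^ card V" using assms by (simp add: card_PiE)
qed

lemma finite_mons: "finite V \<Longrightarrow> finite (mons V j)"
  unfolding mons_def by (rule finite_subset[OF _ mons_le_bound(1)[of V j]]) auto

lemma poly_eq_sum_pscale: "p = (\<Sum>m\<in>Poly_Mapping.keys p. pscale (Poly_Mapping.lookup p m) (Poly_Mapping.single m 1))"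
proof (rule poly_mapping_eqI)
  fix m
  show "Poly_Mapping.lookup p m = Poly_Mapping.lookup (\<Sum>m\<in>Poly_Mapping.keys p. pscale (Poly_Mapping.lookup p m) (Poly_Mapping.single m 1)) m"
    by (simp add: lookup_sum lookup_pscale lookup_single when_def in_keys_iff if_distrib[of "\<lambda>x. _ * x"] cong: if_cong)
qed

lemma in_span_keys: "Poly_Mapping.keys p \<subseteq> M \<Longrightarrow> p \<in> pm.span ((\<lambda>m. Poly_Mapping.single m 1) ` M)"
  by (subst poly_eq_sum_pscale[of p]) (intro pm.span_sum pm.span_scale pm.span_base, auto)

lemma inj_single1: "inj_on (\<lambda>m. Poly_Mapping.single m (1::'k::field)) A"
  by (rule inj_onI) (metis keys_single singleton_inject zero_neq_one)

lemma independent_monomials: "pm.independent ((\<lambda>m. Poly_Mapping.single m (1::'k::field)) ` M)"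
  unfolding pm.dependent_explicit
proof clarify
  fix T u v 
  assume T: "finite T" "T \<subseteq> (\<lambda>m. Poly_Mapping.single m (1::'k)) ` M" and s: "(\<Sum>v\<in>T. pscale (u v) v) = 0" 
   and "v \<in> T" "u v \<noteq> 0"
  then obtain m where m: "v = Poly_Mapping.single m 1" by blast
  have "0 = Poly_Mapping.lookup (\<Sum>v\<in>T. pscale (u v) v) m" using s by simp
  also have "\<dots> = (\<Sum>w\<in>T. if w = v then u v else 0)"
    unfolding lookup_sum
  proof (rule sum.cong)
    fix w assume "w \<in> T"
    then obtain m' where w: "w = Poly_Mapping.single m' 1" using T by blast
    moreover have "w = v \<longleftrightarrow> m' = m" unfolding w m using inj_single1[of UNIV] by (metis UNIV_I inj_onD)
    ultimately show "Poly_Mapping.lookup (pscale (u w) w) m = (if w = v then u v else 0)"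
      by (auto simp: lookup_pscale lookup_single when_def)
  qed simp
  also have "\<dots> = u v" using T \<open>v \<in> T\<close> by simp
  finally show False using \<open>u v \<noteq> 0\<close> by simp
qed

lemma graded_piece_span: "(graded_piece V j :: 'k::field mpoly set) = pm.span ((\<lambda>m. Poly_Mapping.single m 1) ` mons V j)"
proof
  show "graded_piece V j \<subseteq> pm.span ((\<lambda>m. Poly_Mapping.single m (1::'k)) ` mons V j)"
    by (auto intro!: in_span_keys simp: graded_piece_def PR_def homog_def mons_def)
  show "pm.span ((\<lambda>m. Poly_Mapping.single m 1) ` mons V j) \<subseteq> (graded_piece V j :: 'k mpoly set)"
    by (rule pm.span_minimal)
      (auto simp: pm.subspace_def graded_piece_iff mons_def intro: PR_single homog_single PR_add homog_add PR_pscale homog_pscale)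
qed

lemma kdim_graded_piece: "finite V \<Longrightarrow> kdim (graded_piece V j :: 'k::field mpoly set) = card (mons V j)"
  unfolding kdim_def graded_piece_span
  by (simp only: pm.dim_span_eq_card_independent[OF independent_monomials] card_image[OF inj_single1])

lemma subspace_graded_piece: "pm.subspace (graded_piece V j)"
  unfolding graded_piece_span by (rule pm.subspace_span)

lemma fin_span_graded_piece: "finite V \<Longrightarrow> pm.fin_span (graded_piece V j)"
  unfolding graded_piece_span pm.fin_span_def using finite_mons[of V j] by (intro exI[of _ "(\<lambda>m. Poly_Mapping.single m 1) ` mons V j"]) auto

section \<open>Homogeneous ideals, sums with a principal ideal, colon ideals\<close>

lemma is_idealD:
  assumes "is_ideal V I"
  shows "I \<subseteq> PR V" "0 \<in> I" "a \<in> I \<Longrightarrow> b \<in> I \<Longrightarrow> a + b \<in> I" "r \<in> PR V \<Longrightarrow> a \<in> I \<Longrightarrow> r * a \<in> I"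
    "a \<in> I \<Longrightarrow> - a \<in> I" "a \<in> I \<Longrightarrow> b \<in> I \<Longrightarrow> a - b \<in> I" "r \<in> PR V \<Longrightarrow> a \<in> I \<Longrightarrow> a * r \<in> I"
proof -
  note d = assms[unfolded is_ideal_def]
  show "I \<subseteq> PR V" "0 \<in> I" "a \<in> I \<Longrightarrow> b \<in> I \<Longrightarrow> a + b \<in> I" "r \<in> PR V \<Longrightarrow> a \<in> I \<Longrightarrow> r * a \<in> I"
    using d by blast+
  show "r \<in> PR V \<Longrightarrow> a \<in> I \<Longrightarrow> a * r \<in> I" using d by (metis mult.commute)
  have neg: "- b \<in> I" if "b \<in> I" for b
  proof -
    have "(-1) * b \<in> I" using d that PR_uminus[OF PR_1] by blast
    then show ?thesis by simp
  qed
  then show "a \<in> I \<Longrightarrow> - a \<in> I" .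
  show "a \<in> I \<Longrightarrow> b \<in> I \<Longrightarrow> a - b \<in> I" using neg[of b] d by (metis add_uminus_conv_diff)
qed

lemma ideal_sum: "is_ideal V I \<Longrightarrow> (\<And>i. i \<in> A \<Longrightarrow> f i \<in> I) \<Longrightarrow> sum f A \<in> I"
  by (induction A rule: infinite_finite_induct) (auto intro: is_idealD)

lemma ideal_pscale: "is_ideal V I \<Longrightarrow> a \<in> I \<Longrightarrow> pscale c a \<in> I"
  unfolding pscale_eq by (rule is_idealD(4)) (auto intro: PR_single)

lemma subspace_ideal: "is_ideal V I \<Longrightarrow> pm.subspace I"
  by (auto simp: pm.subspace_def intro: is_idealD ideal_pscale)

lemma ideal_eq_PR_iff: "is_ideal V I \<Longrightarrow> I = PR V \<longleftrightarrow> 1 \<in> I"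
  using is_idealD(4)[of V I _ 1] is_idealD(1)[of V I] by fastforce

definition hideal :: "nat set \<Rightarrow> 'k::field mpoly set \<Rightarrow> bool" where
  "hideal V I \<longleftrightarrow> is_ideal V I \<and> (\<forall>p\<in>I. \<forall>j. hcomp j p \<in> I)"

lemma hideal_ideal [simp]: "hideal V I \<Longrightarrow> is_ideal V I"
  and hideal_hcomp: "hideal V I \<Longrightarrow> p \<in> I \<Longrightarrow> hcomp j p \<in> I"
  by (auto simp: hideal_def)

lemma hideal_zero: "hideal V {0}" by (auto simp: hideal_def is_ideal_def)
lemma hideal_comp_notin:
  assumes "is_ideal V I" "p \<notin> I"
  obtains j where "hcomp j p \<notin> I"
  using sum_hcomp[of p] ideal_sum[OF assms(1)] assms(2) by metis

definition iadd :: "nat set \<Rightarrow> 'k::field mpoly set \<Rightarrow> 'k mpoly \<Rightarrow> 'k mpoly set" where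
  "iadd V I a = {p + r * a | p r. p \<in> I \<and> r \<in> PR V}"

definition colon :: "nat set \<Rightarrow> 'k::field mpoly set \<Rightarrow> 'k mpoly \<Rightarrow> 'k mpoly set" where
  "colon V I a = {p \<in> PR V. p * a \<in> I}"

lemma iaddI: "p \<in> I \<Longrightarrow> r \<in> PR V \<Longrightarrow> p + r * a \<in> iadd V I a" by (auto simp: iadd_def)
lemma iaddE: assumes "x \<in> iadd V I a" obtains p r where "x = p + r * a" "p \<in> I" "r \<in> PR V"
  using assms by (auto simp: iadd_def)

lemma iadd_superset: "I \<subseteq> iadd V I a" 
  using iaddI[of _ I 0 V a] by fastforce
lemma iadd_mem: "is_ideal V I \<Longrightarrow> a \<in> iadd V I a"
  using iaddI[of 0 I 1 V a] is_idealD(2) by fastforce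

lemma is_ideal_iadd:
  fixes a :: "'k::field mpoly"
  assumes I: "is_ideal V I" and a: "a \<in> PR V"
  shows "is_ideal V (iadd V I a)"
  unfolding is_ideal_def
proof (intro conjI ballI subsetI)
  fix x assume "x \<in> iadd V I a"
  then show "x \<in> PR V" using I a is_idealD(1) by (auto elim!: iaddE intro!: PR_add PR_mult)
next
  show "0 \<in> iadd V I a" using iadd_superset is_idealD(2)[OF I] by blast
next
  fix x y assume "x \<in> iadd V I a" "y \<in> iadd V I a"
  then obtain p r q s where e: "x = p + r * a" "p \<in> I" "r \<in> PR V" "y = q + s * a" "q \<in> I" "s \<in> PR V"
    by (auto elim!: iaddE)
  have "x + y = (p + q) + (r + s) * a" using e by (simp add: algebra_simps)
  then show "x + y \<in> iadd V I a" using iaddI[OF is_idealD(3)[OF I e(2,5)] PR_add[OF e(3,6)]] by simp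
next
  fix r x :: "'k mpoly" assume r: "r \<in> PR V" "x \<in> iadd V I a"
  then obtain p s where e: "x = p + s * a" "p \<in> I" "s \<in> PR V" by (auto elim!: iaddE)
  have "r * x = r * p + (r * s) * a" using e by (simp add: algebra_simps)
  then show "r * x \<in> iadd V I a" using iaddI[OF is_idealD(4)[OF I r(1) e(2)] PR_mult[OF r(1) e(3)]] by simp
qed

lemma hideal_iadd:
  assumes I: "hideal V I" and a: "a \<in> PR V" "homog e a"
  shows "hideal V (iadd V I a)"
  unfolding hideal_def
proof (intro conjI ballI allI)
  show "is_ideal V (iadd V I a)" by (rule is_ideal_iadd[OF hideal_ideal[OF I] a(1)])
  fix x j assume "x \<in> iadd V I a"
  then obtain p r where e: "x = p + r * a" "p \<in> I" "r \<in> PR V" by (auto elim!: iaddE)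
  have "hcomp j x = hcomp j p + (if e \<le> j then hcomp (j - e) r else 0) * a"
    unfolding e hcomp_add hcomp_mult_left[OF a(2)] by simp
  moreover have "(if e \<le> j then hcomp (j - e) r else 0) \<in> PR V" using e by (simp add: PR_hcomp)
  ultimately show "hcomp j x \<in> iadd V I a" using iaddI[OF hideal_hcomp[OF I e(2)]] by simp
qed

lemma iadd_least: "is_ideal V J \<Longrightarrow> I \<subseteq> J \<Longrightarrow> a \<in> J \<Longrightarrow> iadd V I a \<subseteq> J"
  by (auto elim!: iaddE intro: is_idealD)

lemma iadd_commute: "iadd V (iadd V I a) b = iadd V (iadd V I b) a"
proof -
  have "iadd V (iadd V I a) b \<subseteq> iadd V (iadd V I b) a" for a b
  proof
    fix x assume "x \<in> iadd V (iadd V I a) b"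
    then obtain p r s where e: "x = (p + r * a) + s * b" "p \<in> I" "r \<in> PR V" "s \<in> PR V"
      by (auto elim!: iaddE)
    then have "x = (p + s * b) + r * a" by (simp add: algebra_simps)
    then show "x \<in> iadd V (iadd V I b) a" using iaddI[OF iaddI[OF e(2,4)] e(3)] by simp
  qed
  then show ?thesis by blast
qed

lemma iadd_absorb: "is_ideal V I \<Longrightarrow> a \<in> I \<Longrightarrow> iadd V I a = I"
  using iadd_least[of V I I a] iadd_superset[of I V a] by blast

lemma is_ideal_colon: 
  assumes I: "is_ideal V I" shows "is_ideal V (colon V I a)"
  unfolding is_ideal_def colon_def using I
  by (auto simp: distrib_right mult.assoc intro: PR_add PR_mult is_idealD)

lemma colon_superset: "is_ideal V I \<Longrightarrow> a \<in> PR V \<Longrightarrow> I \<subseteq> colon V I a"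
  using is_idealD(1)[of V I] by (auto simp: colon_def intro: is_idealD)

lemma hideal_colon:
  assumes I: "hideal V I" and a: "homog e a"
  shows "hideal V (colon V I a)"
  unfolding hideal_def
proof (intro conjI ballI allI)
  show "is_ideal V (colon V I a)" by (rule is_ideal_colon[OF hideal_ideal[OF I]])
  fix x j assume x: "x \<in> colon V I a"
  then have "hcomp (j + e) (x * a) \<in> I" using I by (auto simp: colon_def intro: hideal_hcomp)
  then have "hcomp j x * a \<in> I" using hcomp_mult_left[OF a, of "j + e" x] by simp
  then show "hcomp j x \<in> colon V I a" using x by (simp add: colon_def PR_hcomp)
qed

lemma colon_colon: "a \<in> PR V \<Longrightarrow> colon V (colon V I a) b = colon V I (b * a)"
  if "b \<in> PR V" using that by (auto simp: colon_def mult.assoc intro: PR_mult)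

lemma colon_mono: "I \<subseteq> J \<Longrightarrow> colon V I a \<subseteq> colon V J a" by (auto simp: colon_def)

lemma colon_eq_PR_iff: "is_ideal V I \<Longrightarrow> a \<in> PR V \<Longrightarrow> colon V I a = PR V \<longleftrightarrow> a \<in> I"
  unfolding ideal_eq_PR_iff[OF is_ideal_colon] by (simp add: colon_def)

lemma ideal_gen_empty: "ideal_gen V {} = {0}"
  by (auto simp: ideal_gen_def)

lemma ideal_gen_insert: "ideal_gen V (insert a A) = iadd V (ideal_gen V A) a"
proof
  show "ideal_gen V (insert a A) \<subseteq> iadd V (ideal_gen V A) a"
  proof
    fix x assume "x \<in> ideal_gen V (insert a A)"
    then obtain F c where F: "x = (\<Sum>a\<in>F. c a * a)" "finite F" "F \<subseteq> insert a A" "\<forall>a\<in>F. c a \<in> PR V"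
      by (auto simp: ideal_gen_def)
    have m: "(\<Sum>b\<in>F - {a}. c b * b) \<in> ideal_gen V A" using F by (auto simp: ideal_gen_def)
    have "x = (\<Sum>b\<in>F - {a}. c b * b) + (if a \<in> F then c a else 0) * a"
      using F(1,2) by (auto simp: sum.remove add.commute)
    moreover have "(if a \<in> F then c a else 0) \<in> PR V" using F(4) by simp
    ultimately show "x \<in> iadd V (ideal_gen V A) a" using iaddI[OF m] by simp
  qed
  show "iadd V (ideal_gen V A) a \<subseteq> ideal_gen V (insert a A)"
  proof
    fix x assume "x \<in> iadd V (ideal_gen V A) a"
    then obtain F c r where F: "x = (\<Sum>a\<in>F. c a * a) + r * a" "finite F" "F \<subseteq> A" "\<forall>a\<in>F. c a \<in> PR V" "r \<in> PR V"
      by (auto simp: ideal_gen_def iadd_def)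
    let ?c = "\<lambda>b. if b = a then (if a \<in> F then c a else 0) + r else c b"
    have "x = (\<Sum>b\<in>insert a F. ?c b * b)"
    proof -
      have "(\<Sum>b\<in>insert a F. ?c b * b) = ?c a * a + (\<Sum>b\<in>F - {a}. ?c b * b)"
        using F(2) by (simp add: sum.insert_remove)
      also have "(\<Sum>b\<in>F - {a}. ?c b * b) = (\<Sum>b\<in>F - {a}. c b * b)" by (rule sum.cong) auto
      finally show ?thesis using F(1,2) by (auto simp: sum.remove[of F a] algebra_simps)
    qed
    moreover have "\<forall>b\<in>insert a F. ?c b \<in> PR V" using F by (auto intro: PR_add)
    ultimately show "x \<in> ideal_gen V (insert a A)"
      unfolding ideal_gen_def using F(2,3) by (intro CollectI exI[of _ "insert a F"] exI[of _ ?c]) auto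
  qed
qed

section \<open>Hilbert functions and multiplication by a form\<close>

lemma HF_add: "finite V \<Longrightarrow> HF V I j + kdim (I \<inter> graded_piece V j) = kdim (graded_piece V j :: 'k mpoly set)"
  for I :: "'k::field mpoly set"
  unfolding HF_def kdim_def using pm.dim_mono_fin[OF fin_span_graded_piece, of V "I \<inter> graded_piece V j" j] by simp

lemma HF_eq_0_iff:
  fixes I :: "'k::field mpoly set"
  assumes V: "finite V" and I: "is_ideal V I"
  shows "HF V I j = 0 \<longleftrightarrow> graded_piece V j \<subseteq> I"
proof
  assume "HF V I j = 0"
  then have "kdim (graded_piece V j :: 'k mpoly set) \<le> kdim (I \<inter> graded_piece V j)" using HF_add[OF V, of I j] by simp
  then have "I \<inter> graded_piece V j = graded_piece V j" unfolding kdim_def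
    using I by (intro pm.subspace_eq_of_dim fin_span_graded_piece V pm.subspace_inter subspace_ideal[of V] subspace_graded_piece) auto
  then show "graded_piece V j \<subseteq> I" by blast
next
  assume "graded_piece V j \<subseteq> I"
  then have "I \<inter> graded_piece V j = graded_piece V j" by blast
  then show "HF V I j = 0" by (simp add: HF_def)
qed

lemma HF_mono: "finite V \<Longrightarrow> I \<subseteq> J \<Longrightarrow> HF V J j \<le> HF V I j"
  unfolding HF_def kdim_def
  by (intro diff_le_mono2 pm.dim_mono_fin pm.fin_span_mono[OF fin_span_graded_piece]) auto

lemma graded_piece_mult: "p \<in> graded_piece V i \<Longrightarrow> q \<in> graded_piece V j \<Longrightarrow> p * q \<in> graded_piece V (i + j)"
  by (auto simp: graded_piece_iff intro: PR_mult homog_mult)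

text \<open>Multiplication by \<open>a\<close> identifies \<open>S/(I : a)\<close>, shifted by
  \<open>e\<close>, with the kernel of the projection from \<open>S/I\<close> to
  \<open>S/(I + (a))\<close>. The two inequalities express injectivity and surjectivity onto that
  kernel.\<close>

lemma HF_split:
  fixes I :: "'k::field mpoly set"
  assumes V: "finite V" and I: "hideal V I" and a: "a \<in> PR V" "homog e a"
  shows "HF V I (j + e) = HF V (iadd V I a) (j + e) + HF V (colon V I a) j"
proof -
  let ?B = "graded_piece V j :: 'k mpoly set" and ?A = "colon V I a \<inter> graded_piece V j"
  let ?B' = "iadd V I a \<inter> graded_piece V (j + e)" and ?A' = "I \<inter> graded_piece V (j + e)"
  have hi: "is_ideal V I" "is_ideal V (iadd V I a)" "is_ideal V (colon V I a)"
    using I a hideal_iadd hideal_colon hideal_ideal by blast+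
  have AB': "?A' \<subseteq> ?B'" using iadd_superset by blast
  have sA': "pm.subspace ?A'" by (intro pm.subspace_inter subspace_graded_piece subspace_ideal[OF hi(1)])
  have mult: "a * x \<in> graded_piece V (j + e)" if "x \<in> ?B" for x
    using that graded_piece_mult[of x V j a e] a by (simp add: graded_piece_iff mult.commute)
  have fB': "pm.fin_span ?B'" using pm.fin_span_mono[OF fin_span_graded_piece[OF V]] by blast
  have fB: "pm.fin_span ?B" using fin_span_graded_piece[OF V] by blast
  have 1: "pm.dim ?B + pm.dim ?A' \<le> pm.dim ?B' + pm.dim ?A"
  proof (rule pm.codim_le_of_inj[OF linear_mult[of a]])
    fix x assume x: "x \<in> ?B"
    have "a * x \<in> iadd V I a" using x hi(2) iadd_mem[OF hi(1)] a
      by (auto simp: graded_piece_iff intro: is_idealD)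
    then show "a * x \<in> ?B'" using mult[OF x] by blast
    show "x \<in> ?A" if "a * x \<in> ?A'" using that x by (auto simp: colon_def graded_piece_iff mult.commute)
  qed (use fB fB' AB' sA' subspace_graded_piece in auto)
  have 2: "pm.dim ?B' + pm.dim ?A \<le> pm.dim ?B + pm.dim ?A'"
  proof (rule pm.codim_ge_of_surj[OF linear_mult[of a]])
    fix x assume "x \<in> ?A"
    then show "a * x \<in> ?A'" using mult[of x] by (simp add: colon_def mult.commute[of a])
  next
    fix y assume y: "y \<in> ?B'"
    then obtain p r where e: "y = p + r * a" "p \<in> I" "r \<in> PR V" by (auto elim!: iaddE)
    \<comment> \<open>Only degree \<open>j + e\<close> matters, so the cofactor \<open>r\<close> may
      be replaced by its component of degree \<open>j\<close>.\<close>
    have "y = hcomp (j + e) y" using y hcomp_homog[of "j + e" y] by (simp add: graded_piece_iff)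
    also have "\<dots> = hcomp (j + e) p + hcomp j r * a" unfolding e hcomp_add hcomp_mult_left[OF a(2)] by simp
    finally have y': "y - a * hcomp j r = hcomp (j + e) p" by (simp add: mult.commute)
    have "hcomp (j + e) p \<in> ?A'" using e(2) I is_idealD(1)[OF hi(1)]
      by (auto simp: graded_piece_iff intro: hideal_hcomp PR_hcomp)
    then show "\<exists>x\<in>?B. y - a * x \<in> ?A'" using y' e(3) PR_hcomp by (intro bexI[of _ "hcomp j r"]) (auto simp: graded_piece_iff)
  qed (use fB fB' AB' sA' subspace_graded_piece in auto)
  show ?thesis
    using 1 2 HF_add[OF V, of I "j + e"] HF_add[OF V, of "iadd V I a" "j + e"] HF_add[OF V, of "colon V I a" j]
    unfolding kdim_def by linarith
qed

lemma HF_iadd_low: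
  fixes I :: "'k::field mpoly set"
  assumes V: "finite V" and I: "hideal V I" and a: "a \<in> PR V" "homog e a" and j: "j < e"
  shows "HF V (iadd V I a) j = HF V I j"
proof -
  have "iadd V I a \<inter> graded_piece V j = I \<inter> graded_piece V j"
  proof (intro equalityI subsetI)
    fix y assume y: "y \<in> iadd V I a \<inter> graded_piece V j"
    then obtain p r where e: "y = p + r * a" "p \<in> I" by (auto elim!: iaddE)
    have "y = hcomp j y" using y hcomp_homog[of j y] by (simp add: graded_piece_iff)
    also have "\<dots> = hcomp j p" unfolding e hcomp_add hcomp_mult_left[OF a(2)] using j by simp
    finally show "y \<in> I \<inter> graded_piece V j" using y e(2) I hideal_hcomp by fastforce
  qed (use iadd_superset in blast)
  then show ?thesis by (simp add: HF_def)
qed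

text \<open>\<open>multiplicity\<close> is defined through these partial sums. Their eventual
  polynomial has the dimension as its degree, so artinian quotients have degree 0 and dimension zero
  needs no separate convention.\<close>

definition HF_sum :: "nat set \<Rightarrow> 'k::field mpoly set \<Rightarrow> nat \<Rightarrow> nat" where
  "HF_sum V I j = (\<Sum>i\<le>j. HF V I i)"

lemma HF_sum_mono: "finite V \<Longrightarrow> I \<subseteq> J \<Longrightarrow> HF_sum V J j \<le> HF_sum V I j"
  unfolding HF_sum_def by (intro sum_mono HF_mono)

lemma HF_sum_mono2: "i \<le> j \<Longrightarrow> HF_sum V I i \<le> HF_sum V I j"
  unfolding HF_sum_def by (intro sum_mono2) auto

lemma HF_sum_split:
  fixes I :: "'k::field mpoly set"
  assumes V: "finite V" and I: "hideal V I" and a: "a \<in> PR V" "homog e a"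
  shows "HF_sum V I (j + e) = HF_sum V (iadd V I a) (j + e) + HF_sum V (colon V I a) j"
    and "j < e \<Longrightarrow> HF_sum V I j = HF_sum V (iadd V I a) j"
proof -
  show low: "HF_sum V I j = HF_sum V (iadd V I a) j" if "j < e" for j
    unfolding HF_sum_def using that by (intro sum.cong) (auto simp: HF_iadd_low[OF assms])
  show "HF_sum V I (j + e) = HF_sum V (iadd V I a) (j + e) + HF_sum V (colon V I a) j"
  proof (induction j)
    case 0
    have s: "HF_sum V J e = (\<Sum>i<e. HF V J i) + HF V J e" for J :: "'k mpoly set"
      unfolding HF_sum_def by (simp add: lessThan_Suc_atMost[symmetric])
    have "(\<Sum>i<e. HF V (iadd V I a) i) = (\<Sum>i<e. HF V I i)"
      by (intro sum.cong) (auto simp: HF_iadd_low[OF assms])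
    then show ?case using HF_split[OF assms, of 0] s[of I] s[of "iadd V I a"] by (simp add: HF_sum_def)
  next
    case (Suc j)
    then show ?case using HF_split[OF assms, of "Suc j"] by (simp add: HF_sum_def)
  qed
qed

subsection \<open>Ascending chains of homogeneous ideals\<close>

text \<open>The indices whose value is a minimum of all later values form an infinite set, and along
  it the sequence is weakly increasing.\<close>

lemma nat_seq_mono_subseq:
  fixes s :: "nat \<Rightarrow> nat"
  obtains r :: "nat \<Rightarrow> nat" where "strict_mono r" "mono (s \<circ> r)"
proof -
  define A where "A = {i. \<forall>j\<ge>i. s i \<le> s j}"
  have "\<exists>i\<ge>N. i \<in> A" for N
  proof -
    obtain i where i: "i \<ge> N" "\<And>j. j \<ge> N \<Longrightarrow> s i \<le> s j"
      using exists_least_lemma[of "\<lambda>k. \<exists>i\<ge>N. s i = k"] arg_min_nat_lemma[of "\<lambda>i. i \<ge> N" N s] by auto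
    then show ?thesis unfolding A_def by (intro exI[of _ i]) auto
  qed
  then have "infinite A" by (simp add: infinite_nat_iff_unbounded_le)
  then have "strict_mono (enumerate A)" "\<And>i. enumerate A i \<in> A"
    using strict_mono_enumerate enumerate_in_set by blast+
  then show thesis
    by (intro that[of "enumerate A"]) (auto simp: mono_def A_def strict_mono_less_eq)
qed

lemma finite_family_mono_subseq:
  fixes g :: "nat \<Rightarrow> 'v \<Rightarrow> nat"
  assumes "finite V"
  shows "\<exists>r :: nat \<Rightarrow> nat. strict_mono r \<and> (\<forall>v\<in>V. mono (\<lambda>i. g (r i) v))"
  using assms
proof (induction V rule: finite_induct)
  case empty
  show ?case by (intro exI[of _ id]) (auto simp: strict_mono_def)
next
  case (insert v V)
  then obtain r :: "nat \<Rightarrow> nat" where r: "strict_mono r" "\<forall>v\<in>V. mono (\<lambda>i. g (r i) v)" by blast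
  obtain q :: "nat \<Rightarrow> nat" where q: "strict_mono q" "mono ((\<lambda>i. g (r i) v) \<circ> q)"
    by (rule nat_seq_mono_subseq[of "\<lambda>i. g (r i) v"])
  have "mono (\<lambda>i. g (r (q i)) w)" if "w \<in> V" for w
    using r(2) that q(1) by (auto simp: mono_def strict_mono_less_eq)
  then show ?case using r(1) q by (intro exI[of _ "r \<circ> q"]) (auto simp: strict_mono_def comp_def)
qed

lemma dickson:
  fixes f :: "nat \<Rightarrow> (nat \<Rightarrow>\<^sub>0 nat)"
  assumes V: "finite V" and f: "\<And>i. Poly_Mapping.keys (f i) \<subseteq> V"
  obtains i j m where "i < j" "f j = f i + m" "Poly_Mapping.keys m \<subseteq> V"
proof -
  obtain r :: "nat \<Rightarrow> nat" where r: "strict_mono r" "\<forall>v\<in>V. mono (\<lambda>i. Poly_Mapping.lookup (f (r i)) v)"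
    using finite_family_mono_subseq[OF V, of "\<lambda>i. Poly_Mapping.lookup (f i)"] by blast
  have le: "Poly_Mapping.lookup (f (r 0)) v \<le> Poly_Mapping.lookup (f (r 1)) v" for v
  proof (cases "v \<in> V")
    case True then show ?thesis using r(2) by (auto simp: mono_def)
  next
    case False then show ?thesis using f[of "r 0"] by (metis in_keys_iff le0 subsetD)
  qed
  show thesis
  proof (rule that)
    show "r 0 < r 1" using r(1) by (simp add: strict_mono_def)
    show "f (r 1) = f (r 0) + (f (r 1) - f (r 0))"
      by (rule poly_mapping_eqI) (use le in \<open>simp add: lookup_add lookup_minus\<close>)
    show "Poly_Mapping.keys (f (r 1) - f (r 0)) \<subseteq> V"
      using f[of "r 1"] by (auto simp: in_keys_iff lookup_minus)
  qed
qed

lemma lookup_single_mult: 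
  "Poly_Mapping.lookup (Poly_Mapping.single m c * p) (m + k) = c * Poly_Mapping.lookup (p :: 'k::field mpoly) k"
proof -
  have "Poly_Mapping.single m c * p = (\<Sum>l\<in>Poly_Mapping.keys p. Poly_Mapping.single (m + l) (c * Poly_Mapping.lookup p l))"
    by (subst poly_eq_sum_pscale[of p]) (simp add: pscale_eq sum_distrib_left mult_single)
  then have "Poly_Mapping.lookup (Poly_Mapping.single m c * p) (m + k)
     = (\<Sum>l\<in>Poly_Mapping.keys p. if l = k then c * Poly_Mapping.lookup p l else 0)"
    unfolding lookup_sum by (auto simp: lookup_sum lookup_single when_def intro!: sum.cong)
  then show ?thesis by (simp add: in_keys_iff)
qed

lemma keys_single_mult: "Poly_Mapping.keys (Poly_Mapping.single m c * p) \<subseteq> (+) m ` Poly_Mapping.keys (p :: 'k::field mpoly)"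
  using keys_mult[of "Poly_Mapping.single m c" p] by (auto split: if_splits)

text \<open>Take \<open>p\<^sub>i \<in> I\<^sub>i\<^sub>+\<^sub>1 - I\<^sub>i\<close> of fixed degree with least leading monomial; by Dickson's lemma some \<open>p\<^sub>j\<close> can be
  reduced by an earlier \<open>p\<^sub>i\<close>, against minimality.\<close>
lemma hideal_ascending_chain:
  fixes I :: "nat \<Rightarrow> 'k::field mpoly set"
  assumes V: "finite V" and I: "\<And>i. hideal V (I i)" "\<And>i. I i \<subset> I (Suc i)"
  shows False
proof -
  let ?lm = "\<lambda>p :: 'k mpoly. Max (Poly_Mapping.keys p)"
  have II: "is_ideal V (I i)" for i using I(1) by simp
  have mono: "i \<le> j \<Longrightarrow> I i \<subseteq> I j" for i j
    using lift_Suc_mono_le[of I i j] I(2) by (simp add: psubset_imp_subset)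
  have "\<exists>p d. p \<in> I (Suc i) \<and> p \<notin> I i \<and> homog d p \<and>
      (\<forall>q. q \<in> I (Suc i) \<and> q \<notin> I i \<and> homog d q \<longrightarrow> ?lm p \<le> ?lm q)" for i
  proof -
    obtain p where p: "p \<in> I (Suc i)" "p \<notin> I i" using I(2) by blast
    then obtain d where d: "hcomp d p \<notin> I i" using hideal_comp_notin[OF II] by blast
    define A where "A = {q. q \<in> I (Suc i) \<and> q \<notin> I i \<and> homog d q}"
    have ne: "A \<noteq> {}" using d hideal_hcomp[OF I(1) p(1)] unfolding A_def by fastforce
    \<comment> \<open>A least leading monomial exists because only finitely many monomials have the
      fixed degree \<open>d\<close>.\<close>
    have "?lm ` A \<subseteq> mons V d"
    proof clarify
      fix q assume q: "q \<in> A"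
      then have "q \<noteq> 0" using is_idealD(2)[OF II] by (auto simp: A_def)
      then have "?lm q \<in> Poly_Mapping.keys q" using keys_nonempty[of q] by (intro Max_in) auto
      moreover have "q \<in> PR V" using q is_idealD(1)[OF II] by (auto simp: A_def)
      ultimately show "?lm q \<in> mons V d" using q by (auto simp: mons_def A_def homog_def PR_def)
    qed
    then have fin: "finite (?lm ` A)" using finite_mons[OF V] finite_subset by blast
    then have "Min (?lm ` A) \<in> ?lm ` A" using ne by (intro Min_in) auto
    then obtain q where q: "q \<in> A" "?lm q = Min (?lm ` A)" by auto
    then have "\<forall>q'\<in>A. ?lm q \<le> ?lm q'" using fin by auto
    then show ?thesis using q(1) unfolding A_def by blast
  qed
  then obtain p d where pd: "\<And>i. p i \<in> I (Suc i)" "\<And>i. p i \<notin> I i" "\<And>i. homog (d i) (p i)"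
      "\<And>i q. q \<in> I (Suc i) \<Longrightarrow> q \<notin> I i \<Longrightarrow> homog (d i) q \<Longrightarrow> ?lm (p i) \<le> ?lm q"
    by metis
  have nz: "p i \<noteq> 0" for i using pd(2)[of i] is_idealD(2)[OF II] by auto
  have lmk: "?lm (p i) \<in> Poly_Mapping.keys (p i)" for i using keys_nonempty[OF nz[of i]] by (intro Max_in) auto
  have pV: "p i \<in> PR V" for i using pd(1) is_idealD(1)[OF II] by blast
  have "Poly_Mapping.keys (?lm (p i)) \<subseteq> V" for i using lmk pV by (auto simp: PR_def)
  then obtain i j m where ij: "i < j" "?lm (p j) = ?lm (p i) + m" "Poly_Mapping.keys m \<subseteq> V"
    by (rule dickson[OF V, of "\<lambda>i. ?lm (p i)"])
  define c where "c = Poly_Mapping.lookup (p j) (?lm (p j)) / Poly_Mapping.lookup (p i) (?lm (p i))"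
  define s where "s = Poly_Mapping.single m c * p i"
  define q where "q = p j - s"
  have deg: "mdeg (?lm (p k)) = d k" for k using lmk pd(3) by (auto simp: homog_def)
  have "s \<in> I j" using mono[of "Suc i" j] ij pd(1)[of i] unfolding s_def
    by (intro is_idealD(4)[OF II] PR_single) auto
  then have q: "q \<in> I (Suc j)" "q \<notin> I j"
  proof -
    show "q \<in> I (Suc j)" unfolding q_def using pd(1) \<open>s \<in> I j\<close> mono[of j "Suc j"] II
      by (intro is_idealD(6)[OF II]) auto
    show "q \<notin> I j" unfolding q_def using pd(2)[of j] \<open>s \<in> I j\<close> is_idealD(3)[OF II, of "p j - s" j s] by auto
  qed
  have "homog (mdeg m + d i) s" unfolding s_def by (intro homog_mult homog_single pd refl)
  moreover have "mdeg m + d i = d j" using deg[of i] deg[of j] ij(2) by simp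
  ultimately have hq: "homog (d j) q" unfolding q_def using pd(3) by (auto intro: homog_diff)
  have "q \<noteq> 0" using q(2) is_idealD(2)[OF II] by auto
  then have qk: "?lm q \<in> Poly_Mapping.keys q" using keys_nonempty[of q] by (intro Max_in) auto
  have "Poly_Mapping.keys q \<subseteq> Poly_Mapping.keys (p j) \<union> Poly_Mapping.keys s"
    unfolding q_def by (auto simp: in_keys_iff lookup_minus)
  moreover have "k \<le> ?lm (p j)" if "k \<in> Poly_Mapping.keys s" for k
  proof -
    obtain l where l: "l \<in> Poly_Mapping.keys (p i)" "k = m + l"
      using keys_single_mult \<open>k \<in> _\<close> unfolding s_def by blast
    then have "l \<le> ?lm (p i)" by (intro Max_ge) auto
    then show ?thesis unfolding ij(2) l(2) by (simp add: add.commute[of m] add_right_mono)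
  qed
  moreover have "k \<le> ?lm (p j)" if "k \<in> Poly_Mapping.keys (p j)" for k using that by (intro Max_ge) auto
  ultimately have le: "?lm q \<le> ?lm (p j)" using qk by blast
  have "Poly_Mapping.lookup s (?lm (p j)) = c * Poly_Mapping.lookup (p i) (?lm (p i))"
    unfolding s_def ij(2) using lookup_single_mult[of m c "p i" "?lm (p i)"] by (simp add: add.commute)
  also have "\<dots> = Poly_Mapping.lookup (p j) (?lm (p j))" unfolding c_def using lmk[of i] by (simp add: in_keys_iff)
  finally have "Poly_Mapping.lookup q (?lm (p j)) = 0" unfolding q_def by (simp add: lookup_minus)
  then have "?lm q \<noteq> ?lm (p j)" using qk by (metis in_keys_iff)
  then show False using pd(4)[OF q hq] le by simp
qed

text \<open>Noetherian induction on homogeneous ideals. Replacing \<open>I\<close> by the larger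
  ideals \<open>I + (a)\<close> and \<open>I : a\<close> under it does the work usually done by
  primary decomposition.\<close>

lemma hideal_induct [consumes 2, case_names step]:
  fixes I :: "'k::field mpoly set"
  assumes V: "finite V" and I: "hideal V I"
    and step: "\<And>I. hideal V I \<Longrightarrow> (\<And>J. hideal V J \<Longrightarrow> I \<subset> J \<Longrightarrow> P J) \<Longrightarrow> P I"
  shows "P I"
proof -
  let ?r = "{(J, I :: 'k mpoly set). hideal V I \<and> hideal V J \<and> I \<subset> J}"
  have "wf ?r" unfolding wf_iff_no_infinite_down_chain
  proof
    assume "\<exists>f. \<forall>i. (f (Suc i), f i) \<in> ?r"
    then obtain f where "\<And>i. (f (Suc i), f i) \<in> ?r" by blast
    then have "\<And>i. hideal V (f i)" "\<And>i. f i \<subset> f (Suc i)" by auto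
    then show False by (rule hideal_ascending_chain[OF V])
  qed
  then show ?thesis using I
    by (induction I rule: wf_induct_rule) (use step in auto)
qed

lemma hideal_maximal:
  fixes I :: "'k::field mpoly set"
  assumes V: "finite V" and I: "hideal V I" "P I"
  obtains J where "hideal V J" "I \<subseteq> J" "P J" "\<And>K. hideal V K \<Longrightarrow> J \<subset> K \<Longrightarrow> \<not> P K"
  using V I
proof (induction I arbitrary: thesis rule: hideal_induct)
  case (step I)
  show ?case
  proof (cases "\<exists>K. hideal V K \<and> I \<subset> K \<and> P K")
    case True
    then obtain K where K: "hideal V K" "I \<subset> K" "P K" by blast
    show ?thesis
    proof (rule step.IH[OF K(1,2) _ K(3)])
      fix J assume "hideal V J" "K \<subseteq> J" "P J" "\<And>L. hideal V L \<Longrightarrow> J \<subset> L \<Longrightarrow> \<not> P L"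
      then show thesis using K(2) by (intro step.prems(1)[of J]) auto
    qed
  next
    case False
    then show ?thesis using step.prems step.hyps by blast
  qed
qed

subsection \<open>Hilbert polynomials\<close>

text \<open>Makes partial sums of polynomial sequences polynomial. The difference of
  \<open>x ^ Suc n\<close> is \<open>Suc n * x ^ n\<close> plus lower terms, and those have
  antidifferences by induction.\<close>

lemma power_antidifference: "\<exists>Q::real poly. \<forall>x. poly Q x - poly Q (x - 1) = x ^ n"
proof (induction n rule: less_induct)
  case (less n)
  then obtain Q :: "nat \<Rightarrow> real poly" where Q: "\<And>k x. k < n \<Longrightarrow> poly (Q k) x - poly (Q k) (x - 1) = x ^ k"
    by metis
  define c :: "nat \<Rightarrow> real" where "c k = real (Suc n choose k) * (-1) ^ (Suc n - k)" for k
  define R where "R = smult (1 / real (Suc n)) (monom 1 (Suc n) + (\<Sum>k<n. smult (c k) (Q k)))"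
  have "poly R x - poly R (x - 1) = x ^ n" for x
  proof -
    have "(x - 1) ^ Suc n = (\<Sum>k\<le>Suc n. c k * x ^ k)"
      using binomial_ring[of x "-1" "Suc n"] by (simp add: c_def mult_ac)
    also have "\<dots> = (\<Sum>k<n. c k * x ^ k) + c n * x ^ n + c (Suc n) * x ^ Suc n"
      by (simp add: lessThan_Suc_atMost[symmetric])
    also have "c n = - real (Suc n)" by (simp add: c_def)
    also have "c (Suc n) = 1" by (simp add: c_def)
    finally have e: "x ^ Suc n - (x - 1) ^ Suc n + (\<Sum>k<n. c k * x ^ k) = real (Suc n) * x ^ n"
      by (simp only: mult_minus_left mult_1_left)
    have "poly R x - poly R (x - 1) = (x ^ Suc n - (x - 1) ^ Suc n + (\<Sum>k<n. c k * (poly (Q k) x - poly (Q k) (x - 1)))) / real (Suc n)"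
      by (simp add: R_def poly_monom poly_sum sum_subtractf algebra_simps diff_divide_distrib add_divide_distrib)
    also have "(\<Sum>k<n. c k * (poly (Q k) x - poly (Q k) (x - 1))) = (\<Sum>k<n. c k * x ^ k)"
      using Q by (intro sum.cong) auto
    finally show ?thesis unfolding e by simp
  qed
  then show ?case by blast
qed

lemma poly_antidifference: "\<exists>Q::real poly. \<forall>x. poly Q x - poly Q (x - 1) = poly P x"
proof -
  obtain Q :: "nat \<Rightarrow> real poly" where Q: "\<And>k x. poly (Q k) x - poly (Q k) (x - 1) = x ^ k"
    using power_antidifference by metis
  have "poly (\<Sum>k\<le>degree P. smult (coeff P k) (Q k)) x - poly (\<Sum>k\<le>degree P. smult (coeff P k) (Q k)) (x - 1) = poly P x" for x
  proof -
    have "poly (\<Sum>k\<le>degree P. smult (coeff P k) (Q k)) x - poly (\<Sum>k\<le>degree P. smult (coeff P k) (Q k)) (x - 1)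
      = (\<Sum>k\<le>degree P. coeff P k * (poly (Q k) x - poly (Q k) (x - 1)))"
      by (simp add: poly_sum sum_subtractf algebra_simps)
    then show ?thesis unfolding Q by (simp only: poly_altdef)
  qed
  then show ?thesis by blast
qed

text \<open>Stated for every \<open>d\<close> that is at least the degree, so that the limit is 0
  when \<open>d\<close> is larger. In the final argument \<open>d\<close> is the Krull dimension, of
  which only a lower bound is established.\<close>

lemma tendsto_poly_div_power:
  assumes "degree (P::real poly) \<le> d"
  shows "(\<lambda>j. poly P (real j) / real j ^ d) \<longlonglongrightarrow> coeff P d"
proof -
  have t: "(\<lambda>j. real j ^ i / real j ^ d) \<longlonglongrightarrow> (if i = d then 1 else 0)" if "i \<le> d" for i
  proof -
    have "(\<lambda>j. (1 / real j) ^ (d - i)) \<longlonglongrightarrow> 0 ^ (d - i)"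
      by (intro tendsto_power lim_1_over_n)
    moreover have "\<forall>\<^sub>F j in sequentially. (1 / real j) ^ (d - i) = real j ^ i / real j ^ d"
      using eventually_gt_at_top[of 0]
    proof eventually_elim
      case (elim j)
      have "real j ^ d = real j ^ i * real j ^ (d - i)" using that by (simp flip: power_add)
      then show ?case using elim by (simp add: power_one_over)
    qed
    ultimately have "(\<lambda>j. real j ^ i / real j ^ d) \<longlonglongrightarrow> 0 ^ (d - i)" by (rule Lim_transform_eventually)
    moreover have "(0::real) ^ (d - i) = (if i = d then 1 else 0)" using that by (simp add: power_0_left)
    ultimately show ?thesis by simp
  qed
  have "(\<lambda>j. \<Sum>i\<le>d. coeff P i * (real j ^ i / real j ^ d)) \<longlonglongrightarrow> (\<Sum>i\<le>d. coeff P i * (if i = d then 1 else 0))"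
    by (intro tendsto_sum tendsto_mult tendsto_const t) auto
  moreover have "(\<Sum>i\<le>d. coeff P i * (if i = d then 1 else 0)) = coeff P d"
    by (simp add: if_distrib[of "\<lambda>x. _ * x"] cong: if_cong)
  moreover have "poly P x = (\<Sum>i\<le>d. coeff P i * x ^ i)" for x
    unfolding poly_altdef using assms by (intro sum.mono_neutral_left) (auto simp: coeff_eq_0)
  ultimately show ?thesis by (simp add: sum_divide_distrib)
qed

lemma degree_le_of_bound:
  fixes P :: "real poly"
  assumes "\<And>j. j \<ge> N \<Longrightarrow> 0 \<le> poly P (real j)" "\<And>j. j \<ge> N \<Longrightarrow> poly P (real j) \<le> C * (real j + 1) ^ t"
  shows "degree P \<le> t"
proof (rule ccontr)
  assume "\<not> degree P \<le> t"
  then have d: "degree P > t" by simp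
  let ?d = "degree P"
  have lim: "(\<lambda>j. poly P (real j) / real j ^ ?d) \<longlonglongrightarrow> lead_coeff P" by (rule tendsto_poly_div_power) simp
  let ?R = "smult C ([:1, 1:] ^ t)"
  have dR: "degree ?R \<le> t" by (intro order.trans[OF degree_smult_le] order.trans[OF degree_power_le]) simp
  have limR: "(\<lambda>j. poly ?R (real j) / real j ^ ?d) \<longlonglongrightarrow> 0"
  proof -
    have "coeff ?R ?d = 0" by (rule coeff_eq_0) (use dR d in linarith)
    then show ?thesis using tendsto_poly_div_power[of ?R ?d] dR d by (simp only: less_imp_le order.strict_trans1)
  qed
  have "lead_coeff P \<le> 0"
  proof (rule LIMSEQ_le[OF lim limR], intro exI[of _ N] allI impI)
    fix j assume "N \<le> j"
    then show "poly P (real j) / real j ^ ?d \<le> poly ?R (real j) / real j ^ ?d"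
      using assms(2)[of j] by (intro divide_right_mono) (auto simp: add.commute)
  qed
  moreover have "0 \<le> lead_coeff P"
    using lim by (rule LIMSEQ_le_const) (use assms(1) in \<open>auto intro!: exI[of _ N] divide_nonneg_nonneg\<close>)
  ultimately have "lead_coeff P = 0" by simp
  then show False using d by simp
qed

text \<open>The dimension of \<open>S/I\<close> is at most \<open>t\<close>, read off the Hilbert polynomial.\<close>
definition growth_le :: "nat set \<Rightarrow> 'k::field mpoly set \<Rightarrow> nat \<Rightarrow> bool" where
  "growth_le V I t \<longleftrightarrow> (\<exists>P::real poly. degree P \<le> t \<and> (\<exists>N. \<forall>j\<ge>N. real (HF_sum V I j) = poly P (real j)))"

lemma growth_mono: "growth_le V I t \<Longrightarrow> t \<le> s \<Longrightarrow> growth_le V I s"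
  unfolding growth_le_def using order.trans by blast

lemma xpow_PR: "v \<in> V \<Longrightarrow> xpow v e \<in> PR V"
  unfolding xpow_def by (rule PR_single) auto
lemma homog_xpow: "homog e (xpow v e)"
  unfolding xpow_def by (rule homog_single) simp

lemma monomial_divide_var:
  "v \<in> Poly_Mapping.keys m \<Longrightarrow> m = (m - Poly_Mapping.single v (1::nat)) + Poly_Mapping.single v 1"
  by (intro poly_mapping_eqI) (auto simp: lookup_add lookup_minus lookup_single when_def in_keys_iff)

lemma mem_of_variables:
  assumes I: "is_ideal V I" and x: "\<And>v. v \<in> V \<Longrightarrow> xpow v 1 \<in> I" and p: "p \<in> PR V" "Poly_Mapping.lookup p 0 = 0"
  shows "p \<in> I"
proof -
  have "Poly_Mapping.single m (1::'a) \<in> I" if m: "m \<in> Poly_Mapping.keys p" for m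
  proof -
    have "m \<noteq> 0" using m p(2) by (auto simp: in_keys_iff)
    then obtain v where v: "v \<in> Poly_Mapping.keys m" using in_keys_iff[of _ m] by (metis poly_mapping_eqI lookup_zero)
    have mV: "Poly_Mapping.keys m \<subseteq> V" using m p(1) by (auto simp: PR_def)
    note e = monomial_divide_var[OF v]
    have "Poly_Mapping.single m (1::'a) = Poly_Mapping.single (m - Poly_Mapping.single v 1) 1 * xpow v 1"
      unfolding xpow_def mult_single using e by simp
    moreover have "Poly_Mapping.keys (m - Poly_Mapping.single v 1) \<subseteq> V"
      using mV by (auto simp: in_keys_iff lookup_minus)
    ultimately show ?thesis using I x[of v] v mV by (auto intro: is_idealD(4) PR_single)
  qed
  then show ?thesis
    by (subst poly_eq_sum_pscale[of p]) (intro ideal_sum[OF I] ideal_pscale[OF I])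
qed

text \<open>Mostly used contrapositively: where the growth is not bounded by 0, some variable lies
  outside the ideal.\<close>

lemma growth_0_of_variables:
  assumes I: "is_ideal V I" and x: "\<And>v. v \<in> V \<Longrightarrow> xpow v 1 \<in> I"
  shows "growth_le V I 0"
proof -
  have "HF V I j = 0" if "j \<ge> 1" for j
  proof -
    have "graded_piece V j \<subseteq> I"
    proof
      fix p :: "'a mpoly" assume p: "p \<in> graded_piece V j"
      have "0 \<notin> Poly_Mapping.keys p" using p \<open>j \<ge> 1\<close> by (auto simp: graded_piece_iff homog_def)
      then have "Poly_Mapping.lookup p 0 = 0" by (simp add: in_keys_iff)
      then show "p \<in> I" using mem_of_variables[OF I x] p by (auto simp: graded_piece_iff)
    qed
    then have "I \<inter> graded_piece V j = graded_piece V j" by blast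
    then show ?thesis by (simp add: HF_def)
  qed
  then have "HF_sum V I j = HF V I 0" for j unfolding HF_sum_def by (induction j) auto
  then show ?thesis unfolding growth_le_def by (intro exI[of _ "[:real (HF V I 0):]"]) auto
qed

text \<open>For a variable \<open>x\<close> outside \<open>I\<close>, the ideal
  \<open>I + (x)\<close> is larger. If \<open>I : x\<close> is larger as well, the two Hilbert
  polynomials add up after a shift. Otherwise the differences of \<open>HF_sum\<close> for
  \<open>I\<close> are its values for \<open>I + (x)\<close>, and an antidifference sums
  them.\<close>

lemma growth_exists:
  fixes I :: "'k::field mpoly set"
  assumes V: "finite V" and I: "hideal V I"
  shows "\<exists>t. growth_le V I t"
  using assms
proof (induction I rule: hideal_induct)
  case (step I)
  show ?case
  proof (cases "\<forall>v\<in>V. xpow v 1 \<in> I")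
    case True
    then show ?thesis using growth_0_of_variables[of V I] step.hyps by auto
  next
    case False
    then obtain v where v: "v \<in> V" "xpow v 1 \<notin> I" by blast
    define x :: "'k mpoly" where "x = xpow v 1"
    have x: "x \<in> PR V" "homog 1 x" "x \<notin> I" unfolding x_def using v xpow_PR homog_xpow by auto
    have hi: "is_ideal V I" using step.hyps by simp
    have "I \<subset> iadd V I x" using iadd_superset iadd_mem[OF hi, of x] x(3) by blast
    then obtain P1 N1 where P1: "\<And>j. j \<ge> N1 \<Longrightarrow> real (HF_sum V (iadd V I x) j) = poly P1 (real j)"
      using step.IH[OF hideal_iadd[OF step.hyps x(1,2)]] unfolding growth_le_def by blast
    note split = HF_sum_split(1)[OF V step.hyps x(1,2)]
    show ?thesis
    proof (cases "colon V I x = I")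
      case True
      obtain Q where Q: "\<And>y. poly Q y - poly Q (y - 1) = poly P1 y" using poly_antidifference by blast
      define c where "c = real (HF_sum V I N1) - poly Q (real N1)"
      have "real (HF_sum V I (N1 + k)) = poly (Q + [:c:]) (real (N1 + k))" for k
      proof (induction k)
        case (Suc k)
        have "poly Q (real (N1 + Suc k)) = poly Q (real (N1 + k)) + poly P1 (real (N1 + Suc k))"
          using Q[of "real (N1 + Suc k)"] by simp
        then show ?case using Suc split[of "N1 + k"] True P1[of "N1 + Suc k"] by simp
      qed (simp add: c_def)
      then have "\<forall>j\<ge>N1. real (HF_sum V I j) = poly (Q + [:c:]) (real j)" by (metis le_Suc_ex)
      then show ?thesis unfolding growth_le_def by blast
    next
      case False
      then have "I \<subset> colon V I x" using colon_superset[OF hi x(1)] by blast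
      then obtain P2 N2 where P2: "\<And>j. j \<ge> N2 \<Longrightarrow> real (HF_sum V (colon V I x) j) = poly P2 (real j)"
        using step.IH[OF hideal_colon[OF step.hyps x(2)]] unfolding growth_le_def by blast
      have "\<forall>j\<ge>N1 + N2 + 1. real (HF_sum V I j) = poly (P1 + pcompose P2 [:-1, 1:]) (real j)"
      proof (intro allI impI)
        fix j assume j: "j \<ge> N1 + N2 + 1"
        then obtain i where i: "j = i + 1" by (metis add.commute le_Suc_ex add.assoc)
        then have "real j - 1 = real i" by simp
        then show "real (HF_sum V I j) = poly (P1 + pcompose P2 [:-1, 1:]) (real j)"
          using split[of i] P1[of j] P2[of i] i j by (simp add: poly_pcompose)
      qed
      then show ?thesis unfolding growth_le_def by blast
    qed
  qed
qed

lemma growth_bound: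
  assumes "growth_le V I t"
  obtains C where "C \<ge> 0" "\<And>j. real (HF_sum V I j) \<le> C * (real j + 1) ^ t"
proof -
  obtain P N where P: "degree P \<le> t" "\<And>j. j \<ge> N \<Longrightarrow> real (HF_sum V I j) = poly P (real j)"
    using assms unfolding growth_le_def by blast
  define A where "A = (\<Sum>i\<le>degree P. \<bar>coeff P i\<bar>)"
  have A0: "A \<ge> 0" unfolding A_def by (intro sum_nonneg) auto
  have "real (HF_sum V I j) \<le> (A + real (HF_sum V I N)) * (real j + 1) ^ t" for j
  proof (cases "j \<ge> N")
    case True
    have "poly P (real j) \<le> (\<Sum>i\<le>degree P. \<bar>coeff P i\<bar> * (real j + 1) ^ t)"
      unfolding poly_altdef
    proof (rule sum_mono)
      fix i assume "i \<in> {..degree P}"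
      then have i: "i \<le> t" using P(1) by simp
      have "coeff P i * real j ^ i \<le> \<bar>coeff P i\<bar> * real j ^ i" by (intro mult_right_mono) auto
      also have "real j ^ i \<le> (real j + 1) ^ i" by (intro power_mono) auto
      also have "(real j + 1) ^ i \<le> (real j + 1) ^ t" using i by (intro power_increasing) auto
      finally show "coeff P i * real j ^ i \<le> \<bar>coeff P i\<bar> * (real j + 1) ^ t" by (simp add: mult_left_mono)
    qed
    also have "\<dots> = A * (real j + 1) ^ t" by (simp add: A_def sum_distrib_right)
    also have "\<dots> \<le> (A + real (HF_sum V I N)) * (real j + 1) ^ t" by (intro mult_right_mono) auto
    finally show ?thesis using P(2) True by simp
  next
    case False
    then have "real (HF_sum V I j) \<le> real (HF_sum V I N)" using HF_sum_mono2[of j N V I] by simp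
    also have "\<dots> \<le> (A + real (HF_sum V I N)) * 1" using A0 by simp
    also have "\<dots> \<le> (A + real (HF_sum V I N)) * (real j + 1) ^ t" using A0 by (intro mult_left_mono one_le_power) auto
    finally show ?thesis .
  qed
  then show thesis using A0 by (intro that[of "A + real (HF_sum V I N)"]) auto
qed

text \<open>Since a Hilbert polynomial is known to exist, a power bound for \<open>HF_sum\<close>
  bounds its degree. Together with \<open>growth_bound\<close> this turns comparisons of growth into
  inequalities.\<close>

lemma growth_leI:
  fixes I :: "'k::field mpoly set"
  assumes V: "finite V" and I: "hideal V I" and b: "\<And>j. real (HF_sum V I j) \<le> C * (real j + 1) ^ t"
  shows "growth_le V I t"
proof -
  obtain P N where P: "\<And>j. j \<ge> N \<Longrightarrow> real (HF_sum V I j) = poly P (real j)"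
    using growth_exists[OF V I] unfolding growth_le_def by blast
  have "degree P \<le> t"
    by (rule degree_le_of_bound[of N P C]) (use P b in \<open>auto simp flip: P\<close>)
  then show ?thesis unfolding growth_le_def using P by blast
qed

lemma growth_superset:
  assumes "finite V" "hideal V J" "growth_le V I t" "I \<subseteq> J"
  shows "growth_le V J t"
proof -
  obtain C where C: "\<And>j. real (HF_sum V I j) \<le> C * (real j + 1) ^ t" using growth_bound[OF assms(3)] by blast
  show ?thesis
    by (rule growth_leI[OF assms(1,2)]) (rule order.trans[OF _ C], simp add: HF_sum_mono[OF assms(1,4)])
qed

text \<open>As \<open>I\<close> is contained in \<open>I : a\<close>, the value of
  \<open>HF_sum\<close> for \<open>I\<close> at \<open>j\<close> exceeds its value at
  \<open>j - e\<close> by at most the value for \<open>I + (a)\<close> at \<open>j\<close>. At most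
  \<open>j + 1\<close> such bounds are added, which costs one power of \<open>j + 1\<close>.\<close>

lemma growth_of_iadd:
  assumes V: "finite V" and I: "hideal V I" and a: "a \<in> PR V" "homog e a" "e \<ge> 1" and g: "growth_le V (iadd V I a) t"
  shows "growth_le V I (Suc t)"
proof -
  obtain C where C: "C \<ge> 0" "\<And>j. real (HF_sum V (iadd V I a) j) \<le> C * (real j + 1) ^ t" using growth_bound[OF g] by blast
  have hi: "is_ideal V I" using I by simp
  have "real (HF_sum V I j) \<le> C * (real j + 1) ^ t * (real j + 1)" for j
  proof (induction j rule: less_induct)
    case (less j)
    show ?case
    proof (cases "j < e")
      case True
      have "real (HF_sum V I j) \<le> C * (real j + 1) ^ t * 1" using C(2)[of j] HF_sum_split(2)[OF V I a(1,2) True] by simp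
      also have "\<dots> \<le> C * (real j + 1) ^ t * (real j + 1)" using C(1) by (intro mult_left_mono) auto
      finally show ?thesis .
    next
      case False
      then obtain i where i: "j = i + e" by (metis add.commute le_Suc_ex linorder_not_less)
      have "HF_sum V I j \<le> HF_sum V (iadd V I a) j + HF_sum V I i"
        unfolding i HF_sum_split(1)[OF V I a(1,2)] using HF_sum_mono[OF V colon_superset[OF hi a(1)]] by simp
      then have "real (HF_sum V I j) \<le> real (HF_sum V (iadd V I a) j) + real (HF_sum V I i)" by (simp flip: of_nat_add)
      also have "\<dots> \<le> C * (real j + 1) ^ t + C * (real i + 1) ^ t * (real i + 1)"
        using C(2)[of j] less[of i] i a(3) by (intro add_mono) auto
      also have "C * (real i + 1) ^ t * (real i + 1) \<le> C * (real j + 1) ^ t * real j"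
        using C(1) i a(3) by (intro mult_mono power_mono) auto
      finally show ?thesis by (simp add: algebra_simps)
    qed
  qed
  then have "\<And>j. real (HF_sum V I j) \<le> C * (real j + 1) ^ Suc t" by (simp add: mult_ac)
  then show ?thesis by (rule growth_leI[OF V I])
qed

lemma degree_difference: "degree (P - pcompose P [:- e, 1:]) \<le> degree P - 1" for e :: real
proof (cases "degree P = 0")
  case True
  then obtain c where "P = [:c:]" by (rule degree_eq_zeroE)
  then show ?thesis by simp
next
  case False
  let ?Q = "pcompose P [:- e, 1:]"
  have dQ: "degree ?Q = degree P" by (simp add: degree_pcompose)
  have lQ: "lead_coeff ?Q = lead_coeff P" by (simp add: lead_coeff_comp)
  show ?thesis
  proof (rule degree_le, intro allI impI)
    fix i assume "degree P - 1 < i"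
    then consider "i = degree P" | "i > degree P" using False by linarith
    then show "coeff (P - ?Q) i = 0"
    proof cases
      case 1 then show ?thesis using lQ dQ by simp
    next
      case 2 then show ?thesis using dQ by (simp add: coeff_eq_0)
    qed
  qed
qed

text \<open>For a regular form the exact count is \<open>P(j) - P(j - e)\<close>, a polynomial of
  smaller degree. When \<open>t = 0\<close> the truncated \<open>t - 1\<close> gives no drop;
  \<open>growth_0_drop\<close> treats that case.\<close>

lemma growth_drop:
  assumes V: "finite V" and I: "hideal V I" and a: "a \<in> PR V" "homog e a" and nzd: "colon V I a = I"
    and g: "growth_le V I t"
  shows "growth_le V (iadd V I a) (t - 1)"
proof -
  obtain P N where P: "degree P \<le> t" "\<And>j. j \<ge> N \<Longrightarrow> real (HF_sum V I j) = poly P (real j)"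
    using g unfolding growth_le_def by blast
  let ?Q = "P - pcompose P [:- real e, 1:]"
  have "degree ?Q \<le> t - 1" using degree_difference[of P "real e"] P(1) by linarith
  moreover have "\<forall>j\<ge>N + e. real (HF_sum V (iadd V I a) j) = poly ?Q (real j)"
  proof (intro allI impI)
    fix j assume j: "j \<ge> N + e"
    then obtain i where i: "j = i + e" by (metis add.commute add_leE le_Suc_ex)
    have r: "real j - real e = real i" using i by simp
    have "real (HF_sum V I j) = real (HF_sum V (iadd V I a) j) + real (HF_sum V I i)"
      using HF_sum_split(1)[OF V I a, of i] nzd i by simp
    then show "real (HF_sum V (iadd V I a) j) = poly ?Q (real j)"
      using P(2)[of j] P(2)[of i] i j by (simp add: poly_pcompose r)
  qed
  ultimately show ?thesis unfolding growth_le_def by blast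
qed

text \<open>If the partial sums become constant, regularity of \<open>a\<close> makes those of
  \<open>I + (a)\<close> vanish. So the Hilbert function of \<open>I + (a)\<close> is 0 in degree 0,
  where \<open>I\<close> and \<open>I + (a)\<close> agree because \<open>e \<ge> 1\<close>.\<close>

lemma growth_0_drop:
  assumes V: "finite V" and I: "hideal V I" and a: "a \<in> PR V" "homog e a" "e \<ge> 1" and nzd: "colon V I a = I"
    and g: "growth_le V I 0"
  shows "I = PR V"
proof -
  obtain P N where P: "degree P \<le> 0" "\<And>j. j \<ge> N \<Longrightarrow> real (HF_sum V I j) = poly P (real j)"
    using g unfolding growth_le_def by blast
  obtain c where c: "P = [:c:]" using P(1) by (auto elim: degree_eq_zeroE)
  have "HF_sum V I (N + e) = HF_sum V I N" using P(2)[of N] P(2)[of "N + e"] c by simp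
  then have "HF_sum V (iadd V I a) (N + e) = 0" using HF_sum_split(1)[OF V I a(1,2), of N] nzd by simp
  then have "HF V (iadd V I a) 0 = 0" unfolding HF_sum_def by simp
  then have h0: "HF V I 0 = 0" using HF_iadd_low[OF V I a(1,2)] a(3) by simp
  then have "graded_piece V 0 \<subseteq> I" using HF_eq_0_iff[OF V, of I 0] I by simp
  moreover have "1 \<in> graded_piece V 0" by (simp add: graded_piece_iff)
  ultimately show ?thesis using ideal_eq_PR_iff[of V I] I by auto
qed

subsection \<open>Regular sequences of generic linear forms\<close>

text \<open>Compare the highest components of \<open>a\<close> and \<open>b\<close> that lie outside
  \<open>I\<close>. In degree \<open>i + k\<close> every other term of \<open>a * b\<close> has a
  factor of higher degree than these, and that factor lies in \<open>I\<close>.\<close>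

lemma prime_ideal_of_homog:
  fixes I :: "'k::field mpoly set"
  assumes I: "hideal V I" "I \<noteq> PR V"
    and pr: "\<And>a b d e. a \<in> PR V \<Longrightarrow> homog d a \<Longrightarrow> b \<in> PR V \<Longrightarrow> homog e b \<Longrightarrow> a * b \<in> I \<Longrightarrow> a \<in> I \<or> b \<in> I"
  shows "prime_ideal V I"
  unfolding prime_ideal_def
proof (intro conjI ballI impI)
  have hi: "is_ideal V I" using I by simp
  show "is_ideal V I" "I \<noteq> PR V" using hi I(2) by auto
  have top: "\<exists>N i. p = (\<Sum>j\<le>N. hcomp j p) \<and> i \<le> N \<and> hcomp i p \<notin> I \<and> (\<forall>j. i < j \<and> j \<le> N \<longrightarrow> hcomp j p \<in> I)"
    if p: "p \<notin> I" for p
  proof -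
    obtain N where N: "p = (\<Sum>j\<le>N. hcomp j p)" using sum_hcomp by blast
    let ?A = "{j. j \<le> N \<and> hcomp j p \<notin> I}"
    have "?A \<noteq> {}"
    proof
      assume "?A = {}"
      then have "(\<Sum>j\<le>N. hcomp j p) \<in> I" by (intro ideal_sum[OF hi]) auto
      then show False using N p by simp
    qed
    then have "Max ?A \<in> ?A" by (intro Max_in) auto
    moreover have "hcomp j p \<in> I" if "Max ?A < j" "j \<le> N" for j
    proof (rule ccontr)
      assume "hcomp j p \<notin> I"
      then have "j \<le> Max ?A" using that by (intro Max_ge) auto
      then show False using that by simp
    qed
    ultimately show ?thesis using N by blast
  qed
  fix a b assume ab: "a \<in> PR V" "b \<in> PR V" "a * b \<in> I"
  show "a \<in> I \<or> b \<in> I"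
  proof (rule ccontr)
    assume "\<not> (a \<in> I \<or> b \<in> I)"
    then have n: "a \<notin> I" "b \<notin> I" by auto
    obtain N i where i: "a = (\<Sum>j\<le>N. hcomp j a)" "i \<le> N" "hcomp i a \<notin> I" "\<And>j. i < j \<Longrightarrow> j \<le> N \<Longrightarrow> hcomp j a \<in> I"
      using top[OF n(1)] by blast
    obtain M k where k: "b = (\<Sum>j\<le>M. hcomp j b)" "k \<le> M" "hcomp k b \<notin> I" "\<And>j. k < j \<Longrightarrow> j \<le> M \<Longrightarrow> hcomp j b \<in> I"
      using top[OF n(2)] by blast
    let ?f = "\<lambda>(x, y). if x + y = i + k then hcomp x a * hcomp y b else 0"
    have "a * b = (\<Sum>(x, y)\<in>{..N} \<times> {..M}. hcomp x a * hcomp y b)"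
      by (subst i(1), subst k(1)) (simp add: sum_product sum.cartesian_product)
    then have "hcomp (i + k) (a * b) = (\<Sum>z\<in>{..N} \<times> {..M}. ?f z)"
      unfolding hcomp_sum
      by (auto simp: hcomp_sum hcomp_homog[OF homog_mult[OF homog_hcomp homog_hcomp]] intro!: sum.cong)
    also have "\<dots> = ?f (i, k) + (\<Sum>z\<in>{..N} \<times> {..M} - {(i, k)}. ?f z)"
      using i(2) k(2) by (intro sum.remove) auto
    finally have e: "hcomp i a * hcomp k b = hcomp (i + k) (a * b) - (\<Sum>z\<in>{..N} \<times> {..M} - {(i, k)}. ?f z)" by simp
    have "(\<Sum>z\<in>{..N} \<times> {..M} - {(i, k)}. ?f z) \<in> I"
    proof (rule ideal_sum[OF hi])
      fix z assume z: "z \<in> {..N} \<times> {..M} - {(i, k)}"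
      obtain x y where xy: "z = (x, y)" by (cases z)
      have "x > i \<or> y > k" if "x + y = i + k" using z xy that by auto
      then show "?f z \<in> I" using i(4)[of x] k(4)[of y] z xy ab is_idealD(2)[OF hi]
        by (auto intro: is_idealD(4,7)[OF hi] PR_hcomp)
    qed
    then have "hcomp i a * hcomp k b \<in> I" unfolding e using hideal_hcomp[OF I(1) ab(3)] is_idealD(6)[OF hi] by blast
    then show False using pr[OF PR_hcomp[OF ab(1)] homog_hcomp PR_hcomp[OF ab(2)] homog_hcomp] i(3) k(3) by blast
  qed
qed

section \<open>Primes of large growth and generic linear forms\<close>

lemma prime_idealD:
  assumes "prime_ideal V P"
  shows "is_ideal V P" "1 \<notin> P" "a \<in> PR V \<Longrightarrow> b \<in> PR V \<Longrightarrow> a * b \<in> P \<Longrightarrow> a \<in> P \<or> b \<in> P"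
  using assms ideal_eq_PR_iff[of V P] unfolding prime_ideal_def by auto

lemma colon_prime: "prime_ideal V P \<Longrightarrow> a \<in> PR V \<Longrightarrow> a \<notin> P \<Longrightarrow> colon V P a = P"
  using colon_superset[of V P a] prime_idealD[of V P] by (auto simp: colon_def)

lemma growth_split:
  fixes K :: "'k::field mpoly set"
  assumes V: "finite V" and K: "hideal V K" and a: "a \<in> PR V" "homog d a"
    and g: "growth_le V (iadd V K a) t" "growth_le V (colon V K a) t"
  shows "growth_le V K t"
proof -
  obtain C1 where C1: "C1 \<ge> 0" "\<And>j. real (HF_sum V (iadd V K a) j) \<le> C1 * (real j + 1) ^ t" using growth_bound[OF g(1)] by blast
  obtain C2 where C2: "C2 \<ge> 0" "\<And>j. real (HF_sum V (colon V K a) j) \<le> C2 * (real j + 1) ^ t" using growth_bound[OF g(2)] by blast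
  have "real (HF_sum V K j) \<le> (C1 + C2) * (real j + 1) ^ t" for j
  proof (cases "j < d")
    case True
    have "real (HF_sum V K j) \<le> C1 * (real j + 1) ^ t" using C1(2)[of j] HF_sum_split(2)[OF V K a True] by simp
    also have "\<dots> \<le> (C1 + C2) * (real j + 1) ^ t" using C2(1) by (intro mult_right_mono) auto
    finally show ?thesis .
  next
    case False
    then obtain i where i: "j = i + d" by (metis add.commute le_Suc_ex linorder_not_less)
    have "real (HF_sum V K j) = real (HF_sum V (iadd V K a) j) + real (HF_sum V (colon V K a) i)"
      unfolding i HF_sum_split(1)[OF V K a] by simp
    also have "\<dots> \<le> C1 * (real j + 1) ^ t + C2 * (real i + 1) ^ t" using C1(2) C2(2) by (intro add_mono)
    also have "C2 * (real i + 1) ^ t \<le> C2 * (real j + 1) ^ t" using C2(1) i by (intro mult_left_mono power_mono) auto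
    finally show ?thesis by (simp add: algebra_simps)
  qed
  then show ?thesis by (rule growth_leI[OF V K])
qed

lemma iadd_colon_subset:
  assumes "is_ideal V I" "g \<in> PR V" "a \<in> PR V"
  shows "iadd V (colon V I a) g \<subseteq> colon V (iadd V I g) a"
proof (rule iadd_least[OF is_ideal_colon[OF is_ideal_iadd[OF assms(1,2)]]])
  show "colon V I a \<subseteq> colon V (iadd V I g) a" by (rule colon_mono[OF iadd_superset])
  have "a * g \<in> iadd V I g" by (rule is_idealD(4)[OF is_ideal_iadd[OF assms(1,2)] assms(3) iadd_mem[OF assms(1)]])
  then show "g \<in> colon V (iadd V I g) a" using assms by (simp add: colon_def mult.commute)
qed

text \<open>\<open>T\<close> plays the part of the associated primes of top dimension. If
  \<open>I\<close> is not prime, take forms \<open>a\<close>, \<open>b\<close> outside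
  \<open>I\<close> with \<open>a * b\<close> in \<open>I\<close>; the sets for
  \<open>I + (a)\<close> and \<open>I : a\<close> together serve for \<open>I\<close>, and
  \<open>growth_split\<close> reassembles the bound.\<close>

lemma growth_drop_avoiding_primes:
  fixes I :: "'k::field mpoly set"
  assumes V: "finite V" and I: "hideal V I" and g: "growth_le V I (Suc t)"
  shows "\<exists>T. finite T \<and> (\<forall>p\<in>T. hideal V p \<and> prime_ideal V p \<and> I \<subseteq> p \<and> \<not> growth_le V p t) \<and>
     (\<forall>g e. g \<in> PR V \<longrightarrow> homog e g \<longrightarrow> 1 \<le> e \<longrightarrow> (\<forall>p\<in>T. g \<notin> p) \<longrightarrow> growth_le V (iadd V I g) t)"
  using V I g
proof (induction I rule: hideal_induct)
  case (step I)
  note hI = step.hyps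
  have ii: "is_ideal V I" using hI by simp
  show ?case
  proof (cases "growth_le V I t")
    case True
    then have "growth_le V (iadd V I g) t" if "g \<in> PR V" "homog e g" for g e
      using growth_superset[OF V hideal_iadd[OF hI that] _ iadd_superset] by blast
    then show ?thesis by (intro exI[of _ "{}"]) auto
  next
    case ng: False
    show ?thesis
    proof (cases "prime_ideal V I")
      case True
      have "growth_le V (iadd V I g) t" if "g \<in> PR V" "homog e g" "g \<notin> I" for g e
        using growth_drop[OF V hI that(1,2) colon_prime[OF True that(1,3)] step.prems] by simp
      then show ?thesis using True ng hI by (intro exI[of _ "{I}"]) auto
    next
      case False
      have "I \<noteq> PR V"
      proof
        assume I: "I = PR V"
        have "HF_sum V I j = 0" for j
          unfolding HF_sum_def HF_def I by (simp add: inf.absorb2 graded_piece_def Collect_mono_iff Int_def subset_iff)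
        then have "growth_le V I t" by (intro growth_leI[OF V hI, of 0]) simp
        then show False using ng by simp
      qed
      then obtain a b d e where ab: "a \<in> PR V" "homog d a" "b \<in> PR V" "homog e b" "a * b \<in> I" "a \<notin> I" "b \<notin> I"
        using prime_ideal_of_homog[OF hI] False by blast
      let ?J1 = "iadd V I a" and ?J2 = "colon V I a"
      have h: "hideal V ?J1" "hideal V ?J2" using hideal_iadd[OF hI ab(1,2)] hideal_colon[OF hI ab(2)] by auto
      have s: "I \<subset> ?J1" "I \<subset> ?J2" using iadd_superset[of I V a] iadd_mem[OF ii, of a] colon_superset[OF ii ab(1)] ab
        by (auto simp: colon_def mult.commute)
      have gJ: "growth_le V ?J1 (Suc t)" "growth_le V ?J2 (Suc t)" using growth_superset[OF V _ step.prems] h s by blast+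
      obtain T1 where T1: "finite T1" "\<forall>p\<in>T1. hideal V p \<and> prime_ideal V p \<and> ?J1 \<subseteq> p \<and> \<not> growth_le V p t"
        "\<And>g e. g \<in> PR V \<Longrightarrow> homog e g \<Longrightarrow> 1 \<le> e \<Longrightarrow> (\<forall>p\<in>T1. g \<notin> p) \<Longrightarrow> growth_le V (iadd V ?J1 g) t"
        using step.IH[OF h(1) s(1) gJ(1)] by blast
      obtain T2 where T2: "finite T2" "\<forall>p\<in>T2. hideal V p \<and> prime_ideal V p \<and> ?J2 \<subseteq> p \<and> \<not> growth_le V p t"
        "\<And>g e. g \<in> PR V \<Longrightarrow> homog e g \<Longrightarrow> 1 \<le> e \<Longrightarrow> (\<forall>p\<in>T2. g \<notin> p) \<Longrightarrow> growth_le V (iadd V ?J2 g) t"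
        using step.IH[OF h(2) s(2) gJ(2)] by blast
      have "growth_le V (iadd V I g) t" if gg: "g \<in> PR V" "homog k g" "1 \<le> k" "\<forall>p\<in>T1 \<union> T2. g \<notin> p" for g k
      proof -
        have hg: "hideal V (iadd V I g)" by (rule hideal_iadd[OF hI gg(1,2)])
        have "growth_le V (iadd V (iadd V I g) a) t" using T1(3)[OF gg(1-3)] gg(4) by (subst iadd_commute) auto
        moreover have "growth_le V (colon V (iadd V I g) a) t"
        proof (rule growth_superset[OF V hideal_colon[OF hg ab(2)] _ iadd_colon_subset[OF ii gg(1) ab(1)]])
          show "growth_le V (iadd V ?J2 g) t" using T2(3)[OF gg(1-3)] gg(4) by blast
        qed
        ultimately show ?thesis by (rule growth_split[OF V hg ab(1,2)])
      qed
      then show ?thesis using T1(1,2) T2(1,2) s by (intro exI[of _ "T1 \<union> T2"]) fastforce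
    qed
  qed
qed

text \<open>The line \<open>h + c g\<close> meets each subspace in \<open>T\<close> at most once
  because \<open>g\<close> lies in none of them, and it misses \<open>p\<close> when
  \<open>p\<close> contains \<open>g\<close> but not \<open>h\<close>. An infinite field leaves a
  value of \<open>c\<close>; this is the reason for extending the base field.\<close>

lemma avoid_subspaces:
  fixes X :: "'k::field mpoly set"
  assumes inf: "infinite (UNIV :: 'k set)" and T: "finite T" and X: "pm.subspace X"
    and p: "\<And>p. p \<in> T \<Longrightarrow> pm.subspace p \<and> \<not> X \<subseteq> p"
  shows "\<exists>g\<in>X. \<forall>p\<in>T. g \<notin> p"
  using T p
proof (induction T rule: finite_induct)
  case empty
  then show ?case using pm.subspace_0[OF X] by blast
next
  case (insert p T)
  then obtain g where g: "g \<in> X" "\<forall>q\<in>T. g \<notin> q" by blast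
  show ?case
  proof (cases "g \<in> p")
    case False then show ?thesis using g by blast
  next
    case True
    obtain h where h: "h \<in> X" "h \<notin> p" using insert.prems[of p] by blast
    have "\<exists>c0. \<forall>c. h + pscale c g \<in> q \<longrightarrow> c = c0" if q: "q \<in> T" for q
    proof (rule ccontr)
      assume "\<nexists>c0. \<forall>c. h + pscale c g \<in> q \<longrightarrow> c = c0"
      then obtain c d where cd: "h + pscale c g \<in> q" "h + pscale d g \<in> q" "c \<noteq> d" by metis
      have sq: "pm.subspace q" using insert.prems q by blast
      have "(h + pscale c g) - (h + pscale d g) \<in> q" using pm.subspace_diff[OF sq cd(1,2)] .
      then have "pscale (c - d) g \<in> q" by (simp add: pm.scale_left_diff_distrib)
      then have "pscale (1 / (c - d)) (pscale (c - d) g) \<in> q" by (rule pm.subspace_scale[OF sq])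
      then show False using cd(3) g(2) q by simp
    qed
    then obtain c0 where c0: "\<And>q c. q \<in> T \<Longrightarrow> h + pscale c g \<in> q \<Longrightarrow> c = c0 q" by metis
    have "\<exists>c. c \<notin> c0 ` T" using inf insert.hyps(1) by (metis ex_new_if_finite finite_imageI)
    then obtain c where c: "c \<notin> c0 ` T" by blast
    have "h + pscale c g \<notin> p"
    proof
      assume a: "h + pscale c g \<in> p"
      have sp: "pm.subspace p" using insert.prems by blast
      have "(h + pscale c g) - pscale c g \<in> p" by (rule pm.subspace_diff[OF sp a pm.subspace_scale[OF sp True]])
      then show False using h by simp
    qed
    moreover have "h + pscale c g \<in> X" by (intro pm.subspace_add[OF X] pm.subspace_scale[OF X] h g)
    ultimately show ?thesis using c0 c by (intro bexI[of _ "h + pscale c g"]) auto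
  qed
qed

text \<open>One form serves several ideals at once, as the exchange arguments require. A prime whose
  growth is not bounded by \<open>t\<close> cannot contain all linear forms, since its growth would
  then be 0.\<close>

lemma generic_linear:
  fixes Q :: "('k::field mpoly set \<times> nat) set"
  assumes V: "finite V" and inf: "infinite (UNIV :: 'k set)" and Q: "finite Q"
    and h: "\<And>I t. (I, t) \<in> Q \<Longrightarrow> hideal V I \<and> growth_le V I (Suc t)"
  obtains l where "l \<in> PR V" "homog 1 l" "\<And>I t. (I, t) \<in> Q \<Longrightarrow> growth_le V (iadd V I l) t"
proof -
  have "\<forall>z\<in>Q. \<exists>T. finite T \<and> (\<forall>p\<in>T. hideal V p \<and> prime_ideal V p \<and> fst z \<subseteq> p \<and> \<not> growth_le V p (snd z)) \<and>
     (\<forall>g e. g \<in> PR V \<longrightarrow> homog e g \<longrightarrow> 1 \<le> e \<longrightarrow> (\<forall>p\<in>T. g \<notin> p) \<longrightarrow> growth_le V (iadd V (fst z) g) (snd z))"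
    using growth_drop_avoiding_primes[OF V] h by (metis prod.collapse)
  from bchoice[OF this] obtain T where T0: "\<forall>z\<in>Q. finite (T z) \<and> (\<forall>p\<in>T z. hideal V p \<and> prime_ideal V p \<and> fst z \<subseteq> p \<and> \<not> growth_le V p (snd z)) \<and>
     (\<forall>g e. g \<in> PR V \<longrightarrow> homog e g \<longrightarrow> 1 \<le> e \<longrightarrow> (\<forall>p\<in>T z. g \<notin> p) \<longrightarrow> growth_le V (iadd V (fst z) g) (snd z))" ..
  have T: "\<And>z. z \<in> Q \<Longrightarrow> finite (T z)"
     "\<And>z p. z \<in> Q \<Longrightarrow> p \<in> T z \<Longrightarrow> hideal V p \<and> prime_ideal V p \<and> fst z \<subseteq> p \<and> \<not> growth_le V p (snd z)"
     "\<And>z g e. z \<in> Q \<Longrightarrow> g \<in> PR V \<Longrightarrow> homog e g \<Longrightarrow> 1 \<le> e \<Longrightarrow> (\<forall>p\<in>T z. g \<notin> p) \<Longrightarrow> growth_le V (iadd V (fst z) g) (snd z)"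
    by (rule bspec[OF T0, THEN conjunct1]; assumption) (use T0 in blast)+
  have "\<exists>l\<in>graded_piece V 1. \<forall>p\<in>(\<Union>z\<in>Q. T z). l \<notin> p"
  proof (rule avoid_subspaces[OF inf _ subspace_graded_piece])
    show "finite (\<Union>z\<in>Q. T z)" using Q T(1) by blast
    fix p assume "p \<in> (\<Union>z\<in>Q. T z)"
    then obtain z where z: "z \<in> Q" "p \<in> T z" by blast
    have p: "is_ideal V p" "\<not> growth_le V p (snd z)" using T(2)[OF z] by auto
    have "\<not> graded_piece V 1 \<subseteq> p"
    proof
      assume "graded_piece V 1 \<subseteq> p"
      then have "xpow v 1 \<in> p" if "v \<in> V" for v

        using that by (intro subsetD[OF \<open>graded_piece V 1 \<subseteq> p\<close>]) (simp add: graded_piece_iff xpow_PR homog_xpow del: One_nat_def)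
      then show False using growth_0_of_variables[OF p(1)] growth_mono p(2) by blast
    qed
    then show "pm.subspace p \<and> \<not> graded_piece V 1 \<subseteq> p" using subspace_ideal[OF p(1)] by blast
  qed
  then obtain l where l: "l \<in> graded_piece V 1" "\<And>z p. z \<in> Q \<Longrightarrow> p \<in> T z \<Longrightarrow> l \<notin> p" by blast
  show thesis
  proof (rule that[of l])
    show "l \<in> PR V" "homog 1 l" using l(1) by (auto simp: graded_piece_iff)
    fix I t assume z: "(I, t) \<in> Q"
    show "growth_le V (iadd V I l) t"
      using T(3)[OF z, of l 1] l(2)[OF z] \<open>l \<in> PR V\<close> \<open>homog 1 l\<close> by simp
  qed
qed

text \<open>\<open>S/I\<close> is Cohen-Macaulay of dimension \<open>t\<close>, with a regular system of parameters consisting of linear forms.\<close>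
inductive linear_depth :: "nat set \<Rightarrow> 'k::field mpoly set \<Rightarrow> nat \<Rightarrow> bool" for V where
  linear_depth_0: "hideal V I \<Longrightarrow> growth_le V I 0 \<Longrightarrow> linear_depth V I 0"
| linear_depth_Suc: "hideal V I \<Longrightarrow> l \<in> PR V \<Longrightarrow> homog 1 l \<Longrightarrow> colon V I l = I \<Longrightarrow> linear_depth V (iadd V I l) t \<Longrightarrow> linear_depth V I (Suc t)"

inductive_cases linear_depth_SucE: "linear_depth V I (Suc t)"
inductive_cases linear_depth_0E: "linear_depth V I 0"

lemma linear_depth_hideal: "linear_depth V I t \<Longrightarrow> hideal V I"
  by (induction rule: linear_depth.induct) auto

lemma linear_depth_gr: "finite V \<Longrightarrow> linear_depth V I t \<Longrightarrow> growth_le V I t"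
  by (rotate_tac, induction rule: linear_depth.induct) (auto intro: growth_of_iadd)

section \<open>Unmixedness and regularity under linear sections\<close>

lemma colon_cong:
  assumes "is_ideal V I" "u - w \<in> I"
  shows "colon V I u = colon V I w"
proof -
  have "p * u \<in> I \<longleftrightarrow> p * w \<in> I" if p: "p \<in> PR V" for p
  proof -
    have d: "p * (u - w) \<in> I" by (rule is_idealD(4)[OF assms(1) p assms(2)])
    have "p * u = p * w + p * (u - w)" "p * w = p * u - p * (u - w)" by (simp_all add: algebra_simps)
    then show ?thesis using d is_idealD(3,6)[OF assms(1)] by metis
  qed
  then show ?thesis by (auto simp: colon_def)
qed

lemma colon_mult_nzd:
  assumes "is_ideal V I" "l \<in> PR V" "u \<in> PR V" "colon V I l = I"
  shows "colon V I (u * l) = colon V I u" "colon V (colon V I u) l = colon V I u"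
proof -
  have "p * u * l \<in> I \<longleftrightarrow> p * u \<in> I" if "p \<in> PR V" for p
    using assms(4) PR_mult[OF that assms(3)] by (auto simp: colon_def)
  then show "colon V I (u * l) = colon V I u" "colon V (colon V I u) l = colon V I u"
    using assms(2) by (auto simp: colon_def mult_ac intro: PR_mult)
qed

text \<open>Each division by \<open>l\<close> lowers the degree by one, so the process stops;
  regularity of \<open>l\<close> modulo \<open>I\<close> keeps the colon ideal unchanged
  throughout.\<close>

lemma divide_out_linear:
  fixes I :: "'k::field mpoly set"
  assumes I: "hideal V I" and l: "l \<in> PR V" "homog 1 l" "colon V I l = I"
    and u: "u \<in> PR V" "homog d u" "u \<notin> I"
  obtains u' d' where "d' \<le> d" "u' \<in> PR V" "homog d' u'" "u' \<notin> iadd V I l" "colon V I u' = colon V I u"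
  using u
proof (induction d arbitrary: u thesis rule: less_induct)
  case (less d)
  have ii: "is_ideal V I" using I by simp
  show ?case
  proof (cases "u \<in> iadd V I l")
    case False then show ?thesis using less.prems by blast
  next
    case True
    then obtain p r where pr: "u = p + r * l" "p \<in> I" "r \<in> PR V" by (rule iaddE)
    have u': "u = hcomp d p + (if 1 \<le> d then hcomp (d - 1) r * l else 0)"
      using less.prems(3) hcomp_homog[of d u d] unfolding pr(1) hcomp_add hcomp_mult_left[OF l(2)] by simp
    have hp: "hcomp d p \<in> I" using hideal_hcomp[OF I pr(2)] .
    have d: "1 \<le> d" using u' hp less.prems(4) by (cases "1 \<le> d") auto
    define w where "w = hcomp (d - 1) r"
    have w: "w \<in> PR V" "homog (d - 1) w" unfolding w_def using pr(3) PR_hcomp by auto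
    have uw: "u = hcomp d p + w * l" using u' d unfolding w_def by simp
    have "colon V I u = colon V I (w * l)" by (rule colon_cong[OF ii]) (use hp in \<open>simp add: uw\<close>)
    also have "\<dots> = colon V I w" by (rule colon_mult_nzd(1)[OF ii l(1) w(1) l(3)])
    finally have c: "colon V I u = colon V I w" .
    have "w \<notin> I" using uw hp less.prems(4) is_idealD(3,7)[OF ii] l(1) by metis
    then obtain u' d' where "d' \<le> d - 1" "u' \<in> PR V" "homog d' u'" "u' \<notin> iadd V I l" "colon V I u' = colon V I w"
      using less.IH[of "d - 1" w] d w by (metis One_nat_def diff_less less_le_trans zero_less_one)
    then show ?thesis using c by (intro less.prems(1)[of d' u']) auto
  qed
qed

text \<open>The submodule of \<open>S/I\<close> generated by \<open>u\<close> is
  \<open>S/(I : u)\<close> up to a shift, so this is unmixedness. The form \<open>l\<close> is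
  regular modulo \<open>I : u\<close> too; dividing it out of \<open>u\<close> keeps
  \<open>u\<close> nonzero in the section, where both \<open>t\<close> and \<open>s\<close> drop by
  one.\<close>

lemma linear_depth_unmixed:
  fixes I :: "'k::field mpoly set"
  assumes V: "finite V" and I: "linear_depth V I t" and u: "u \<in> PR V" "homog d u" "u \<notin> I" "growth_le V (colon V I u) s"
  shows "t \<le> s"
  using I u
proof (induction arbitrary: u d s rule: linear_depth.induct)
  case (linear_depth_Suc I l t)
  note hI = linear_depth_Suc.hyps(1) and l = linear_depth_Suc.hyps(2-4)
  have ii: "is_ideal V I" using hI by simp
  obtain u' d' where u': "u' \<in> PR V" "homog d' u'" "u' \<notin> iadd V I l" "colon V I u' = colon V I u"
    by (rule divide_out_linear[OF hI l linear_depth_Suc.prems(1-3)])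
  let ?K = "colon V I u'"
  have hK: "hideal V ?K" by (rule hideal_colon[OF hI u'(2)])
  have cK: "colon V ?K l = ?K" by (rule colon_mult_nzd(2)[OF ii l(1) u'(1) l(3)])
  have gK: "growth_le V ?K s" using linear_depth_Suc.prems(4) u'(4) by simp
  have "u' \<notin> I" using u'(3) iadd_superset by blast
  then have nK: "?K \<noteq> PR V" using colon_eq_PR_iff[OF ii u'(1)] by simp
  have s: "s \<noteq> 0" using growth_0_drop[OF V hK l(1,2) _ cK] gK nK by auto
  have "growth_le V (iadd V ?K l) (s - 1)" by (rule growth_drop[OF V hK l(1,2) cK gK])
  then have "growth_le V (colon V (iadd V I l) u') (s - 1)"
    using growth_superset[OF V hideal_colon[OF hideal_iadd[OF hI l(1,2)] u'(2)] _ iadd_colon_subset[OF ii l(1) u'(1)]] by blast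
  then have "t \<le> s - 1" using linear_depth_Suc.IH u' by blast
  then show ?case using s by simp
qed simp

text \<open>If \<open>g\<close> killed a class \<open>s\<close> outside \<open>I\<close>, then
  \<open>I + (g)\<close> would lie in \<open>I : s\<close>, whose growth would be too small for
  unmixedness.\<close>

lemma linear_depth_nzd:
  fixes I :: "'k::field mpoly set"
  assumes V: "finite V" and I: "linear_depth V I (Suc t)" and g: "g \<in> PR V" "homog e g" "growth_le V (iadd V I g) t"
  shows "colon V I g = I"
proof (rule ccontr)
  have hI: "hideal V I" using linear_depth_hideal[OF I] .
  have ii: "is_ideal V I" using hI by simp
  assume "colon V I g \<noteq> I"
  then obtain s where s: "s \<in> colon V I g" "s \<notin> I" using colon_superset[OF ii g(1)] by blast
  obtain j where j: "hcomp j s \<notin> I" using hideal_comp_notin[OF ii s(2)] .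
  have m: "hcomp j s \<in> colon V I g" using hideal_hcomp[OF hideal_colon[OF hI g(2)] s(1)] .
  let ?s = "hcomp j s"
  have sP: "?s \<in> PR V" using m by (simp add: colon_def)
  have "iadd V I g \<subseteq> colon V I ?s"
    using m g(1) colon_superset[OF ii sP] by (intro iadd_least is_ideal_colon ii) (auto simp: colon_def mult.commute)
  then have "growth_le V (colon V I ?s) t" using growth_superset[OF V hideal_colon[OF hI homog_hcomp] g(3)] by blast
  then have "Suc t \<le> t" by (rule linear_depth_unmixed[OF V I sP homog_hcomp j])
  then show False by simp
qed

lemma nzd_swap:
  assumes ii: "is_ideal V I" and l: "l \<in> PR V" "colon V I l = I" and g: "g \<in> PR V" "colon V I g = I"
    and gl: "colon V (iadd V I l) g = iadd V I l"
  shows "colon V (iadd V I g) l = iadd V I g"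
proof
  show "iadd V I g \<subseteq> colon V (iadd V I g) l" using colon_superset[OF is_ideal_iadd[OF ii g(1)] l(1)] .
  show "colon V (iadd V I g) l \<subseteq> iadd V I g"
  proof
    fix s assume "s \<in> colon V (iadd V I g) l"
    then obtain p r where s: "s \<in> PR V" "s * l = p + r * g" "p \<in> I" "r \<in> PR V" by (auto simp: colon_def elim!: iaddE)
    have "r * g = - p + s * l" using s(2) by simp
    also have "\<dots> \<in> iadd V I l" using s is_idealD(5)[OF ii] by (intro iaddI)
    finally have "r \<in> iadd V I l" using gl s(4) by (auto simp: colon_def)
    then obtain q w where r: "r = q + w * l" "q \<in> I" "w \<in> PR V" by (rule iaddE)
    have "(s - w * g) * l = p + q * g" using s(2) r(1) by (simp add: algebra_simps)
    also have "\<dots> \<in> I" using s r g(1) by (intro is_idealD(3,7)[OF ii])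
    finally have "s - w * g \<in> I" using l(2) s r g(1) by (auto simp: colon_def intro: PR_diff PR_mult)
    then have "(s - w * g) + w * g \<in> iadd V I g" using r(3) by (intro iaddI)
    then show "s \<in> iadd V I g" by simp
  qed
qed

text \<open>A linear form \<open>l\<close> that is generic for \<open>I\<close>, \<open>I + (k)\<close> and \<open>I + (g)\<close> is regular modulo \<open>I\<close> and \<open>I + (k)\<close>, so the induction
  hypothesis applies to \<open>I + (k)\<close> with \<open>l\<close> and, after interchanging \<open>k\<close> and \<open>l\<close>, to \<open>I + (l)\<close> with \<open>g\<close>.\<close>
lemma linear_depth_iadd:
  fixes I :: "'k::field mpoly set"
  assumes V: "finite V" and inf: "infinite (UNIV :: 'k set)"
    and I: "linear_depth V I (Suc t)" and g: "g \<in> PR V" "homog e g" "e \<ge> 1" "growth_le V (iadd V I g) t"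
  shows "linear_depth V (iadd V I g) t"
  using I g
proof (induction t arbitrary: I g e)
  case 0
  then show ?case using hideal_iadd[OF linear_depth_hideal] by (blast intro: linear_depth_0)
next
  case (Suc t)
  note g = Suc.prems(2-5)
  have hI: "hideal V I" using linear_depth_hideal[OF Suc.prems(1)] .
  have ii: "is_ideal V I" using hI by simp
  obtain k where k: "k \<in> PR V" "homog 1 k" "colon V I k = I" "linear_depth V (iadd V I k) (Suc t)"
    using Suc.prems(1) by (rule linear_depth_SucE) (rule that; simp)
  let ?Q = "{(I, Suc t), (iadd V I k, t), (iadd V I g, t)}"
  obtain l where l: "l \<in> PR V" "homog 1 l" "\<And>J s. (J, s) \<in> ?Q \<Longrightarrow> growth_le V (iadd V J l) s"
    by (rule generic_linear[OF V inf, of ?Q])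
      (use hI k g linear_depth_gr[OF V Suc.prems(1)] linear_depth_gr[OF V k(4)] hideal_iadd in auto)
  have lI: "growth_le V (iadd V I l) (Suc t)" "growth_le V (iadd V (iadd V I k) l) t" "growth_le V (iadd V (iadd V I g) l) t" using l(3) by auto
  have nl: "colon V I l = I" using linear_depth_nzd[OF V Suc.prems(1) l(1,2) lI(1)] .
  have nkl: "colon V (iadd V I k) l = iadd V I k" using linear_depth_nzd[OF V k(4) l(1,2) lI(2)] .
  have "linear_depth V (iadd V (iadd V I k) l) t" using Suc.IH[OF k(4) l(1,2) _ lI(2)] by simp
  then have "linear_depth V (iadd V (iadd V I l) k) t" by (subst iadd_commute)
  moreover have "colon V (iadd V I l) k = iadd V I l"
    using nzd_swap[OF ii k(1,3) l(1) nl nkl] .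
  ultimately have dl: "linear_depth V (iadd V I l) (Suc t)"
    using linear_depth_Suc[OF hideal_iadd[OF hI l(1,2)] k(1,2)] by blast
  have glg: "growth_le V (iadd V (iadd V I l) g) t" using lI(3) by (subst iadd_commute)
  have ng: "colon V I g = I" using linear_depth_nzd[OF V Suc.prems(1) g(1,2,4)] .
  have nlg: "colon V (iadd V I l) g = iadd V I l" using linear_depth_nzd[OF V dl g(1,2) glg] .
  have "linear_depth V (iadd V (iadd V I l) g) t" by (rule Suc.IH[OF dl g(1-3) glg])
  then have "linear_depth V (iadd V (iadd V I g) l) t" by (subst iadd_commute)
  moreover have "colon V (iadd V I g) l = iadd V I g"
    using nzd_swap[OF ii l(1) nl g(1) ng nlg] .
  ultimately show ?case using linear_depth_Suc[OF hideal_iadd[OF hI g(1,2)] l(1,2)] by blast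
qed

text \<open>The prime generated by the variables in \<open>W\<close>, described by supports of
  monomials so that colons by and sums with a further variable can be read off. It serves to show
  that the zero ideal has linear depth \<open>card V\<close>.\<close>

definition varideal :: "nat set \<Rightarrow> nat set \<Rightarrow> 'k::field mpoly set" where
  "varideal V W = {p \<in> PR V. \<forall>m\<in>Poly_Mapping.keys p. Poly_Mapping.keys m \<inter> W \<noteq> {}}"

lemma hideal_varideal: "hideal V (varideal V W)"
  unfolding hideal_def is_ideal_def
proof (intro conjI ballI allI)
  fix a b :: "'a mpoly" assume "a \<in> varideal V W" "b \<in> varideal V W"
  then show "a + b \<in> varideal V W" using keys_add[of a b] by (auto simp: varideal_def intro: PR_add)
next
  fix r a :: "'a mpoly" assume ra: "r \<in> PR V" "a \<in> varideal V W"
  have "Poly_Mapping.keys m \<inter> W \<noteq> {}" if "m \<in> Poly_Mapping.keys (r * a)" for m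
  proof -
    obtain x y where "m = x + y" "y \<in> Poly_Mapping.keys a" using keys_mult[of r a] \<open>m \<in> _\<close> by blast
    then show ?thesis using ra(2) by (auto simp: varideal_def keys_add_nat)
  qed
  then show "r * a \<in> varideal V W" using ra by (auto simp: varideal_def intro: PR_mult)
qed (auto simp: varideal_def keys_hcomp intro: PR_hcomp)

lemma varideal_empty: "varideal V {} = {0}"
  using keys_nonempty by (auto simp: varideal_def)

lemma xpow_mem_varideal: "v \<in> W \<Longrightarrow> v \<in> V \<Longrightarrow> xpow v 1 \<in> varideal V W"
  by (auto simp: varideal_def xpow_def intro: PR_single)

lemma colon_varideal:
  assumes "v \<in> V" "v \<notin> W"
  shows "colon V (varideal V W) (xpow v 1) = (varideal V W :: 'k::field mpoly set)"
proof
  show "varideal V W \<subseteq> colon V (varideal V W) (xpow v 1 :: 'k mpoly)"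
    using colon_superset[OF hideal_ideal[OF hideal_varideal] xpow_PR[OF assms(1)]] .
  show "colon V (varideal V W) (xpow v 1) \<subseteq> (varideal V W :: 'k mpoly set)"
  proof
    fix p :: "'k mpoly" assume p: "p \<in> colon V (varideal V W) (xpow v 1)"
    have "Poly_Mapping.keys m \<inter> W \<noteq> {}" if m: "m \<in> Poly_Mapping.keys p" for m
    proof -
      have "Poly_Mapping.lookup (p * xpow v 1) (Poly_Mapping.single v 1 + m) = Poly_Mapping.lookup p m"
        unfolding xpow_def by (subst mult.commute) (simp add: lookup_single_mult)
      then have "Poly_Mapping.single v 1 + m \<in> Poly_Mapping.keys (p * xpow v 1)" using m by (simp add: in_keys_iff)
      then have "Poly_Mapping.keys (Poly_Mapping.single v 1 + m) \<inter> W \<noteq> {}" using p by (auto simp: colon_def varideal_def)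
      then show ?thesis using assms(2) by (auto simp: keys_add_nat)
    qed
    then show "p \<in> varideal V W" using p by (auto simp: colon_def varideal_def)
  qed
qed

lemma iadd_varideal:
  assumes "v \<in> V" 
  shows "iadd V (varideal V W) (xpow v 1) = (varideal V (insert v W) :: 'k::field mpoly set)"
proof
  note hi = hideal_ideal[OF hideal_varideal]
  have sub: "varideal V W \<subseteq> varideal V (insert v W)" by (auto simp: varideal_def)
  show "iadd V (varideal V W) (xpow v 1) \<subseteq> (varideal V (insert v W) :: 'k mpoly set)"
    using assms by (intro iadd_least[OF hi] xpow_mem_varideal sub) auto
  note hi2 = is_ideal_iadd[OF hi[of V W] xpow_PR[OF assms]]
  show "varideal V (insert v W) \<subseteq> iadd V (varideal V W) (xpow v 1 :: 'k mpoly)"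
  proof
    fix p :: "'k mpoly" assume p: "p \<in> varideal V (insert v W)"
    have "Poly_Mapping.single m 1 \<in> iadd V (varideal V W) (xpow v 1 :: 'k mpoly)" if m: "m \<in> Poly_Mapping.keys p" for m
    proof -
      have mV: "Poly_Mapping.keys m \<subseteq> V" "Poly_Mapping.keys m \<inter> insert v W \<noteq> {}" using m p by (auto simp: varideal_def PR_def)
      show ?thesis
      proof (cases "Poly_Mapping.keys m \<inter> W = {}")
        case False
        then have "Poly_Mapping.single m (1::'k) \<in> varideal V W" using mV by (auto simp: varideal_def intro: PR_single)
        then show ?thesis using iadd_superset by blast
      next
        case True
        then have v: "v \<in> Poly_Mapping.keys m" using mV(2) by blast
        note e = monomial_divide_var[OF v]
        have "Poly_Mapping.single m (1::'k) = Poly_Mapping.single (m - Poly_Mapping.single v 1) 1 * xpow v 1"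
          unfolding xpow_def mult_single using e by simp
        moreover have "Poly_Mapping.keys (m - Poly_Mapping.single v 1) \<subseteq> Poly_Mapping.keys m"
          by (auto simp: in_keys_iff lookup_minus)
        then have "Poly_Mapping.keys (m - Poly_Mapping.single v 1) \<subseteq> V" using mV(1) by blast
        ultimately show ?thesis using is_idealD(4)[OF hi2 PR_single iadd_mem[OF hi]] by metis
      qed
    qed
    then show "p \<in> iadd V (varideal V W) (xpow v 1)"
      by (subst poly_eq_sum_pscale[of p]) (intro ideal_sum[OF hi2] ideal_pscale[OF hi2])
  qed
qed

lemma linear_depth_varideal:
  assumes V: "finite V" and W: "W \<subseteq> V"
  shows "linear_depth V (varideal V W :: 'k::field mpoly set) (card (V - W))"
  using W
proof (induction "card (V - W)" arbitrary: W)
  case 0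
  then have "W = V" using V by auto
  then have "growth_le V (varideal V W :: 'k mpoly set) 0"
    by (intro growth_0_of_variables hideal_ideal[OF hideal_varideal] xpow_mem_varideal) auto
  then show ?case using linear_depth_0[OF hideal_varideal] 0 by metis
next
  case (Suc k)
  have "V - W \<noteq> {}" using Suc(2) by (metis card.empty nat.distinct(1))
  then obtain v where v: "v \<in> V" "v \<notin> W" by blast
  have "k = card (V - insert v W)" 
  proof -
    have "V - insert v W = (V - W) - {v}" by blast
    then show ?thesis using Suc(2) v V card_Diff_singleton[of v "V - W"] by simp
  qed
  then have "linear_depth V (varideal V (insert v W) :: 'k mpoly set) k" using Suc(1)[of "insert v W"] Suc.prems v by simp
  then have "linear_depth V (iadd V (varideal V W) (xpow v 1 :: 'k mpoly)) k" using iadd_varideal[OF v(1)] by metis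
  then have "linear_depth V (varideal V W :: 'k mpoly set) (Suc k)"
    using linear_depth_Suc[OF hideal_varideal xpow_PR[OF v(1)] homog_xpow colon_varideal[OF v]] by blast
  then show ?case using Suc(2) by simp
qed

lemma linear_depth_zero: "finite V \<Longrightarrow> linear_depth V {0} (card V)"
  using linear_depth_varideal[of V "{}"] by (simp add: varideal_empty)

section \<open>Ideals given by lists of forms of positive degree\<close>

definition homog_gens :: "nat set \<Rightarrow> 'k::field mpoly list \<Rightarrow> nat list \<Rightarrow> bool" where
  "homog_gens V gs es \<longleftrightarrow> list_all2 (\<lambda>g e. g \<in> PR V \<and> homog e g \<and> 1 \<le> e) gs es"

lemma homog_gens_Nil [simp]: "homog_gens V [] es \<longleftrightarrow> es = []" by (simp add: homog_gens_def)
lemma homog_gens_Cons [simp]: "homog_gens V (g # gs) (e # es) \<longleftrightarrow> g \<in> PR V \<and> homog e g \<and> 1 \<le> e \<and> homog_gens V gs es"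
  by (simp add: homog_gens_def)
lemma homog_gens_length: "homog_gens V gs es \<Longrightarrow> length gs = length es"
  unfolding homog_gens_def by (rule list_all2_lengthD)

abbreviation idl :: "nat set \<Rightarrow> 'k::field mpoly list \<Rightarrow> 'k mpoly set" where
  "idl V gs \<equiv> ideal_gen V (set gs)"

lemma idl_Cons: "idl V (g # gs) = iadd V (idl V gs) g" by (simp add: ideal_gen_insert)

lemma hideal_idl: "homog_gens V gs es \<Longrightarrow> hideal V (idl V gs)"
proof (induction gs arbitrary: es)
  case Nil then show ?case by (simp add: ideal_gen_empty hideal_zero)
next
  case (Cons g gs)
  then obtain e es' where "es = e # es'" by (metis homog_gens_length length_Suc_conv)
  then show ?case using Cons unfolding idl_Cons by (auto intro: hideal_iadd)
qed

lemma homog_gens_ConsE: 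
  assumes "homog_gens V (g # gs) es"
  obtains e es' where "es = e # es'" "g \<in> PR V" "homog e g" "1 \<le> e" "homog_gens V gs es'"
  using assms homog_gens_length[OF assms] by (cases es) auto

text \<open>Regularity is deduced from the numbers: removing a generator raises the growth bound by
  one, and the induction hypothesis provides the depth from which \<open>linear_depth_iadd\<close>
  descends. As only the ideal and the number of generators enter, generators can later be permuted
  and exchanged.\<close>

lemma linear_depth_idl:
  fixes gs :: "'k::field mpoly list"
  assumes V: "finite V" and inf: "infinite (UNIV :: 'k set)" and gs: "homog_gens V gs es"
    and g: "growth_le V (idl V gs) t" and len: "length gs + t = card V"
  shows "linear_depth V (idl V gs) t"
  using gs g len
proof (induction gs arbitrary: es t)
  case Nil
  then show ?case using linear_depth_zero[OF V] by (simp add: ideal_gen_empty)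
next
  case (Cons a gs)
  obtain e es' where e: "a \<in> PR V" "homog e a" "1 \<le> e" "homog_gens V gs es'" using homog_gens_ConsE[OF Cons.prems(1)] by metis
  have g: "growth_le V (iadd V (idl V gs) a) t" using Cons.prems(2) by (simp only: idl_Cons)
  have "growth_le V (idl V gs) (Suc t)" by (rule growth_of_iadd[OF V hideal_idl[OF e(4)] e(1-3) g])
  then have "linear_depth V (idl V gs) (Suc t)" using Cons.IH[OF e(4)] Cons.prems(3) by simp
  then show ?case unfolding idl_Cons by (rule linear_depth_iadd[OF V inf _ e(1-3) g])
qed

subsection \<open>Artinian complete intersections\<close>

lemma HF_pos_of_notin:
  "finite V \<Longrightarrow> is_ideal V I \<Longrightarrow> u \<in> PR V \<Longrightarrow> homog d u \<Longrightarrow> u \<notin> I \<Longrightarrow> HF V I d \<noteq> 0"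
  using HF_eq_0_iff[of V I d] by (auto simp: graded_piece_iff)

lemma ex_notin_of_HF:
  assumes "finite V" "is_ideal V I" "HF V I d \<noteq> 0"
  obtains u where "u \<in> PR V" "homog d u" "u \<notin> I"
proof -
  have "\<not> graded_piece V d \<subseteq> I" using HF_eq_0_iff[OF assms(1,2), of d] assms(3) by simp
  then obtain u where "u \<in> graded_piece V d" "u \<notin> I" by blast
  then show thesis using that[of u] by (simp add: graded_piece_iff)
qed

lemma mons_0: "mons V 0 = {0}" by (auto simp: mons_def)

lemma mons_1: "mons V 1 = (\<lambda>v. Poly_Mapping.single v 1) ` V"
proof (intro equalityI subsetI)
  fix m assume m: "m \<in> mons V 1"
  then have "m \<noteq> 0" by (auto simp: mons_def)
  then obtain v where v: "v \<in> Poly_Mapping.keys m" using in_keys_iff[of _ m] by (metis poly_mapping_eqI lookup_zero)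
  note e = monomial_divide_var[OF v]
  have "mdeg m = mdeg (m - Poly_Mapping.single v 1) + 1" by (subst e) simp
  then have "m - Poly_Mapping.single v 1 = 0" using m by (simp add: mons_def)
  then show "m \<in> (\<lambda>v. Poly_Mapping.single v 1) ` V" using e v m by (auto simp: mons_def)
qed (auto simp: mons_def)

lemma card_mons_1: "card (mons V 1) = card V"
  unfolding mons_1 by (intro card_image inj_onI) (metis keys_single singleton_inject zero_neq_one)

lemma HF_zero: "finite V \<Longrightarrow> HF V ({0} :: 'k::field mpoly set) j = card (mons V j)"
proof -
  assume V: "finite V"
  have "{0} \<inter> graded_piece V j = ({0} :: 'k mpoly set)" by (auto simp: graded_piece_iff)
  moreover have "pm.dim ({0} :: 'k mpoly set) = 0"
    using pm.dim_le_card[of "{0}" "{}"] by simp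
  ultimately show ?thesis using HF_add[OF V, of "{0} :: 'k mpoly set" j] kdim_graded_piece[OF V, where 'k = 'k]
    by (simp add: kdim_def)
qed

lemma HF_idl_0: 
  assumes V: "finite V" and gs: "homog_gens V gs es" shows "HF V (idl V gs) 0 = 1"
  using gs
proof (induction gs arbitrary: es)
  case Nil
  show ?case using HF_zero[OF V, of 0] by (simp add: ideal_gen_empty mons_0)
next
  case (Cons a gs)
  obtain e es' where e: "a \<in> PR V" "homog e a" "1 \<le> e" "homog_gens V gs es'" using homog_gens_ConsE[OF Cons.prems(1)] by metis
  show ?case unfolding idl_Cons using HF_iadd_low[OF V hideal_idl[OF e(4)] e(1,2), of 0] Cons.IH[OF e(4)] e(3) by simp
qed

lemma idl_nzd:
  fixes gs :: "'k::field mpoly list"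
  assumes V: "finite V" and inf: "infinite (UNIV :: 'k set)" and gs: "homog_gens V gs es"
    and len: "length gs + Suc t = card V" and a: "a \<in> PR V" "homog e a" "1 \<le> e" and g: "growth_le V (iadd V (idl V gs) a) t"
  shows "colon V (idl V gs) a = idl V gs"
proof -
  have "growth_le V (idl V gs) (Suc t)" by (rule growth_of_iadd[OF V hideal_idl[OF gs] a g])
  then have "linear_depth V (idl V gs) (Suc t)" using linear_depth_idl[OF V inf gs] len by simp
  then show ?thesis by (rule linear_depth_nzd[OF V _ a(1,2) g])
qed

lemma homog_gens_append: "homog_gens V gs es \<Longrightarrow> homog_gens V hs es' \<Longrightarrow> homog_gens V (gs @ hs) (es @ es')"
  unfolding homog_gens_def by (rule list_all2_appendI)

lemma idl_append_commute: "idl V (xs @ ys) = idl V (ys @ xs)" by (simp add: Un_commute)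
lemma idl_middle: "idl V (xs @ g # ys) = iadd V (idl V (xs @ ys)) g"
  using ideal_gen_insert[of V g "set (xs @ ys)"] by simp

lemma growth_idl_append:
  assumes V: "finite V" and xs: "homog_gens V xs ds" and ys: "homog_gens V ys es" and g: "growth_le V (idl V (xs @ ys)) t"
  shows "growth_le V (idl V ys) (t + length xs)"
  using xs g
proof (induction xs arbitrary: ds t)
  case (Cons a xs)
  obtain e es' where e: "a \<in> PR V" "homog e a" "1 \<le> e" "homog_gens V xs es'" using homog_gens_ConsE[OF Cons.prems(1)] by metis
  have "growth_le V (idl V (xs @ ys)) (Suc t)"
    using growth_of_iadd[OF V hideal_idl[OF homog_gens_append[OF e(4) ys]] e(1-3)] Cons.prems(2) by (simp only: append_Cons idl_Cons)
  then show ?case using Cons.IH[OF e(4)] by fastforce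
qed simp

text \<open>Each of the \<open>card V\<close> forms is regular modulo those already added, and so
  lowers the Hilbert function in degree 1 by one.\<close>

lemma linear_forms_generate:
  fixes ls :: "'k::field mpoly list"
  assumes V: "finite V" and inf: "infinite (UNIV :: 'k set)" and ls: "homog_gens V ls (replicate (card V) 1)"
    and g: "growth_le V (idl V ls) 0"
  shows "graded_piece V 1 \<subseteq> idl V ls"
proof -
  have "HF V (idl V hs) 1 + length hs = card V"
    if "homog_gens V hs (replicate (length hs) 1)" "growth_le V (idl V hs) t" "length hs + t = card V" for hs :: "'k mpoly list" and t
    using that
  proof (induction hs arbitrary: t)
    case Nil
    then show ?case using HF_zero[OF V, of 1] card_mons_1[of V] by (simp add: ideal_gen_empty)
  next
    case (Cons a hs)
    have e: "a \<in> PR V" "homog 1 a" "homog_gens V hs (replicate (length hs) 1)" using Cons.prems(1) by auto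
    have g: "growth_le V (iadd V (idl V hs) a) t" using Cons.prems(2) by (simp only: idl_Cons)
    have c: "colon V (idl V hs) a = idl V hs"
      using idl_nzd[OF V inf e(3) _ e(1,2) _ g] Cons.prems(3) by simp
    have "growth_le V (idl V hs) (Suc t)" by (rule growth_of_iadd[OF V hideal_idl[OF e(3)] e(1,2) _ g]) simp
    then have "HF V (idl V hs) 1 + length hs = card V" using Cons.IH[OF e(3)] Cons.prems(3) by simp
    moreover have "HF V (idl V hs) (0 + 1) = HF V (idl V (a # hs)) (0 + 1) + HF V (colon V (idl V hs) a) 0"
      unfolding idl_Cons by (rule HF_split[OF V hideal_idl[OF e(3)] e(1,2)])
    ultimately show ?case using HF_idl_0[OF V e(3)] c by simp
  qed
  from this[of ls 0] have "HF V (idl V ls) 1 = 0" using ls g homog_gens_length[OF ls] by simp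
  then show ?thesis unfolding HF_eq_0_iff[OF V hideal_ideal[OF hideal_idl[OF ls]]] .
qed

lemma mem_of_linear:
  assumes "is_ideal V I" "graded_piece V 1 \<subseteq> I" "u \<in> PR V" "homog d u" "1 \<le> d"
  shows "u \<in> (I :: 'k::field mpoly set)"
proof (rule mem_of_variables[OF assms(1)])
  show "xpow v 1 \<in> I" if "v \<in> V" for v
    using that by (intro subsetD[OF assms(2)]) (simp add: graded_piece_iff xpow_PR homog_xpow del: One_nat_def)
  have "0 \<notin> Poly_Mapping.keys u" using assms(4,5) by (auto simp: homog_def)
  then show "Poly_Mapping.lookup u 0 = 0" by (simp add: in_keys_iff)
qed (fact assms)

text \<open>The step behind the inductions on complete intersections: \<open>g\<close> is traded for
  a generic linear form \<open>l\<close>, both regular modulo the remaining generators, until only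
  linear forms are left and the ideal contains every form of positive degree.\<close>

lemma exchange_linear:
  fixes ls gs :: "'k::field mpoly list"
  assumes V: "finite V" and inf: "infinite (UNIV :: 'k set)"
    and ls: "homog_gens V ls (replicate (length ls) 1)" and gs: "homog_gens V gs es"
    and len: "length ls + length (g # gs) = card V" and g: "g \<in> PR V" "homog e g" "1 \<le> e"
    and growth_le: "growth_le V (idl V (ls @ g # gs)) 0"
  obtains l where "l \<in> PR V" "homog 1 l" "colon V (idl V (ls @ gs)) l = idl V (ls @ gs)"
    "colon V (idl V (ls @ gs)) g = idl V (ls @ gs)" "homog_gens V (l # ls) (replicate (length (l # ls)) 1)"
    "growth_le V (idl V ((l # ls) @ gs)) 0" "idl V ((l # ls) @ gs) = iadd V (idl V (ls @ gs)) l"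
    "idl V (ls @ g # gs) = iadd V (idl V (ls @ gs)) g"
proof -
  let ?I = "idl V (ls @ gs)"
  have h: "homog_gens V (ls @ gs) (replicate (length ls) 1 @ es)" using homog_gens_append[OF ls gs] .
  have gI: "growth_le V (iadd V ?I g) 0" using growth_le unfolding idl_middle .
  have g1: "growth_le V ?I (Suc 0)" by (rule growth_of_iadd[OF V hideal_idl[OF h] g gI])
  obtain l where l: "l \<in> PR V" "homog 1 l" "growth_le V (iadd V ?I l) 0"
    by (rule generic_linear[OF V inf, of "{(?I, 0)}"]) (use hideal_idl[OF h] g1 in auto)
  show thesis
  proof (rule that[of l])
    show "colon V ?I l = ?I" using idl_nzd[OF V inf h _ l(1,2) _ l(3)] len by simp
    show "colon V ?I g = ?I" using idl_nzd[OF V inf h _ g gI] len by simp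
    show "growth_le V (idl V ((l # ls) @ gs)) 0" using l(3) by (simp only: append_Cons idl_Cons)
    show "idl V ((l # ls) @ gs) = iadd V ?I l" by (simp only: append_Cons idl_Cons)
    show "idl V (ls @ g # gs) = iadd V ?I g" by (rule idl_middle)
  qed (use l ls in auto)
qed

lemma sigma_Cons: "sigma (e # es) = (e - 1) + sigma es" by (simp add: sigma_def)
lemma sigma_Nil: "sigma [] = 0" by (simp add: sigma_def)
lemma sigma_append: "sigma (xs @ ys) = sigma xs + sigma ys" by (simp add: sigma_def)
lemma sigma_rev: "sigma (rev xs) = sigma xs" by (simp add: sigma_def rev_map[symmetric] del: One_nat_def)

text \<open>If \<open>u\<close> spans a socle element modulo \<open>I + (g)\<close> and \<open>l\<close> is linear, then \<open>l u = g u'\<close> modulo \<open>I\<close>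
  and \<open>u'\<close> spans a socle element modulo \<open>I + (l)\<close>; this shifts the degree by \<open>1 - e\<close>.\<close>
lemma socle_degree:
  fixes ls gs :: "'k::field mpoly list"
  assumes V: "finite V" and inf: "infinite (UNIV :: 'k set)"
    and "homog_gens V ls (replicate (length ls) 1)" "homog_gens V gs es"
    and "length ls + length gs = card V" and "growth_le V (idl V (ls @ gs)) 0"
    and "u \<in> PR V" "homog d u" "u \<notin> idl V (ls @ gs)" "\<And>v. v \<in> V \<Longrightarrow> xpow v 1 * u \<in> idl V (ls @ gs)"
  shows "d = sigma es"
  using assms(3-)
proof (induction gs arbitrary: ls es u d)
  case Nil
  have es: "es = []" using Nil.prems(2) by simp
  have "graded_piece V 1 \<subseteq> idl V ls" using linear_forms_generate[OF V inf] Nil.prems(1,3,4) by simp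
  then have "\<not> 1 \<le> d" using mem_of_linear[OF hideal_ideal[OF hideal_idl[OF Nil.prems(1)]]] Nil.prems(5-7) by fastforce
  then show ?case by (simp add: es sigma_Nil)
next
  case (Cons g gs)
  obtain e es' where e: "es = e # es'" "g \<in> PR V" "homog e g" "1 \<le> e" "homog_gens V gs es'" using homog_gens_ConsE[OF Cons.prems(2)] by metis
  obtain l where l: "l \<in> PR V" "homog 1 l" "colon V (idl V (ls @ gs)) l = idl V (ls @ gs)"
    "colon V (idl V (ls @ gs)) g = idl V (ls @ gs)" "homog_gens V (l # ls) (replicate (length (l # ls)) 1)"
    "growth_le V (idl V ((l # ls) @ gs)) 0" "idl V ((l # ls) @ gs) = iadd V (idl V (ls @ gs)) l"
    "idl V (ls @ g # gs) = iadd V (idl V (ls @ gs)) g"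
    by (rule exchange_linear[OF V inf Cons.prems(1) e(5) Cons.prems(3) e(2-4) Cons.prems(4)])
  let ?I = "idl V (ls @ gs)"
  have hI: "hideal V ?I" using hideal_idl[OF homog_gens_append[OF Cons.prems(1) e(5)]] .
  have ii: "is_ideal V ?I" using hI by simp
  have iig: "is_ideal V (iadd V ?I g)" using is_ideal_iadd[OF ii e(2)] .
  have iil: "is_ideal V (iadd V ?I l)" using is_ideal_iadd[OF ii l(1)] .
  note u = Cons.prems(5,6)
  have un: "u \<notin> iadd V ?I g" and xu: "\<And>v. v \<in> V \<Longrightarrow> xpow v 1 * u \<in> iadd V ?I g"
    using Cons.prems(7,8) unfolding l(8) by auto
  have "l \<in> colon V (iadd V ?I g) u"
  proof (rule mem_of_variables[OF is_ideal_colon[OF iig]])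
    show "xpow v 1 \<in> colon V (iadd V ?I g) u" if "v \<in> V" for v using xu[OF that] xpow_PR[OF that] by (simp add: colon_def)
    have "0 \<notin> Poly_Mapping.keys l" using l(2) by (auto simp: homog_def)
    then show "Poly_Mapping.lookup l 0 = 0" by (simp add: in_keys_iff)
  qed (fact l)
  then have "l * u \<in> iadd V ?I g" by (simp add: colon_def)
  then obtain p r where pr: "l * u = p + r * g" "p \<in> ?I" "r \<in> PR V" by (rule iaddE)
  have "homog (1 + d) (l * u)" using homog_mult[OF l(2) u(2)] .
  then have lu: "l * u = hcomp (1 + d) p + (if e \<le> 1 + d then hcomp (1 + d - e) r * g else 0)"
    using hcomp_homog[of "1 + d" "l * u" "1 + d"] unfolding pr(1) hcomp_add hcomp_mult_left[OF e(3)] by simp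
  have hp: "hcomp (1 + d) p \<in> ?I" using hideal_hcomp[OF hI pr(2)] .
  have uI: "u \<notin> ?I" using un iadd_superset by blast
  have "e \<le> 1 + d"
  proof (rule ccontr)
    assume "\<not> e \<le> 1 + d"
    then have "u * l \<in> ?I" using lu hp by (simp add: mult.commute)
    then have "u \<in> colon V ?I l" using u(1) by (simp add: colon_def)
    then show False using l(3) uI by simp
  qed
  define w where "w = hcomp (1 + d - e) r"
  have w: "w \<in> PR V" "homog (1 + d - e) w" unfolding w_def using pr(3) PR_hcomp by auto
  have luw: "l * u = hcomp (1 + d) p + w * g" using lu \<open>e \<le> 1 + d\<close> unfolding w_def by simp
  \<comment> \<open>Were \<open>w\<close> in \<open>I + (l)\<close>, cancelling \<open>l\<close>
    would put \<open>u\<close> into \<open>I + (g)\<close>.\<close>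
  have wn: "w \<notin> iadd V ?I l"
  proof
    assume "w \<in> iadd V ?I l"
    then obtain q s where q: "w = q + s * l" "q \<in> ?I" "s \<in> PR V" by (rule iaddE)
    have "(u - s * g) * l = hcomp (1 + d) p + q * g" using luw q(1) by (simp add: algebra_simps)
    also have "\<dots> \<in> ?I" using hp q e(2) by (intro is_idealD(3,7)[OF ii])
    finally have "u - s * g \<in> ?I" using l(3) u(1) q(3) e(2) by (auto simp: colon_def intro: PR_diff PR_mult)
    then have "(u - s * g) + s * g \<in> iadd V ?I g" using q(3) by (intro iaddI)
    then show False using un by simp
  qed
  have xw: "xpow v 1 * w \<in> iadd V ?I l" if v: "v \<in> V" for v
  proof -
    have xP: "xpow v 1 \<in> PR V" using xpow_PR[OF v] .
    obtain q s where q: "xpow v 1 * u = q + s * g" "q \<in> ?I" "s \<in> PR V" using xu[OF v] by (rule iaddE)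
    have "(xpow v 1 * w - s * l) * g = xpow v 1 * (w * g) - s * l * g" by (simp add: algebra_simps)
    also have "w * g = l * u - hcomp (1 + d) p" using luw by simp
    also have "xpow v 1 * (l * u - hcomp (1 + d) p) - s * l * g = l * (xpow v 1 * u) - xpow v 1 * hcomp (1 + d) p - s * l * g"
      by (simp add: algebra_simps)
    also have "\<dots> = l * q - xpow v 1 * hcomp (1 + d) p" unfolding q(1) by (simp add: algebra_simps)
    also have "\<dots> \<in> ?I" using q l(1) hp xP by (intro is_idealD(6)[OF ii] is_idealD(4)[OF ii])
    finally have "(xpow v 1 * w - s * l) * g \<in> ?I" .
    moreover have "xpow v 1 * w - s * l \<in> PR V" using xP w q l by (intro PR_diff PR_mult)
    ultimately have "xpow v 1 * w - s * l \<in> ?I" using l(4) unfolding colon_def by blast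
    then have "(xpow v 1 * w - s * l) + s * l \<in> iadd V ?I l" using q(3) by (intro iaddI)
    then show ?thesis by simp
  qed
  have "1 + d - e = sigma es'"
  proof (rule Cons.IH[OF l(5) e(5) _ l(6) w])
    show "length (l # ls) + length gs = card V" using Cons.prems(3) by simp
    show "w \<notin> idl V ((l # ls) @ gs)" "\<And>v. v \<in> V \<Longrightarrow> xpow v 1 * w \<in> idl V ((l # ls) @ gs)"
      unfolding l(7) by (fact wn, fact xw)
  qed
  then show ?case using \<open>e \<le> 1 + d\<close> e(4) by (simp add: e(1) sigma_Cons)
qed

lemma HF_eq_CH_linear:
  assumes V: "finite V" and I: "hideal V I" and l: "l \<in> PR V" "homog 1 l" "colon V I l = I"
  shows "HF V I j = HF_sum V (iadd V I l) j"
proof (induction j)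
  case 0
  then show ?case using HF_iadd_low[OF V I l(1,2), of 0] by (simp add: HF_sum_def)
next
  case (Suc j)
  then show ?case using HF_split[OF V I l(1,2), of j] l(3) by (simp add: HF_sum_def)
qed

lemma HF_sum_Suc: "HF_sum V I (Suc j) = HF_sum V I j + HF V I (Suc j)" by (simp add: HF_sum_def)

lemma HF_sum_const:
  assumes "\<And>j. s < j \<Longrightarrow> HF V I j = 0" "s \<le> j" shows "HF_sum V I j = HF_sum V I s"
  using assms(2) by (induction j rule: dec_induct) (auto simp: HF_sum_Suc assms(1))

text \<open>With \<open>L = I + (l)\<close>, the Hilbert function of \<open>I\<close> is
  \<open>HF_sum\<close> of \<open>L\<close>, constant from \<open>sigma es'\<close> on. Subtracting
  its shift by \<open>e\<close> gives the Hilbert function of \<open>I + (g)\<close>: it ends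
  \<open>e - 1\<close> degrees later, and its total is multiplied by \<open>e\<close>.\<close>

lemma artinian_ci_HF:
  fixes ls gs :: "'k::field mpoly list"
  assumes V: "finite V" and inf: "infinite (UNIV :: 'k set)"
    and "homog_gens V ls (replicate (length ls) 1)" "homog_gens V gs es"
    and "length ls + length gs = card V" and "growth_le V (idl V (ls @ gs)) 0"
  shows "HF V (idl V (ls @ gs)) (sigma es) = 1 \<and> (\<forall>j>sigma es. HF V (idl V (ls @ gs)) j = 0)
     \<and> HF_sum V (idl V (ls @ gs)) (sigma es) = prod_list es"
  using assms(3-)
proof (induction gs arbitrary: ls es)
  case Nil
  have es: "es = []" using Nil.prems(2) by simp
  have S: "graded_piece V 1 \<subseteq> idl V ls" using linear_forms_generate[OF V inf] Nil.prems(1,3,4) by simp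
  have ii: "is_ideal V (idl V ls)" using hideal_idl[OF Nil.prems(1)] by simp
  have "HF V (idl V ls) j = 0" if "j > 0" for j
    unfolding HF_eq_0_iff[OF V ii] using mem_of_linear[OF ii S] that by (auto simp: graded_piece_iff)
  then show ?case using HF_idl_0[OF V Nil.prems(1)] by (auto simp: es sigma_Nil HF_sum_def)
next
  case (Cons g gs)
  obtain e es' where e: "es = e # es'" "g \<in> PR V" "homog e g" "1 \<le> e" "homog_gens V gs es'" using homog_gens_ConsE[OF Cons.prems(2)] by metis
  obtain l where l: "l \<in> PR V" "homog 1 l" "colon V (idl V (ls @ gs)) l = idl V (ls @ gs)"
    "colon V (idl V (ls @ gs)) g = idl V (ls @ gs)" "homog_gens V (l # ls) (replicate (length (l # ls)) 1)"
    "growth_le V (idl V ((l # ls) @ gs)) 0" "idl V ((l # ls) @ gs) = iadd V (idl V (ls @ gs)) l"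
    "idl V (ls @ g # gs) = iadd V (idl V (ls @ gs)) g"
    by (rule exchange_linear[OF V inf Cons.prems(1) e(5) Cons.prems(3) e(2-4) Cons.prems(4)])
  let ?I = "idl V (ls @ gs)"
  let ?L = "iadd V ?I l" and ?G = "iadd V ?I g"
  let ?s = "sigma es'"
  have hI: "hideal V ?I" using hideal_idl[OF homog_gens_append[OF Cons.prems(1) e(5)]] .
  have IH: "HF V ?L ?s = 1" "\<And>j. ?s < j \<Longrightarrow> HF V ?L j = 0" "HF_sum V ?L ?s = prod_list es'"
    using Cons.IH[OF l(5) e(5) _ l(6)] Cons.prems(3) unfolding l(7) by auto
  have HI: "HF V ?I j = HF_sum V ?L j" for j by (rule HF_eq_CH_linear[OF V hI l(1-3)])
  have HG: "HF_sum V ?L (j + e) = HF V ?G (j + e) + HF_sum V ?L j" for j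
    using HF_split[OF V hI e(2,3), of j] unfolding l(4) HI .
  have HG0: "HF V ?G j = HF_sum V ?L j" if "j < e" for j
    using HF_iadd_low[OF V hI e(2,3) that] HI by simp
  have cL: "HF_sum V ?L j = prod_list es'" if "?s \<le> j" for j using HF_sum_const[OF IH(2) that] IH(3) by simp
  have sig: "sigma es = ?s + e - 1" using e(4) by (simp add: e(1) sigma_Cons)
  have 2: "HF V ?G j = 0" if "j > sigma es" for j
  proof -
    have "j - e \<ge> ?s" "j = (j - e) + e" using that sig e(4) by auto
    then show ?thesis using HG[of "j - e"] cL[of j] cL[of "j - e"] by simp
  qed
  \<comment> \<open>If \<open>sigma es' = 0\<close>, the top degree is \<open>e - 1\<close>, which
    lies outside the range of the shifted formula \<open>HG\<close>.\<close>
  have 1: "HF V ?G (sigma es) = 1"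
  proof (cases "?s = 0")
    case True
    then have "HF V ?G (sigma es) = HF_sum V ?L (sigma es)" using HG0 sig e(4) by simp
    also have "\<dots> = HF_sum V ?L ?s" using cL[of "sigma es"] IH(3) True by simp
    also have "\<dots> = 1" using True IH(1) by (simp add: HF_sum_def)
    finally show ?thesis .
  next
    case False
    then obtain k where k: "?s = Suc k" using not0_implies_Suc by blast
    then have s: "sigma es = k + e" using sig by simp
    have "HF_sum V ?L (k + e) = prod_list es'" using cL[of "k + e"] k e(4) by simp
    moreover have "HF_sum V ?L k + 1 = prod_list es'" using IH(1,3) by (simp add: k HF_sum_Suc)
    ultimately show ?thesis using HG[of k] s by simp
  qed
  have "HF_sum V ?G (sigma es) = e * prod_list es'"
  proof -
    \<comment> \<open>One degree beyond the top is included, where the Hilbert function is 0, so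
      that the splitting by \<open>g\<close> applies with shift exactly \<open>e\<close>.\<close>
    have "HF_sum V ?G (sigma es) = HF_sum V ?G (?s + e)" by (rule HF_sum_const[OF 2, symmetric]) (use sig e(4) in auto)
    moreover have "HF_sum V ?I (?s + e) = HF_sum V ?G (?s + e) + HF_sum V ?I ?s"
      using HF_sum_split(1)[OF V hI e(2,3), of ?s] unfolding l(4) .
    moreover have "HF_sum V ?I (?s + k) = HF_sum V ?I ?s + k * prod_list es'" for k
    proof (induction k)
      case (Suc k)
      have "HF V ?I (?s + Suc k) = prod_list es'" unfolding HI by (rule cL) simp
      then show ?case using Suc by (simp add: HF_sum_Suc)
    qed simp
    ultimately show ?thesis by simp
  qed
  then show ?case unfolding l(8) using 1 2 by (simp add: e(1))
qed

section \<open>Duality in an artinian complete intersection\<close>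

context
  fixes V :: "nat set" and gs :: "'k::field mpoly list" and es :: "nat list" and J
  assumes V: "finite V" and inf: "infinite (UNIV :: 'k set)"
    and gs: "homog_gens V gs es" and len: "length gs = card V" and growth_le: "growth_le V (idl V gs) 0"
  defines "J \<equiv> idl V gs"
begin

lemma artinian_hideal: "hideal V J" unfolding J_def by (rule hideal_idl[OF gs])
lemma artinian_is_ideal: "is_ideal V J" using artinian_hideal by simp

lemma artinian_HF: "HF V J (sigma es) = 1" "\<And>j. sigma es < j \<Longrightarrow> HF V J j = 0" "HF_sum V J (sigma es) = prod_list es"
  using artinian_ci_HF[OF V inf, of "[]" gs es] gs len growth_le unfolding J_def by auto

lemma socle_step:
  assumes "u \<in> PR V" "homog d u" "u \<notin> J" "d < sigma es"
  obtains v where "v \<in> V" "xpow v 1 * u \<notin> J"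
proof (rule ccontr)
  assume "\<not> thesis"
  then have "xpow v 1 * u \<in> J" if "v \<in> V" for v using that \<open>\<And>v. v \<in> V \<Longrightarrow> xpow v 1 * u \<notin> J \<Longrightarrow> thesis\<close> by blast
  then have "d = sigma es" using socle_degree[OF V inf, of "[]" gs es u d] gs len growth_le assms unfolding J_def by simp
  then show False using assms(4) by simp
qed

lemma degree_le_sigma: "u \<in> PR V \<Longrightarrow> homog d u \<Longrightarrow> u \<notin> J \<Longrightarrow> d \<le> sigma es"
  using HF_pos_of_notin[OF V artinian_is_ideal] artinian_HF(2) by (metis linorder_not_less)

text \<open>By \<open>socle_degree\<close>, a form outside \<open>J\<close> of degree below
  \<open>sigma es\<close> is not killed by all variables, so multiplication can be continued up to
  the top degree.\<close>

lemma multiply_up: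
  assumes u: "u \<in> PR V" "homog d u" "u \<notin> J" and r: "d + r \<le> sigma es"
  obtains w where "w \<in> PR V" "homog r w" "w * u \<notin> J"
  using r
proof (induction r arbitrary: thesis)
  case 0
  then show ?case using u by (metis PR_1 homog_1 mult_1)
next
  case (Suc r)
  obtain w where w: "w \<in> PR V" "homog r w" "w * u \<notin> J" using Suc by auto
  obtain v where v: "v \<in> V" "xpow v 1 * (w * u) \<notin> J"
    by (rule socle_step[OF PR_mult[OF w(1) u(1)] homog_mult[OF w(2) u(2)] w(3)]) (use Suc.prems in auto)
  show ?case
    by (rule Suc.prems(1)[of "xpow v 1 * w"])
      (use v w xpow_PR[OF v(1), of 1] homog_mult[OF homog_xpow[of 1 v] w(2)] in \<open>auto simp: mult.assoc intro: PR_mult\<close>)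
qed

text \<open>\<open>J\<close> has codimension one in the top degree, and \<open>f\<close> is a
  coordinate there. It turns products of complementary degrees into scalars.\<close>

lemma socle_functional:
  obtains f :: "'k mpoly \<Rightarrow> 'k" where "Vector_Spaces.linear pscale (*) f"
    "\<And>x. x \<in> graded_piece V (sigma es) \<Longrightarrow> f x = 0 \<longleftrightarrow> x \<in> J"
proof -
  interpret vp: vector_space_pair "pscale :: 'k \<Rightarrow> 'k mpoly \<Rightarrow> 'k mpoly" "(*) :: 'k \<Rightarrow> 'k \<Rightarrow> 'k"
    by unfold_locales (auto simp: algebra_simps)
  let ?S = "graded_piece V (sigma es) :: 'k mpoly set"
  let ?A = "J \<inter> ?S"
  obtain w where w: "w \<in> ?S" "w \<notin> J"
    using ex_notin_of_HF[OF V artinian_is_ideal, of "sigma es"] artinian_HF(1) by (auto simp: graded_piece_iff)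
  obtain B where B: "B \<subseteq> ?A" "pm.independent B" "?A \<subseteq> pm.span B" "card B = pm.dim ?A" by (rule pm.basis_exists)
  have sA: "pm.subspace ?A" by (intro pm.subspace_inter subspace_ideal[OF artinian_is_ideal] subspace_graded_piece)
  have spB: "pm.span B = ?A" by (rule pm.span_subspace[OF B(1,3) sA])
  have fB: "finite B" by (rule pm.fin_span_independent(1)[OF fin_span_graded_piece[OF V] _ B(2)]) (use B(1) in auto)
  have iB: "pm.independent (insert w B)" using B(2) w spB by (intro pm.independent_insertI) auto
  have wB: "w \<notin> B" using w B(1) by blast
  have "pm.dim ?S = card B + 1" using HF_add[OF V, of J "sigma es"] artinian_HF(1) B(4) by (simp add: kdim_def)
  also have "\<dots> = pm.dim (pm.span (insert w B))" using pm.dim_span_eq_card_independent[OF iB] fB wB by simp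
  finally have "pm.span (insert w B) = ?S"
    using B(1) w by (intro pm.subspace_eq_of_dim fin_span_graded_piece V pm.span_minimal subspace_graded_piece pm.subspace_span) auto
  note spS = this
  obtain f where f: "Vector_Spaces.linear pscale (*) f" "\<forall>x\<in>insert w B. f x = (if x = w then 1 else 0)"
    using vp.linear_independent_extend[OF iB, of "\<lambda>x. if x = w then 1 else 0"] by blast
  interpret f: Vector_Spaces.linear pscale "(*)" f by (rule f(1))
  have f0: "f x = 0" if "x \<in> ?A" for x
  proof -
    have "pm.subspace {x. f x = 0}" by (auto simp: pm.subspace_def f.add f.scale)
    then have "pm.span B \<subseteq> {x. f x = 0}" using f(2) wB by (intro pm.span_minimal) auto
    then show ?thesis using that spB by blast
  qed
  have "x \<in> J" if x: "x \<in> ?S" "f x = 0" for x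
  proof -
    have "x \<in> pm.span (insert w B)" using x(1) spS by simp
    then obtain k where k: "x - pscale k w \<in> pm.span B" using pm.span_breakdown_eq by blast
    then have xk: "x - pscale k w \<in> ?A" using spB by simp
    have "f (x - pscale k w) = 0" using f0 xk by blast
    then have "k = 0" using x(2) f(2) by (simp add: f.diff f.scale)
    then show ?thesis using xk by simp
  qed
  then show thesis using f(1) f0 by (intro that[of f]) auto
qed

text \<open>The pairing \<open>f (v * w * u)\<close> between degrees \<open>a\<close> and
  \<open>b\<close> has \<open>J : u\<close> as kernel on both sides: by \<open>multiply_up\<close>,
  a product \<open>v * u\<close> outside \<open>J\<close> has a multiple outside \<open>J\<close> in
  the top degree. This reflects that \<open>S/(J : u)\<close> is Gorenstein with socle degree
  \<open>sigma es - d\<close>.\<close>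

lemma colon_HF_le:
  assumes u: "u \<in> PR V" "homog d u" and s: "a + b + d = sigma es"
  shows "HF V (colon V J u) b \<le> HF V (colon V J u) a"
proof -
  obtain f :: "'k mpoly \<Rightarrow> 'k" where f: "Vector_Spaces.linear pscale (*) f"
    "\<And>x. x \<in> graded_piece V (sigma es) \<Longrightarrow> f x = 0 \<longleftrightarrow> x \<in> J" using socle_functional by blast
  interpret f: Vector_Spaces.linear pscale "(*)" f by (rule f(1))
  let ?Sa = "graded_piece V a :: 'k mpoly set" and ?Sb = "graded_piece V b :: 'k mpoly set"
  let ?F = "\<lambda>v w. f (v * w * u)"
  have prod: "v * w * u \<in> graded_piece V (sigma es)" if "v \<in> ?Sa" "w \<in> ?Sb" for v w
    using graded_piece_mult[OF graded_piece_mult[OF that], of u d] u s by (simp add: graded_piece_iff)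
  have pair: "v \<in> colon V J u" if c: "c + b' + d = sigma es" "v \<in> graded_piece V c" "\<And>w. w \<in> graded_piece V b' \<Longrightarrow> v * w * u \<in> J" for c b' v
  proof (rule ccontr)
    assume "v \<notin> colon V J u"
    then have n: "v * u \<notin> J" using c by (simp add: colon_def graded_piece_iff)
    have vu: "v * u \<in> PR V" "homog (c + d) (v * u)" using c u by (auto simp: graded_piece_iff intro: PR_mult homog_mult)
    obtain w where "w \<in> PR V" "homog b' w" "w * (v * u) \<notin> J"
      by (rule multiply_up[OF vu n, of b']) (use c(1) in auto)
    then show False using c(3)[of w] by (simp add: graded_piece_iff mult_ac)
  qed
  have lin: "Vector_Spaces.linear pscale (*) (\<lambda>v. f (v * p))" for p
  proof -
    have "pscale c x * p = pscale c (x * p)" for c x by (simp add: pscale_eq mult.assoc)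
    then have "\<forall>c x. f (pscale c x * p) = c * f (x * p)" by (simp add: f.scale)
    moreover have "\<forall>x y. f ((x + y) * p) = f (x * p) + f (y * p)" by (simp add: distrib_right f.add)
    ultimately show ?thesis using f(1) unfolding Vector_Spaces.linear_iff by blast
  qed
  have l1: "Vector_Spaces.linear pscale (*) (\<lambda>v. ?F v w)" for w using lin[of "w * u"] by (simp add: mult.assoc)
  have l2: "Vector_Spaces.linear pscale (*) (\<lambda>w. ?F v w)" for v using lin[of "v * u"] by (simp add: mult_ac)
  have K: "{v\<in>?Sa. \<forall>w\<in>?Sb. ?F v w = 0} = colon V J u \<inter> ?Sa"
  proof (intro equalityI subsetI)
    fix v assume "v \<in> {v\<in>?Sa. \<forall>w\<in>?Sb. ?F v w = 0}"
    then show "v \<in> colon V J u \<inter> ?Sa" using pair[OF s] f(2) prod by blast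
  next
    fix v assume v: "v \<in> colon V J u \<inter> ?Sa"
    have "?F v w = 0" if w: "w \<in> ?Sb" for w
    proof -
      have "w * (v * u) \<in> J" using v w by (auto simp: colon_def graded_piece_iff intro: is_idealD(4)[OF artinian_is_ideal])
      then show ?thesis using f(2) prod[of v w] v w by (simp add: mult_ac)
    qed
    then show "v \<in> {v\<in>?Sa. \<forall>w\<in>?Sb. ?F v w = 0}" using v by blast
  qed
  have L: "{w\<in>?Sb. \<forall>v\<in>?Sa. ?F v w = 0} = colon V J u \<inter> ?Sb"
  proof (intro equalityI subsetI)
    fix w assume w: "w \<in> {w\<in>?Sb. \<forall>v\<in>?Sa. ?F v w = 0}"
    have "w * v * u \<in> J" if "v \<in> ?Sa" for v
    proof -
      have "v * w * u \<in> J" using w that f(2) prod[of v w] by blast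
      then show ?thesis by (simp only: mult.commute[of w v])
    qed
    then show "w \<in> colon V J u \<inter> ?Sb" using pair[of b a w] s w by auto
  next
    fix w assume w: "w \<in> colon V J u \<inter> ?Sb"
    have "?F v w = 0" if v: "v \<in> ?Sa" for v
    proof -
      have "v * (w * u) \<in> J" using v w by (auto simp: colon_def graded_piece_iff intro: is_idealD(4)[OF artinian_is_ideal])
      then show ?thesis using f(2) prod[of v w] v w by (simp add: mult_ac)
    qed
    then show "w \<in> {w\<in>?Sb. \<forall>v\<in>?Sa. ?F v w = 0}" using w by blast
  qed
  have "pm.dim ?Sb + pm.dim (colon V J u \<inter> ?Sa) \<le> pm.dim ?Sa + pm.dim (colon V J u \<inter> ?Sb)"
    using pm.codim_bilinear_kernels[OF fin_span_graded_piece[OF V, of a] subspace_graded_piece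
        fin_span_graded_piece[OF V, of b] subspace_graded_piece, of ?F] l1 l2 unfolding K L by blast
  then show ?thesis
    using HF_add[OF V, of "colon V J u" a] HF_add[OF V, of "colon V J u" b] unfolding kdim_def by linarith
qed

lemma colon_HF_symmetric:
  assumes "u \<in> PR V" "homog d u" "a + b + d = sigma es"
  shows "HF V (colon V J u) a = HF V (colon V J u) b"
  using colon_HF_le[OF assms] colon_HF_le[OF assms(1,2), of b a] assms(3) by simp

text \<open>The linear forms killing \<open>u\<close> are completed, inside the annihilator of \<open>u\<close>, to a regular sequence whose
  remaining degrees are the largest \<open>card V - t\<close> of the \<open>es\<close>; its socle degree bounds that of the annihilator.\<close>
lemma linear_annihilator_bound:
  assumes u: "u \<in> PR V" "homog d u" "u \<notin> J" and srt: "sorted es"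
  defines "t \<equiv> kdim (colon V J u \<inter> graded_piece V 1)"
  shows "sigma (take t es) \<le> d" "t \<le> card V" "HF V (colon V J u) 1 = card V - t"
proof -
  let ?n = "card V"
  let ?S = "graded_piece V 1 :: 'k mpoly set" and ?K = "colon V J u"
  have iK: "is_ideal V ?K" using is_ideal_colon[OF artinian_is_ideal] .
  have kS: "pm.dim ?S = ?n" using kdim_graded_piece[OF V, of 1, where 'k='k] card_mons_1[of V] by (simp add: kdim_def)
  show H: "t \<le> card V" "HF V (colon V J u) 1 = card V - t"
    using HF_add[OF V, of ?K 1] kS unfolding t_def kdim_def by auto
  \<comment> \<open>\<open>P\<close> is a basis of the linear forms killing \<open>u\<close>, and
    \<open>C\<close> completes it to a basis of all linear forms.\<close>
  obtain P C where PC: "P \<subseteq> ?K \<inter> ?S" "C \<subseteq> ?S" "pm.independent (P \<union> C)" "?K \<inter> ?S \<subseteq> pm.span P"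
    "?S \<subseteq> pm.span (P \<union> C)" "finite P" "finite C" "P \<inter> C = {}" "card P = pm.dim (?K \<inter> ?S)" "card P + card C = pm.dim ?S"
    by (rule pm.extend_basis[OF fin_span_graded_piece[OF V], of "?K \<inter> ?S" 1]) auto
  obtain ps where ps: "set ps = P" "distinct ps" using finite_distinct_list[OF PC(6)] by blast
  obtain cs where cs: "set cs = C" "distinct cs" using finite_distinct_list[OF PC(7)] by blast
  have lps: "length ps = t" using ps PC(9) distinct_card[of ps] unfolding t_def kdim_def by simp
  have lcs: "length cs = ?n - t" using cs PC(9,10) distinct_card[of cs] kS unfolding t_def kdim_def by simp
  have lin: "homog_gens V xs (replicate (length xs) 1)" if "set xs \<subseteq> ?S" for xs
    using that by (auto simp: homog_gens_def list_all2_conv_all_nth graded_piece_iff dest!: nth_mem)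
  have hps: "homog_gens V ps (replicate t 1)" and hcs: "homog_gens V cs (replicate (?n - t) 1)"
    using lin[of ps] lin[of cs] ps cs PC lps lcs by auto
  have iPC: "is_ideal V (idl V (cs @ ps))" using hideal_idl[OF homog_gens_append[OF hcs hps]] by simp
  have mem: "x \<in> idl V xs" if "x \<in> set xs" "homog_gens V xs ds" for x xs ds
    using that
  proof (induction xs arbitrary: ds)
    case (Cons y ys)
    obtain ds' where ds': "homog_gens V ys ds'" using homog_gens_ConsE[OF Cons.prems(2)] by metis
    show ?case using Cons ds' iadd_mem[OF hideal_ideal[OF hideal_idl[OF ds']]] iadd_superset unfolding idl_Cons by fastforce
  qed simp
  have "pm.span (P \<union> C) \<subseteq> idl V (cs @ ps)"
    using mem[OF _ homog_gens_append[OF hcs hps]] ps cs by (intro pm.span_minimal subspace_ideal[OF iPC]) auto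
  then have S: "?S \<subseteq> idl V (cs @ ps)" using PC(5) by blast
  have "growth_le V (idl V (cs @ ps)) 0"
    using S by (intro growth_0_of_variables iPC) (auto simp: graded_piece_iff subset_iff xpow_PR homog_xpow simp del: One_nat_def)
  \<comment> \<open>Adding the \<open>n - t\<close> forms \<open>cs\<close> makes the quotient
    artinian, so \<open>ps\<close> alone leaves growth at most \<open>n - t\<close>.\<close>
  then have grps: "growth_le V (idl V ps) (?n - t)" using growth_idl_append[OF V hcs hps] lcs by fastforce
  have les: "length es = ?n" using len homog_gens_length[OF gs] by simp
  have take_sub: "homog_gens V (take i gs) (take i es)" "homog_gens V (drop i gs) (drop i es)" for i
    using gs unfolding homog_gens_def by (auto intro: list_all2_takeI list_all2_dropI)
  have idl_least: "idl V xs \<subseteq> A" if "is_ideal V A" "set xs \<subseteq> A" for xs A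
    using that(2)
  proof (induction xs)
    case Nil then show ?case using is_idealD(2)[OF that(1)] by (simp add: ideal_gen_empty)
  next
    case (Cons y ys) then show ?case unfolding idl_Cons by (intro iadd_least[OF that(1)]) auto
  qed
  \<comment> \<open>Counting from 0, the \<open>i\<close>-th form added has degree
    \<open>es ! (t + i)\<close>; the degrees are reversed because each new form is
    prepended.\<close>
  have "\<exists>hs. homog_gens V hs (rev (take i (drop t es))) \<and> set hs \<subseteq> J \<and> growth_le V (idl V (hs @ ps)) (?n - t - i)"
    if "i \<le> ?n - t" for i
    using that
  proof (induction i)
    case 0
    then show ?case using grps by (intro exI[of _ "[]"]) auto
  next
    case (Suc i)
    obtain hs where hs: "homog_gens V hs (rev (take i (drop t es)))" "set hs \<subseteq> J" "growth_le V (idl V (hs @ ps)) (?n - t - i)"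
      using Suc by auto
    let ?I = "idl V (hs @ ps)" and ?k = "t + i" and ?r = "?n - t - Suc i"
    have hI: "hideal V ?I" using hideal_idl[OF homog_gens_append[OF hs(1) hps]] .
    have kn: "?k < ?n" using Suc.prems by simp
    have g1: "growth_le V ?I (Suc ?r)" using hs(3) Suc.prems by (simp add: Suc_diff_Suc)
    obtain T where T: "finite T" "\<And>p. p \<in> T \<Longrightarrow> hideal V p \<and> prime_ideal V p \<and> ?I \<subseteq> p \<and> \<not> growth_le V p ?r"
       "\<And>g e. g \<in> PR V \<Longrightarrow> homog e g \<Longrightarrow> 1 \<le> e \<Longrightarrow> (\<forall>p\<in>T. g \<notin> p) \<Longrightarrow> growth_le V (iadd V ?I g) ?r"
      using growth_drop_avoiding_primes[OF V hI g1] by blast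
    let ?e = "es ! ?k"
    let ?Y = "idl V (take (Suc ?k) gs)"
    have hY: "hideal V ?Y" by (rule hideal_idl[OF take_sub(1)])
    have iY: "is_ideal V ?Y" using hY by simp
    have gY: "growth_le V ?Y ?r"
    proof -
      have "idl V (drop (Suc ?k) gs @ take (Suc ?k) gs) = idl V gs"
        by (subst idl_append_commute) (simp only: append_take_drop_id)
      then have "growth_le V (idl V (drop (Suc ?k) gs @ take (Suc ?k) gs)) 0" using growth_le by simp
      from growth_idl_append[OF V take_sub(2) take_sub(1) this]
      have "growth_le V ?Y (0 + length (drop (Suc ?k) gs))" .
      then show ?thesis using len by simp
    qed
    \<comment> \<open>By sortedness \<open>Y\<close> is generated in degrees at most
      \<open>es ! (t + i)\<close>. A prime containing all its forms of exactly that degree would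
      contain \<open>Y\<close>: multiply each generator by a power of a variable outside the prime.
      For a prime in \<open>T\<close> this contradicts the growth of \<open>Y\<close>.\<close>
    let ?X = "?Y \<inter> graded_piece V ?e"
    have sX: "pm.subspace ?X" by (intro pm.subspace_inter subspace_ideal[OF iY] subspace_graded_piece)
    have nX: "\<not> ?X \<subseteq> p" if p: "p \<in> T" for p
    proof
      assume Xp: "?X \<subseteq> p"
      have pp: "hideal V p" "prime_ideal V p" "\<not> growth_le V p ?r" using T(2)[OF p] by auto
      have ip: "is_ideal V p" using pp by simp
      obtain v where v: "v \<in> V" "xpow v 1 \<notin> p"
        using growth_0_of_variables[OF ip] growth_mono pp(3) by blast
      have xm: "xpow v m \<notin> p" for m
      proof (induction m)
        case 0
        have "xpow v 0 = (1 :: 'k mpoly)" by (simp add: xpow_def)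
        then show ?case using prime_idealD(2)[OF pp(2)] by simp
      next
        case (Suc m)
        have "xpow v (Suc m) = xpow v 1 * (xpow v m :: 'k mpoly)" by (simp add: xpow_def mult_single flip: single_add)
        then show ?case using prime_idealD(3)[OF pp(2) xpow_PR[OF v(1)] xpow_PR[OF v(1)]] Suc v(2) by metis
      qed
      have "set (take (Suc ?k) gs) \<subseteq> p"
      proof
        fix g assume g: "g \<in> set (take (Suc ?k) gs)"
        then obtain j where j: "j < Suc ?k" "j < length gs" "g = gs ! j" by (auto simp: in_set_conv_nth)
        have gj: "g \<in> PR V" "homog (es ! j) g" using gs j unfolding homog_gens_def by (auto dest: list_all2_nthD)
        have "es ! j \<le> ?e" using srt j(1) kn les by (intro sorted_nth_mono) auto
        then have "g * xpow v (?e - es ! j) \<in> graded_piece V ?e"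
          using gj homog_mult[OF gj(2) homog_xpow[of "?e - es ! j" v]] xpow_PR[OF v(1)] by (auto simp: graded_piece_iff intro: PR_mult)
        moreover have "g * xpow v (?e - es ! j) \<in> ?Y"
          by (rule is_idealD(7)[OF iY xpow_PR[OF v(1)] mem[OF g take_sub(1)]])
        ultimately have "g * xpow v (?e - es ! j) \<in> p" using Xp by blast
        then show "g \<in> p" using prime_idealD(3)[OF pp(2) gj(1) xpow_PR[OF v(1)]] xm by blast
      qed
      then have "?Y \<subseteq> p" by (rule idl_least[OF ip])
      then show False using growth_superset[OF V pp(1) gY] pp(3) by blast
    qed
    obtain g where g: "g \<in> ?X" "\<And>p. p \<in> T \<Longrightarrow> g \<notin> p"
      using avoid_subspaces[OF inf T(1) sX] nX T(2) subspace_ideal hideal_ideal by meson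
    have gp: "g \<in> PR V" "homog ?e g" using g(1) by (auto simp: graded_piece_iff)
    have e1: "1 \<le> ?e" using gs kn len unfolding homog_gens_def by (auto dest: list_all2_nthD)
    have "growth_le V (idl V ((g # hs) @ ps)) ?r" 
    proof -
      have "\<forall>p\<in>T. g \<notin> p" using g(2) by blast
      from T(3)[OF gp e1 this] show ?thesis by (simp only: append_Cons idl_Cons)
    qed
    moreover have "homog_gens V (g # hs) (rev (take (Suc i) (drop t es)))"
      using hs(1) gp e1 kn les by (simp add: take_Suc_conv_app_nth)
    moreover have "?Y \<subseteq> J" unfolding J_def
      by (rule idl_least) (use hideal_idl[OF gs] mem[OF _ gs] in \<open>auto dest: in_set_takeD\<close>)
    then have "set (g # hs) \<subseteq> J" using g(1) hs(2) by auto
    ultimately show ?case by blast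
  qed
  from this[of "?n - t"] obtain hs where hs: "homog_gens V hs (rev (drop t es))" "set hs \<subseteq> J" "growth_le V (idl V (hs @ ps)) 0"
    using les by auto
  have lhs: "length hs = ?n - t" using homog_gens_length[OF hs(1)] les by simp
  have z: "HF V (idl V (ps @ hs)) j = 0" if "j > sigma (drop t es)" for j
    using artinian_ci_HF[OF V inf _ hs(1), of ps] hps lps lhs H(1) hs(3) that sigma_rev[of "drop t es"]
    by (subst (asm) idl_append_commute) auto
  have sub: "idl V (ps @ hs) \<subseteq> ?K"
    using ps PC(1) hs(2) colon_superset[OF artinian_is_ideal u(1)] by (intro idl_least[OF iK]) auto
  have ds: "d \<le> sigma es" using degree_le_sigma[OF u] .
  obtain w where w: "w \<in> PR V" "homog (sigma es - d) w" "w * u \<notin> J"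
    by (rule multiply_up[OF u, of "sigma es - d"]) (use ds in auto)
  have "w \<notin> ?K" using w by (simp add: colon_def)
  then have "w \<notin> idl V (ps @ hs)" using sub by blast
  then have "HF V (idl V (ps @ hs)) (sigma es - d) \<noteq> 0"
    using HF_pos_of_notin[OF V _ w(1,2)] hideal_idl[OF homog_gens_append[OF hps hs(1)]] by simp
  \<comment> \<open>\<open>w\<close> survives modulo \<open>ps @ hs\<close>, whose quotient ends in
    degree \<open>sigma (drop t es)\<close> because the linear forms contribute 0.\<close>
  then have "sigma es - d \<le> sigma (drop t es)" using z by (metis linorder_not_less)
  moreover have "sigma es = sigma (take t es) + sigma (drop t es)" by (simp flip: sigma_append)
  ultimately show "sigma (take t es) \<le> d" using ds by linarith
qed

text \<open>The Hilbert function \<open>H\<close> of \<open>S/(J : u)\<close> is at least 1 at both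
  ends, whence the 2; by symmetry the inner degrees fold into two initial segments, a middle degree
  being counted once. The upper limits are the floor and the ceiling of half of
  \<open>sigma es + D - 1\<close>. The function \<open>\<psi>\<close> stands for \<open>phi\<close>
  and frees the bound from the field over which \<open>phi\<close> is formed.\<close>

lemma colon_dimension_bound:
  fixes \<psi> :: "nat \<Rightarrow> int"
  assumes u: "u \<in> PR V" "homog D u" "u \<notin> J" and D: "D < sigma es" and srt: "sorted es"
    and \<psi>: "\<And>E t. t \<le> card V \<Longrightarrow> sigma (take t es) \<le> E \<Longrightarrow> E < sigma es \<Longrightarrow> \<psi> (Suc E) \<le> int (card V - t)"
  shows "2 + (\<Sum>m\<in>{D+1..(sigma es + D - 1) div 2}. \<psi> m) + (\<Sum>m\<in>{D+1..(sigma es + D) div 2}. \<psi> m)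
    \<le> int (HF_sum V (colon V J u) (sigma es - D))"
proof -
  let ?K = "colon V J u"
  define s where "s = sigma es - D"
  have s: "sigma es = s + D" "s \<ge> 1" using D unfolding s_def by auto
  have hK: "hideal V ?K" by (rule hideal_colon[OF artinian_hideal u(2)])
  define H where "H j = int (HF V ?K j)" for j
  have sym: "H j = H (s - j)" if "j \<le> s" for j
    unfolding H_def using colon_HF_symmetric[OF u(1,2), of j "s - j"] that s by simp
  have "HF V ?K 0 \<noteq> 0"
    using HF_pos_of_notin[OF V hideal_ideal[OF hK] PR_1 homog_1] u by (simp add: colon_def)
  then have H0: "H 0 \<ge> 1" unfolding H_def by simp
  have Hs: "H s \<ge> 1" using sym[of 0] H0 by simp
  \<comment> \<open>Take a multiple \<open>w * u\<close> outside \<open>J\<close> in degree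
    \<open>D + j - 1\<close>. The linear forms modulo those killing it embed into degree
    \<open>j\<close> of \<open>S/(J : u)\<close> through multiplication by \<open>w\<close>.\<close>
  have H\<psi>: "\<psi> (D + j) \<le> H j" if j: "1 \<le> j" "j \<le> s" for j
  proof -
    obtain w where w: "w \<in> PR V" "homog (j - 1) w" "w * u \<notin> J"
      by (rule multiply_up[OF u, of "j - 1"]) (use j s in auto)
    have wu: "w * u \<in> PR V" "homog (j - 1 + D) (w * u)" using w u by (auto intro: PR_mult homog_mult)
    note b = linear_annihilator_bound[OF wu w(3) srt]
    have "\<psi> (Suc (j - 1 + D)) \<le> int (HF V (colon V J (w * u)) 1)"
      unfolding b(3) by (rule \<psi>[OF b(2) b(1)]) (use j s in auto)
    also have "colon V J (w * u) = colon V ?K w" using colon_colon[OF w(1) u(1), of J] by simp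
    also have "HF V (colon V ?K w) 1 \<le> HF V ?K (1 + (j - 1))" using HF_split[OF V hK w(1,2), of 1] by simp
    finally show ?thesis using j unfolding H_def by (simp add: add.commute)
  qed
  define a where "a = (s - 1) div 2"
  define b where "b = s div 2"
  have ab: "a + b = s - 1" "a < s" "b < s" unfolding a_def b_def using s(2) by presburger+
  have "int (HF_sum V ?K s) = (\<Sum>j\<le>s. H j)" unfolding HF_sum_def H_def by simp
  also have "\<dots> = H 0 + (\<Sum>j\<in>{1..s}. H j)"
    by (simp add: atMost_atLeast0 sum.atLeast_Suc_atMost)
  also have "(\<Sum>j\<in>{1..s}. H j) = H s + (\<Sum>j\<in>{1..s-1}. H j)"
    using s(2) by (cases s) (auto simp: atLeastAtMostSuc_conv)
  also have "{1..s-1} = {1..b} \<union> {b+1..s-1}" using ab by auto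
  also have "(\<Sum>j\<in>{1..b} \<union> {b+1..s-1}. H j) = (\<Sum>j\<in>{1..b}. H j) + (\<Sum>j\<in>{b+1..s-1}. H j)"
    by (rule sum.union_disjoint) auto
  also have "(\<Sum>j\<in>{b+1..s-1}. H j) = (\<Sum>j\<in>{1..a}. H j)"
    by (rule sum.reindex_bij_witness[of _ "\<lambda>i. s - i" "\<lambda>i. s - i"]) (use ab in \<open>auto intro: sym[symmetric]\<close>)
  finally have "int (HF_sum V ?K s) = H 0 + (H s + ((\<Sum>j\<in>{1..b}. H j) + (\<Sum>j\<in>{1..a}. H j)))" .
  moreover have "(\<Sum>j\<in>{1..c}. \<psi> (D + j)) \<le> (\<Sum>j\<in>{1..c}. H j)" if "c < s" for c
    using that by (intro sum_mono H\<psi>) auto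
  moreover have "(\<Sum>m\<in>{D+1..D+c}. \<psi> m) = (\<Sum>j\<in>{1..c}. \<psi> (D + j))" for c
    by (rule sum.reindex_bij_witness[of _ "\<lambda>i. D + i" "\<lambda>i. i - D"]) auto
  moreover have "(sigma es + D - 1) div 2 = D + a" "(sigma es + D) div 2 = D + b"
    unfolding a_def b_def s(1) using s(2) by presburger+
  ultimately show ?thesis using H0 Hs ab unfolding s_def[symmetric] by (smt (verit))
qed

end

subsection \<open>Growth of principal ideals in a complete intersection\<close>

lemma sum_choose_shift: "(\<Sum>i\<le>j. (i + t) choose t) = (j + Suc t) choose Suc t"
  by (induction j) auto

text \<open>Passing to a generic linear section: if \<open>l\<close> is regular modulo \<open>I\<close> and modulo \<open>I : G\<close>, then
  \<open>HF (I : G) j = HF_sum ((I : G) + (l)) j \<ge> HF_sum ((I + (l)) : G) j\<close>.\<close>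
lemma colon_growth_infinite_field:
  fixes gs :: "'k::field mpoly list" and \<psi> :: "nat \<Rightarrow> int"
  assumes V: "finite V" and inf: "infinite (UNIV :: 'k set)"
    and "homog_gens V gs es" "sorted es" "growth_le V (idl V gs) t" "length gs + t = card V"
    and "G \<in> PR V" "homog D G" "G \<notin> idl V gs"
    and "\<And>E k. k \<le> card V \<Longrightarrow> sigma (take k (replicate t 1 @ es)) \<le> E \<Longrightarrow> E < sigma es \<Longrightarrow> \<psi> (Suc E) \<le> int (card V - k)"
  shows "\<exists>N c. 1 \<le> N \<and> N \<le> prod_list es \<and> (\<forall>j. N * ((j + t) choose t) \<le> HF_sum V (colon V (idl V gs) G) (j + c))
    \<and> (\<forall>j. HF_sum V (idl V gs) j \<le> prod_list es * ((j + t) choose t))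
    \<and> (\<forall>E. D \<le> E \<longrightarrow> E < sigma es \<longrightarrow>
        2 + (\<Sum>m\<in>{E+1..(sigma es + E - 1) div 2}. \<psi> m) + (\<Sum>m\<in>{E+1..(sigma es + E) div 2}. \<psi> m) \<le> int N)"
  using assms(3-)
proof (induction t arbitrary: gs es G D)
  case 0
  let ?J = "idl V gs"
  have len: "length gs = card V" using 0(4) by simp
  note ctx = V inf 0(1) len 0(3)
  have artinian_is_ideal: "is_ideal V ?J" using artinian_is_ideal[OF ctx] .
  have hK: "hideal V (colon V ?J G)" by (rule hideal_colon[OF artinian_hideal[OF ctx] 0(6)])
  \<comment> \<open>By degree \<open>sigma es\<close> the partial sums have reached the full length
    of \<open>S/(J : G)\<close>, so the offset \<open>c = sigma es\<close> gives the bound for all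
    \<open>j\<close>.\<close>
  let ?N = "HF_sum V (colon V ?J G) (sigma es)"
  have Jmax: "HF_sum V ?J j \<le> prod_list es" for j
  proof (cases "j \<le> sigma es")
    case True
    then show ?thesis using HF_sum_mono2[of j "sigma es" V ?J] artinian_HF(3)[OF ctx] by simp
  next
    case False
    then show ?thesis using HF_sum_const[of "sigma es" V ?J j, OF artinian_HF(2)[OF ctx]] artinian_HF(3)[OF ctx] by simp
  qed
  have "HF V (colon V ?J G) 0 \<noteq> 0"
    using HF_pos_of_notin[OF V hideal_ideal[OF hK] PR_1 homog_1] 0(5,7) by (simp add: colon_def)
  then have "1 \<le> HF_sum V (colon V ?J G) 0" by (simp add: HF_sum_def)
  also have "\<dots> \<le> ?N" by (rule HF_sum_mono2) simp
  finally have N1: "1 \<le> ?N" .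
  have N2: "?N \<le> prod_list es" using HF_sum_mono[OF V colon_superset[OF artinian_is_ideal 0(5)]] Jmax order.trans by blast
  \<comment> \<open>Dividing out linear forms may have lowered the degree of \<open>G\<close>. A
    multiple of \<open>G\<close> of degree \<open>E\<close> restores the bound, since its
    annihilator is at least as large.\<close>
  have N3: "2 + (\<Sum>m\<in>{E+1..(sigma es + E - 1) div 2}. \<psi> m) + (\<Sum>m\<in>{E+1..(sigma es + E) div 2}. \<psi> m) \<le> int ?N"
    if E: "D \<le> E" "E < sigma es" for E
  proof -
    obtain w where w: "w \<in> PR V" "homog (E - D) w" "w * G \<notin> ?J"
      by (rule multiply_up[OF ctx 0(5-7), of "E - D"]) (use E in auto)
    have wG: "w * G \<in> PR V" "homog E (w * G)" using w 0(5) homog_mult[OF w(2) 0(6)] E by (auto intro: PR_mult)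
    have "2 + (\<Sum>m\<in>{E+1..(sigma es + E - 1) div 2}. \<psi> m) + (\<Sum>m\<in>{E+1..(sigma es + E) div 2}. \<psi> m)
      \<le> int (HF_sum V (colon V ?J (w * G)) (sigma es - E))"
      by (rule colon_dimension_bound[OF ctx wG w(3) E(2) 0(2)]) (use 0(8) in simp)
    also have "HF_sum V (colon V ?J (w * G)) (sigma es - E) \<le> HF_sum V (colon V ?J G) (sigma es - E)"
      using w(1) by (intro HF_sum_mono V) (auto simp: colon_def mult.left_commute[of _ w] intro: is_idealD(4)[OF artinian_is_ideal])
    also have "\<dots> \<le> ?N" by (rule HF_sum_mono2) simp
    finally show ?thesis by simp
  qed
  show ?case
    using N1 N2 N3 Jmax HF_sum_mono2[of "sigma es" _ V "colon V ?J G"] by (intro exI[of _ ?N] exI[of _ "sigma es"]) auto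
next
  case (Suc t)
  let ?I = "idl V gs"
  note prem = Suc.prems
  have hI: "hideal V ?I" by (rule hideal_idl[OF prem(1)])
  have ii: "is_ideal V ?I" using hI by simp
  obtain l where l: "l \<in> PR V" "homog 1 l" "growth_le V (iadd V ?I l) t"
    by (rule generic_linear[OF V inf, of "{(?I, t)}"]) (use hI prem(3) in auto)
  have nl: "colon V ?I l = ?I" using idl_nzd[OF V inf prem(1) _ l(1,2) _ l(3)] prem(4) by simp
  obtain G' D' where G': "D' \<le> D" "G' \<in> PR V" "homog D' G'" "G' \<notin> iadd V ?I l" "colon V ?I G' = colon V ?I G"
    by (rule divide_out_linear[OF hI l(1,2) nl prem(5-7)])
  have es1: "1 \<le> e" if "e \<in> set es" for e
    using prem(1) that unfolding homog_gens_def by (auto simp: list_all2_conv_all_nth in_set_conv_nth)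
  \<comment> \<open>The linear form enters as a generator of degree 1: it changes neither
    \<open>sigma\<close> nor the product of the degrees, and it keeps the list sorted.\<close>
  have IHa: "\<exists>N c. 1 \<le> N \<and> N \<le> prod_list (1 # es) \<and> (\<forall>j. N * ((j + t) choose t) \<le> HF_sum V (colon V (idl V (l # gs)) G') (j + c))
    \<and> (\<forall>j. HF_sum V (idl V (l # gs)) j \<le> prod_list (1 # es) * ((j + t) choose t))
    \<and> (\<forall>E. D' \<le> E \<longrightarrow> E < sigma (1 # es) \<longrightarrow>
        2 + (\<Sum>m\<in>{E+1..(sigma (1 # es) + E - 1) div 2}. \<psi> m) + (\<Sum>m\<in>{E+1..(sigma (1 # es) + E) div 2}. \<psi> m) \<le> int N)"
  proof (rule Suc.IH[OF _ _ _ _ G'(2,3)])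
    show "homog_gens V (l # gs) (1 # es)" using l prem(1) by simp
    show "sorted (1 # es)" using prem(2) es1 by simp
    show "growth_le V (idl V (l # gs)) t" "G' \<notin> idl V (l # gs)" unfolding idl_Cons by (fact l(3), fact G'(4))
    show "length (l # gs) + t = card V" using prem(4) by simp
    \<comment> \<open>\<open>replicate t 1 @ 1 # es\<close> equals
      \<open>replicate (Suc t) 1 @ es\<close>, so the hypothesis on \<open>\<psi>\<close> is the
      same before and after the section.\<close>
    fix E k assume "k \<le> card V" "sigma (take k (replicate t 1 @ 1 # es)) \<le> E" "E < sigma (1 # es)"
    then show "\<psi> (Suc E) \<le> int (card V - k)"
      using prem(8)[of k E] by (simp add: sigma_Cons replicate_app_Cons_same)
  qed
  then obtain N c where N: "1 \<le> N" "N \<le> prod_list es"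
      "\<And>j. N * ((j + t) choose t) \<le> HF_sum V (colon V (iadd V ?I l) G') (j + c)"
      "\<And>j. HF_sum V (iadd V ?I l) j \<le> prod_list es * ((j + t) choose t)"
      "\<And>E. D' \<le> E \<Longrightarrow> E < sigma es \<Longrightarrow>
        2 + (\<Sum>m\<in>{E+1..(sigma es + E - 1) div 2}. \<psi> m) + (\<Sum>m\<in>{E+1..(sigma es + E) div 2}. \<psi> m) \<le> int N"
    unfolding idl_Cons sigma_Cons by auto
  let ?K = "colon V ?I G"
  have hK: "hideal V ?K" by (rule hideal_colon[OF hI prem(6)])
  have nK: "colon V ?K l = ?K" using colon_mult_nzd(2)[OF ii l(1) G'(2) nl] unfolding G'(5) .
  have low: "HF_sum V (colon V (iadd V ?I l) G') j \<le> HF V ?K j" for j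
    unfolding HF_eq_CH_linear[OF V hK l(1,2) nK]
    using iadd_colon_subset[OF ii l(1) G'(2)] unfolding G'(5) by (rule HF_sum_mono[OF V])
  \<comment> \<open>Summing the bound for the section over the degrees up to \<open>j\<close> raises
    the lower index of the binomial by one.\<close>
  have "N * ((j + Suc t) choose Suc t) \<le> HF_sum V ?K (j + c)" for j
  proof -
    have "N * ((j + Suc t) choose Suc t) = (\<Sum>i\<le>j. N * ((i + t) choose t))"
      unfolding sum_choose_shift[symmetric] by (simp add: sum_distrib_left)
    also have "\<dots> \<le> (\<Sum>i\<le>j. HF V ?K (i + c))" by (intro sum_mono order.trans[OF N(3) low])
    also have "\<dots> = (\<Sum>i\<in>(\<lambda>i. i + c) ` {..j}. HF V ?K i)" by (subst sum.reindex) (auto simp: inj_on_def)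
    also have "\<dots> \<le> HF_sum V ?K (j + c)" unfolding HF_sum_def by (intro sum_mono2) auto
    finally show ?thesis .
  qed
  moreover have "HF_sum V ?I j \<le> prod_list es * ((j + Suc t) choose Suc t)" for j
  proof -
    have "HF_sum V ?I j = (\<Sum>i\<le>j. HF_sum V (iadd V ?I l) i)"
      unfolding HF_sum_def[of V ?I] using HF_eq_CH_linear[OF V hI l(1,2) nl] by simp
    also have "\<dots> \<le> (\<Sum>i\<le>j. prod_list es * ((i + t) choose t))" by (intro sum_mono N(4))
    finally show ?thesis unfolding sum_choose_shift[symmetric] by (simp add: sum_distrib_left)
  qed
  ultimately show ?case using N(1,2,5) G'(1) by (intro exI[of _ N] exI[of _ c]) auto
qed

subsection \<open>Extension of the base field\<close>

text \<open>The constants inside the field of rational functions in one variable, which is infinite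
  whatever the base field is.\<close>

definition emb :: "'k::field \<Rightarrow> 'k poly fract" where "emb a = Fract [:a:] 1"

lemma emb_simps: "emb 0 = 0" "emb 1 = 1" "emb (a + b) = emb a + emb b" "emb (a * b) = emb a * emb b"
proof -
  show "emb 0 = 0" "emb 1 = 1" by (simp_all add: emb_def Zero_fract_def One_fract_def one_pCons)
  show "emb (a + b) = emb a + emb b" "emb (a * b) = emb a * emb b" by (simp_all add: emb_def mult.commute)
qed

lemma infinite_fract: "infinite (UNIV :: 'k::field poly fract set)"
proof -
  have "inj (\<lambda>n. Fract (monom (1::'k) n) 1)"
    by (rule injI) (simp add: eq_fract monom_eq_iff')
  then show ?thesis using infinite_UNIV_nat by (metis finite_imageD finite_subset subset_UNIV)
qed

definition epoly :: "'k::field mpoly \<Rightarrow> 'k poly fract mpoly" where "epoly p = Poly_Mapping.map emb p"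

lemma lookup_epoly: "Poly_Mapping.lookup (epoly p) m = emb (Poly_Mapping.lookup p m)"
  unfolding epoly_def by (simp add: Poly_Mapping.map.rep_eq when_def emb_simps)

lemma emb_eq_0_iff: "emb a = 0 \<longleftrightarrow> a = 0"
proof
  assume "emb a = 0"
  then show "a = 0" by (simp add: emb_def Zero_fract_def eq_fract)
qed (simp add: emb_simps)

lemma keys_epoly: "Poly_Mapping.keys (epoly p) = Poly_Mapping.keys p"
  by (auto simp: in_keys_iff lookup_epoly emb_eq_0_iff)

lemma epoly_PR: "p \<in> PR V \<Longrightarrow> epoly p \<in> PR V" by (simp add: PR_def keys_epoly)
lemma epoly_homog: "homog d p \<Longrightarrow> homog d (epoly p)" by (simp add: homog_def keys_epoly)

text \<open>Functionals on \<open>k(x)\<close> over \<open>k\<close> turn a linear relation over \<open>k(x)\<close> into one over \<open>k\<close>.\<close>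
lemma emb_linear_functional:
  fixes z :: "'k::field poly fract"
  assumes "z \<noteq> 0"
  obtains f :: "'k poly fract \<Rightarrow> 'k" where "f z = 1" "\<And>x y. f (x + y) = f x + f y" "\<And>a x. f (emb a * x) = a * f x"
proof -
  let ?s = "\<lambda>a (x :: 'k poly fract). emb a * x"
  interpret e: vector_space ?s by unfold_locales (simp_all add: emb_simps algebra_simps)
  interpret vp: vector_space_pair ?s "(*) :: 'k \<Rightarrow> 'k \<Rightarrow> 'k" by unfold_locales (auto simp: algebra_simps)
  have "e.independent {z}" using assms by (simp add: e.dependent_single)
  then obtain f where f: "Vector_Spaces.linear ?s (*) f" "\<forall>x\<in>{z}. f x = 1"
    using vp.linear_independent_extend[of "{z}" "\<lambda>_. 1"] by blast
  interpret f: Vector_Spaces.linear ?s "(*)" f by (rule f(1))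
  show thesis by (rule that[of f]) (use f(2) f.add f.scale in auto)
qed

lemma independent_epoly:
  assumes B: "finite B" "pm.independent B"
  shows "pm.independent (epoly ` B)" "inj_on epoly B"
proof -
  show inj: "inj_on epoly B"
  proof (rule inj_onI)
    fix p q assume e: "epoly p = epoly q"
    have "Poly_Mapping.lookup p m = Poly_Mapping.lookup q m" for m
    proof -
      have "emb (Poly_Mapping.lookup p m) = emb (Poly_Mapping.lookup q m)" using e by (metis lookup_epoly)
      then show ?thesis by (simp add: emb_def eq_fract)
    qed
    then show "p = q" by (rule poly_mapping_eqI)
  qed
  show "pm.independent (epoly ` B)"
  proof
    assume "pm.dependent (epoly ` B)"
    then obtain u where u: "\<exists>v\<in>epoly ` B. u v \<noteq> 0" "(\<Sum>v\<in>epoly ` B. pscale (u v) v) = 0"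
      using pm.dependent_finite[of "epoly ` B"] B(1) by auto
    then obtain b0 where b0: "b0 \<in> B" "u (epoly b0) \<noteq> 0" by blast
    obtain f where f: "f (u (epoly b0)) = 1" "\<And>x y. f (x + y) = f x + f y" "\<And>a x. f (emb a * x) = a * f x"
      using emb_linear_functional[OF b0(2)] by blast
    have f0: "f 0 = 0" using f(3)[of 0 0] by (simp add: emb_simps)
    have fsum: "f (sum g A) = (\<Sum>x\<in>A. f (g x))" if "finite A" for g and A :: "'a mpoly set"
      using that by (induction A rule: finite_induct) (auto simp: f0 f(2))
    have "(\<Sum>b\<in>B. pscale (f (u (epoly b))) b) = 0"
    proof (rule poly_mapping_eqI)
      fix m
      have "(\<Sum>b\<in>B. pscale (u (epoly b)) (epoly b)) = 0" using u(2) by (simp add: sum.reindex[OF inj])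
      then have "Poly_Mapping.lookup (\<Sum>b\<in>B. pscale (u (epoly b)) (epoly b)) m = 0" by simp
      then have "(\<Sum>b\<in>B. emb (Poly_Mapping.lookup b m) * u (epoly b)) = 0"
        by (simp add: lookup_sum lookup_pscale lookup_epoly mult.commute)
      then have "f (\<Sum>b\<in>B. emb (Poly_Mapping.lookup b m) * u (epoly b)) = 0" using f0 by simp
      then have "(\<Sum>b\<in>B. Poly_Mapping.lookup b m * f (u (epoly b))) = 0" by (simp add: fsum[OF B(1)] f(3))
      then show "Poly_Mapping.lookup (\<Sum>b\<in>B. pscale (f (u (epoly b))) b) m = Poly_Mapping.lookup 0 m"
        by (simp add: lookup_sum lookup_pscale mult.commute)
    qed
    moreover have "\<exists>b\<in>B. f (u (epoly b)) \<noteq> 0" using b0(1) f(1) by (intro bexI[of _ b0]) auto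
    ultimately have "pm.dependent B" unfolding pm.dependent_finite[OF B(1)]
      by (intro exI[of _ "\<lambda>b. f (u (epoly b))"]) (rule conjI)
    then show False using B(2) by simp
  qed
qed

lemma epoly_add: "epoly (p + q) = epoly p + epoly q"
  by (rule poly_mapping_eqI) (simp add: lookup_epoly lookup_add emb_simps)
lemma epoly_0: "epoly 0 = 0"
  by (rule poly_mapping_eqI) (simp add: lookup_epoly emb_simps)
lemma epoly_pscale: "epoly (pscale c p) = pscale (emb c) (epoly p)"
  by (rule poly_mapping_eqI) (simp add: lookup_epoly lookup_pscale emb_simps)
lemma epoly_monomial_mult: "epoly (Poly_Mapping.single m 1 * p) = Poly_Mapping.single m 1 * epoly p"
proof (rule poly_mapping_eqI)
  fix k
  show "Poly_Mapping.lookup (epoly (Poly_Mapping.single m 1 * p)) k = Poly_Mapping.lookup (Poly_Mapping.single m 1 * epoly p) k"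
  proof (cases "\<exists>l. k = m + l")
    case True
    then show ?thesis by (auto simp: lookup_epoly lookup_single_mult)
  next
    case False
    then have "k \<notin> Poly_Mapping.keys (Poly_Mapping.single m 1 * p)" "k \<notin> Poly_Mapping.keys (Poly_Mapping.single m 1 * epoly p)"
      using keys_single_mult by fast+
    then show ?thesis by (simp add: lookup_epoly in_keys_iff emb_simps)
  qed
qed

lemma dim_span_epoly:
  assumes B: "finite (B :: 'k::field mpoly set)"
  shows "pm.dim (pm.span (epoly ` B)) = pm.dim (pm.span B)"
proof -
  obtain C where C: "C \<subseteq> B" "pm.independent C" "B \<subseteq> pm.span C" using pm.maximal_independent_subset[of B] by blast
  have fC: "finite C" using C(1) B finite_subset by blast
  have "pm.span B = pm.span C" using C by (meson pm.span_eq pm.span_superset subset_trans)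
  then have 1: "pm.dim (pm.span B) = card C" using pm.dim_span_eq_card_independent[OF C(2)] by simp
  let ?S = "{p. epoly p \<in> pm.span (epoly ` C)}"
  have "pm.subspace ?S" unfolding pm.subspace_def
    by (auto simp: epoly_0 epoly_add epoly_pscale intro: pm.span_zero pm.span_add pm.span_scale)
  then have "pm.span C \<subseteq> ?S" by (intro pm.span_minimal) (auto intro: pm.span_base)
  then have "epoly ` B \<subseteq> pm.span (epoly ` C)" using C(3) by blast
  then have "pm.span (epoly ` B) = pm.span (epoly ` C)"
    using pm.span_mono[of "epoly ` C" "epoly ` B"] C(1)
    by (intro equalityI pm.span_minimal[OF _ pm.subspace_span]) auto
  then have "pm.dim (pm.span (epoly ` B)) = card (epoly ` C)"
    using pm.dim_span_eq_card_independent[OF independent_epoly(1)[OF fC C(2)]] by simp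
  then show ?thesis using 1 card_image[OF independent_epoly(2)[OF fC C(2)]] by simp
qed

text \<open>Monomial multiples of the generators, spanning the degree \<open>j\<close> piece of the
  ideal. As monomials have coefficient 1, \<open>epoly\<close> carries this set to the corresponding
  one over the extension.\<close>

fun mspan :: "nat set \<Rightarrow> 'k::field mpoly list \<Rightarrow> nat list \<Rightarrow> nat \<Rightarrow> 'k mpoly set" where
  "mspan V (g # gs) (e # es) j = mspan V gs es j \<union> (if e \<le> j then (\<lambda>m. Poly_Mapping.single m 1 * g) ` mons V (j - e) else {})"
| "mspan V _ _ j = {}"

lemma idl_graded_piece:
  assumes "list_all2 (\<lambda>g e. g \<in> PR V \<and> homog e g) gs es"
  shows "hideal V (idl V gs) \<and> idl V gs \<inter> graded_piece V j = pm.span (mspan V gs es j)"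
  using assms
proof (induction gs es rule: list_all2_induct)
  case Nil
  then show ?case by (auto simp: ideal_gen_empty hideal_zero graded_piece_iff)
next
  case (Cons g gs e es)
  let ?I = "idl V gs"
  have g: "g \<in> PR V" "homog e g" and hI: "hideal V ?I" and IH: "?I \<inter> graded_piece V j = pm.span (mspan V gs es j)"
    using Cons by auto
  have ii: "is_ideal V ?I" using hI by simp
  have hA: "hideal V (iadd V ?I g)" by (rule hideal_iadd[OF hI g])
  interpret mg: Vector_Spaces.linear pscale pscale "\<lambda>p. p * g"
    using linear_mult[of g] by (simp add: mult.commute)
  have "iadd V ?I g \<inter> graded_piece V j = pm.span (mspan V (g # gs) (e # es) j)" (is "?L = ?R")
  proof
    show "?L \<subseteq> ?R"
    proof
      fix y assume y: "y \<in> ?L"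
      then obtain p r where pr: "y = p + r * g" "p \<in> ?I" "r \<in> PR V" by (auto elim!: iaddE)
      have "y = hcomp j y" using y hcomp_homog[of j y] by (simp add: graded_piece_iff)
      then have y': "y = hcomp j p + (if e \<le> j then hcomp (j - e) r * g else 0)"
        unfolding pr(1) hcomp_add hcomp_mult_left[OF g(2)] by simp
      have "hcomp j p \<in> ?I \<inter> graded_piece V j"
        using hideal_hcomp[OF hI pr(2)] is_idealD(1)[OF ii] by (auto simp: graded_piece_iff)
      then have 1: "hcomp j p \<in> ?R" unfolding IH using pm.span_mono[of "mspan V gs es j" "mspan V (g # gs) (e # es) j"] by auto
      have 2: "hcomp (j - e) r * g \<in> ?R" if "e \<le> j"
      proof -
        have "hcomp (j - e) r \<in> pm.span ((\<lambda>m. Poly_Mapping.single m 1) ` mons V (j - e))"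
          using PR_hcomp[OF pr(3)] by (simp add: graded_piece_iff flip: graded_piece_span)
        then have "hcomp (j - e) r * g \<in> pm.span ((\<lambda>p. p * g) ` ((\<lambda>m. Poly_Mapping.single m 1) ` mons V (j - e)))"
          unfolding mg.span_image by blast
        then show ?thesis using that
          using pm.span_mono[of "(\<lambda>p. p * g) ` (\<lambda>m. Poly_Mapping.single m 1) ` mons V (j - e)" "mspan V (g # gs) (e # es) j"]
          by (auto simp: image_image)
      qed
      show "y \<in> ?R" using 1 2 y' pm.span_add by (cases "e \<le> j") auto
    qed
    have "mspan V gs es j \<subseteq> ?L" using IH iadd_superset pm.span_superset by fast
    moreover have "Poly_Mapping.single m 1 * g \<in> ?L" if "m \<in> mons V (j - e)" "e \<le> j" for m
    proof -
      have m: "Poly_Mapping.single m 1 \<in> PR V" "homog (j - e) (Poly_Mapping.single m (1::'a))"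
        using that by (auto simp: mons_def intro: PR_single homog_single)
      show ?thesis using homog_mult[OF m(2) g(2)] that(2) m(1) g(1) iadd_mem[OF ii]
        by (auto simp: graded_piece_iff intro: PR_mult is_idealD(4)[OF hideal_ideal[OF hA]])
    qed
    ultimately have "mspan V (g # gs) (e # es) j \<subseteq> ?L" by auto
    then show "?R \<subseteq> ?L"
      by (intro pm.span_minimal pm.subspace_inter subspace_graded_piece subspace_ideal[OF hideal_ideal[OF hA]])
  qed
  then show ?case using hA by (simp add: idl_Cons del: mspan.simps flip: insert_is_Un) (simp add: ideal_gen_insert hA)
qed

lemma finite_mspan: "finite V \<Longrightarrow> finite (mspan V gs es j)"
  by (induction V gs es j rule: mspan.induct) (auto intro: finite_mons)

lemma mspan_epoly: "mspan V (map epoly gs) es j = epoly ` mspan V gs es j"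
  by (induction V gs es j rule: mspan.induct) (auto simp: image_Un image_image epoly_monomial_mult)

lemma HF_epoly:
  fixes gs :: "'k::field mpoly list"
  assumes V: "finite V" and gs: "list_all2 (\<lambda>g e. g \<in> PR V \<and> homog e g) gs es"
  shows "HF V (idl V (map epoly gs)) j = HF V (idl V gs) j"
proof -
  have gs': "list_all2 (\<lambda>g e. g \<in> PR V \<and> homog e g) (map epoly gs) es"
    using gs by (auto simp: list_all2_conv_all_nth epoly_PR epoly_homog)
  have "kdim (idl V (map epoly gs) \<inter> graded_piece V j) = kdim (idl V gs \<inter> graded_piece V j)"
    unfolding kdim_def conjunct2[OF idl_graded_piece[OF gs]] conjunct2[OF idl_graded_piece[OF gs']] mspan_epoly
    by (rule dim_span_epoly[OF finite_mspan[OF V]])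
  moreover have "kdim (graded_piece V j :: 'k mpoly set) = kdim (graded_piece V j :: 'k poly fract mpoly set)"
    by (simp add: kdim_graded_piece[OF V])
  ultimately show ?thesis unfolding HF_def by simp
qed

text \<open>No generators of \<open>I : G\<close> are at hand, so its Hilbert function is compared
  across the extension through \<open>HF_sum_split\<close>, that is, through \<open>I\<close> and
  \<open>I + (G)\<close>, whose generators are defined over the base field.\<close>

lemma colon_growth:
  fixes gs :: "'k::field mpoly list" and \<psi> :: "nat \<Rightarrow> int"
  assumes V: "finite V"
    and gs: "homog_gens V gs es" and srt: "sorted es" and g: "growth_le V (idl V gs) t" and len: "length gs + t = card V"
    and G: "G \<in> PR V" "homog D G" "G \<notin> idl V gs"
    and \<psi>: "\<And>E k. k \<le> card V \<Longrightarrow> sigma (take k (replicate t 1 @ es)) \<le> E \<Longrightarrow> E < sigma es \<Longrightarrow> \<psi> (Suc E) \<le> int (card V - k)"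
  shows "\<exists>N c. 1 \<le> N \<and> N \<le> prod_list es \<and> (\<forall>j. N * ((j + t) choose t) \<le> HF_sum V (colon V (idl V gs) G) (j + c))
    \<and> (\<forall>j. HF_sum V (idl V gs) j \<le> prod_list es * ((j + t) choose t))
    \<and> (\<forall>E. D \<le> E \<longrightarrow> E < sigma es \<longrightarrow>
        2 + (\<Sum>m\<in>{E+1..(sigma es + E - 1) div 2}. \<psi> m) + (\<Sum>m\<in>{E+1..(sigma es + E) div 2}. \<psi> m) \<le> int N)"
proof -
  let ?I = "idl V gs" and ?I' = "idl V (map epoly gs)" and ?G = "epoly G"
  have hI: "hideal V ?I" by (rule hideal_idl[OF gs])
  have la: "list_all2 (\<lambda>g e. g \<in> PR V \<and> homog e g) gs es"
    using gs unfolding homog_gens_def by (rule list_all2_mono) auto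
  have laG: "list_all2 (\<lambda>g e. g \<in> PR V \<and> homog e g) (G # gs) (D # es)" using la G by simp
  have gs': "homog_gens V (map epoly gs) es"
    using gs by (auto simp: homog_gens_def list_all2_conv_all_nth epoly_PR epoly_homog)
  have hI': "hideal V ?I'" by (rule hideal_idl[OF gs'])
  have HI: "HF V ?I' j = HF V ?I j" for j by (rule HF_epoly[OF V la])
  have HIG: "HF V (iadd V ?I' ?G) j = HF V (iadd V ?I G) j" for j
    using HF_epoly[OF V laG, of j] by (simp only: list.map idl_Cons)
  have CI: "HF_sum V ?I' = HF_sum V ?I" "HF_sum V (iadd V ?I' ?G) = HF_sum V (iadd V ?I G)"
    unfolding HF_sum_def fun_eq_iff HI HIG by blast+
  have G': "?G \<in> PR V" "homog D ?G" using G epoly_PR epoly_homog by blast+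
  have Cc: "HF_sum V (colon V ?I' ?G) = HF_sum V (colon V ?I G)"
  proof
    fix j show "HF_sum V (colon V ?I' ?G) j = HF_sum V (colon V ?I G) j"
      using HF_sum_split(1)[OF V hI' G', of j] HF_sum_split(1)[OF V hI G(1,2), of j] CI by simp
  qed
  \<comment> \<open>\<open>G\<close> stays outside the extended ideal because \<open>I\<close> and
    \<open>I + (G)\<close> already differ in their Hilbert functions at \<open>D\<close>, and these
    do not change under the extension.\<close>
  have "HF V (colon V ?I G) 0 \<noteq> 0"
    using HF_pos_of_notin[OF V hideal_ideal[OF hideal_colon[OF hI G(2)]] PR_1 homog_1] G(1,3) by (simp add: colon_def)
  then have "HF V (iadd V ?I G) D \<noteq> HF V ?I D" using HF_split[OF V hI G(1,2), of 0] by simp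
  then have "iadd V ?I' ?G \<noteq> ?I'" using HI[of D] HIG[of D] by auto
  then have nG: "?G \<notin> ?I'" using iadd_absorb[OF hideal_ideal[OF hI']] by blast
  have g': "growth_le V ?I' t" using g unfolding growth_le_def CI .
  show ?thesis
    using colon_growth_infinite_field[OF V infinite_fract gs' srt g' _ G' nG, of \<psi>] len \<psi> unfolding CI Cc by simp
qed

subsection \<open>The lex-largest monomial\<close>

text \<open>The linear order on exponent vectors compares at the first index where they differ, so
  the lexicographically largest monomial is a \<open>Max\<close>.\<close>

lemma lex_gt_iff: "lex_gt m m' \<longleftrightarrow> m' < m"
  unfolding lex_gt_def less_poly_mapping.rep_eq less_fun_def by (auto simp: eq_commute)

lemma homog_gens_nth: "homog_gens V gs es \<Longrightarrow> i < length gs \<Longrightarrow> gs ! i \<in> PR V \<and> homog (es ! i) (gs ! i) \<and> 1 \<le> es ! i"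
  unfolding homog_gens_def by (auto dest: list_all2_nthD)

lemma sigma_take: "k \<le> length ds \<Longrightarrow> sigma (take k ds) = (\<Sum>i<k. ds ! i - 1)"
  unfolding sigma_def by (simp add: sum_list_sum_nth atLeast0LessThan)

text \<open>Exponents of the monomials of degree \<open>E\<close> outside
  \<open>xd_ideal ds\<close>, described without reference to the field.\<close>

definition reduced :: "nat list \<Rightarrow> nat \<Rightarrow> (nat \<Rightarrow>\<^sub>0 nat) set" where
  "reduced ds E = {m. Poly_Mapping.keys m \<subseteq> {0..<length ds} \<and> mdeg m = E \<and> (\<forall>i<length ds. Poly_Mapping.lookup m i < ds ! i)}"

lemma monomial_mem_xd_ideal:
  assumes k: "Poly_Mapping.keys m \<subseteq> {0..<length ds}"
  shows "Poly_Mapping.single m (1::'k::field) \<in> xd_ideal ds \<longleftrightarrow> (\<exists>i<length ds. ds ! i \<le> Poly_Mapping.lookup m i)"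
proof
  let ?V = "{0..<length ds}"
  let ?A = "{p :: 'k mpoly. p \<in> PR ?V \<and> (\<forall>m\<in>Poly_Mapping.keys p. \<exists>i<length ds. ds ! i \<le> Poly_Mapping.lookup m i)}"
  have "xd_ideal ds \<subseteq> ?A"
  proof
    fix p :: "'k mpoly" assume "p \<in> xd_ideal ds"
    then obtain F c where F: "p = (\<Sum>a\<in>F. c a * a)" "F \<subseteq> (\<lambda>i. xpow i (ds ! i)) ` ?V" "\<forall>a\<in>F. c a \<in> PR ?V"
      unfolding xd_ideal_def ideal_gen_def by blast
    have cA: "c a * a \<in> ?A" if aF: "a \<in> F" for a
    proof -
      obtain i where i: "i < length ds" "a = xpow i (ds ! i)" using F(2) aF by auto
      have "\<exists>i<length ds. ds ! i \<le> Poly_Mapping.lookup m i" if "m \<in> Poly_Mapping.keys (c a * a)" for m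
      proof -
        have "m \<in> (+) (Poly_Mapping.single i (ds ! i)) ` Poly_Mapping.keys (c a)"
          using that keys_single_mult[of "Poly_Mapping.single i (ds ! i)" 1 "c a"] unfolding i(2) xpow_def by (subst (asm) mult.commute) blast
        then show ?thesis using i(1) by (auto simp: lookup_add)
      qed
      then show ?thesis using F(3) aF i xpow_PR[of i ?V] by (auto intro: PR_mult)
    qed
    have sA: "sum f F' \<in> ?A" if "\<And>x. x \<in> F' \<Longrightarrow> f x \<in> ?A" for f :: "'k mpoly \<Rightarrow> 'k mpoly" and F'
      using that
    proof (induction F' rule: infinite_finite_induct)
      case (insert x F')
      have a: "f x \<in> ?A" "sum f F' \<in> ?A" using insert by auto
      then have "f x + sum f F' \<in> PR ?V" by (intro PR_add) auto
      moreover have "\<exists>i<length ds. ds ! i \<le> Poly_Mapping.lookup m i" if "m \<in> Poly_Mapping.keys (f x + sum f F')" for m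
        using subsetD[OF keys_add that] a by auto
      ultimately show ?case using insert.hyps by simp
    qed auto
    show "p \<in> ?A" unfolding F(1) by (rule sA) (rule cA)
  qed
  then show "Poly_Mapping.single m (1::'k) \<in> xd_ideal ds \<Longrightarrow> \<exists>i<length ds. ds ! i \<le> Poly_Mapping.lookup m i" by fastforce
next
  let ?V = "{0..<length ds}"
  assume "\<exists>i<length ds. ds ! i \<le> Poly_Mapping.lookup m i"
  then obtain i where i: "i < length ds" "ds ! i \<le> Poly_Mapping.lookup m i" by blast
  let ?r = "m - Poly_Mapping.single i (ds ! i)"
  have "m = ?r + Poly_Mapping.single i (ds ! i)"
    using i by (intro poly_mapping_eqI) (auto simp: lookup_add lookup_minus lookup_single when_def)
  then have e: "Poly_Mapping.single m (1::'k) = Poly_Mapping.single ?r 1 * xpow i (ds ! i)"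
    unfolding xpow_def mult_single by simp
  have "Poly_Mapping.keys ?r \<subseteq> Poly_Mapping.keys m" by (auto simp: in_keys_iff lookup_minus)
  then have "Poly_Mapping.single ?r (1::'k) \<in> PR ?V" using k by (intro PR_single) auto
  then show "Poly_Mapping.single m (1::'k) \<in> xd_ideal ds"
    unfolding xd_ideal_def ideal_gen_def e using i(1)
    by (intro CollectI exI[of _ "{xpow i (ds ! i)}"] exI[of _ "\<lambda>_. Poly_Mapping.single ?r 1"]) auto
qed

lemma reduced_iff: 
  "m \<in> reduced ds E \<longleftrightarrow> Poly_Mapping.keys m \<subseteq> {0..<length ds} \<and> mdeg m = E \<and> Poly_Mapping.single m (1::'k::field) \<notin> xd_ideal ds"
proof -
  have "(\<exists>i<length ds. ds ! i \<le> Poly_Mapping.lookup m i) \<longleftrightarrow> \<not> (\<forall>i<length ds. Poly_Mapping.lookup m i < ds ! i)"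
    by (simp add: not_less)
  then show ?thesis using monomial_mem_xd_ideal[of m ds, where 'k = 'k] unfolding reduced_def by blast
qed

lemma finite_reduced: "finite (reduced ds E)"
  by (rule finite_subset[OF _ finite_mons[of "{0..<length ds}" E]]) (auto simp: reduced_def mons_def)

lemma U_mon_eq_Max:
  assumes "reduced ds E \<noteq> {}"
  shows "U_mon TYPE('k::field) ds E = Max (reduced ds E)"
proof -
  note fin = finite_reduced[of ds E]
  have M: "Max (reduced ds E) \<in> reduced ds E" using Max_in[OF fin assms] .
  show ?thesis unfolding U_mon_def
  proof (rule the_equality)
    show "Poly_Mapping.keys (Max (reduced ds E)) \<subseteq> {0..<length ds} \<and> mdeg (Max (reduced ds E)) = E
       \<and> Poly_Mapping.single (Max (reduced ds E)) (1::'k) \<notin> xd_ideal ds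
       \<and> (\<forall>m'. Poly_Mapping.keys m' \<subseteq> {0..<length ds} \<and> mdeg m' = E
              \<and> Poly_Mapping.single m' (1::'k) \<notin> xd_ideal ds \<and> m' \<noteq> Max (reduced ds E) \<longrightarrow> lex_gt (Max (reduced ds E)) m')"
      using M reduced_iff[where 'k='k] Max_ge[OF fin] unfolding lex_gt_iff by (metis order_le_less)
    fix m assume m: "Poly_Mapping.keys m \<subseteq> {0..<length ds} \<and> mdeg m = E \<and> Poly_Mapping.single m (1::'k) \<notin> xd_ideal ds
      \<and> (\<forall>m'. Poly_Mapping.keys m' \<subseteq> {0..<length ds} \<and> mdeg m' = E
              \<and> Poly_Mapping.single m' (1::'k) \<notin> xd_ideal ds \<and> m' \<noteq> m \<longrightarrow> lex_gt m m')"
    then have "m \<in> reduced ds E" using reduced_iff[where 'k='k] by blast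
    then have "m \<le> Max (reduced ds E)" using Max_ge[OF fin] by blast
    moreover have "Max (reduced ds E) = m \<or> Max (reduced ds E) < m"
      using m M reduced_iff[where 'k='k] unfolding lex_gt_iff by blast
    ultimately show "m = Max (reduced ds E)" by auto
  qed
qed

text \<open>The exponents are filled from the left, each up to \<open>ds ! i - 1\<close>, until the
  degree is used up; \<open>E \<le> sigma ds\<close> ensures that there is room for all of
  it.\<close>

lemma greedy_reduced:
  assumes E: "E \<le> sigma ds" and pos: "\<And>i. i < length ds \<Longrightarrow> 1 \<le> ds ! i"
    and k: "k \<le> length ds" "sigma (take k ds) \<le> E"
  obtains m where "m \<in> reduced ds E" "\<And>i. i < k \<Longrightarrow> Poly_Mapping.lookup m i = ds ! i - 1"
proof -
  let ?h = "length ds"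
  let ?b = "\<lambda>i. ds ! i - 1"
  \<comment> \<open>Truncated subtraction yields exponent 0 once the degree is exhausted.\<close>
  define f where "f i = (if i < ?h then min (?b i) (E - (\<Sum>j<i. ?b j)) else 0)" for i
  have "{i. f i \<noteq> 0} \<subseteq> {..<?h}" by (auto simp: f_def split: if_splits)
  then have ff: "finite {i. f i \<noteq> 0}" using finite_subset by blast
  define m where "m = Abs_poly_mapping f"
  have lm: "Poly_Mapping.lookup m = f" unfolding m_def by (rule lookup_Abs_poly_mapping) (use ff in simp)
  have km: "Poly_Mapping.keys m \<subseteq> {0..<?h}" by (auto simp: in_keys_iff lm f_def split: if_splits)
  have s: "(\<Sum>i<n. f i) = min E (\<Sum>i<n. ?b i)" if "n \<le> ?h" for n
    using that by (induction n) (auto simp: f_def)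
  have "mdeg m = (\<Sum>i<?h. f i)" using mdeg_eq_sum[OF _ km] by (simp add: lm atLeast0LessThan)
  also have "\<dots> = E" using s[of ?h] E sigma_take[of ?h ds] by simp
  finally have "mdeg m = E" .
  moreover have "f i < ds ! i" if "i < ?h" for i using that pos[of i] by (auto simp: f_def)
  ultimately have "m \<in> reduced ds E" using km by (auto simp: reduced_def lm)
  moreover have "Poly_Mapping.lookup m i = ?b i" if i: "i < k" for i
  proof -
    have "(\<Sum>j<i. ?b j) + ?b i = (\<Sum>j<Suc i. ?b j)" by simp
    also have "\<dots> \<le> (\<Sum>j<k. ?b j)" using i by (intro sum_mono2) auto
    also have "\<dots> \<le> E" using k sigma_take by simp
    finally show ?thesis using i k(1) by (simp add: lm f_def)
  qed
  ultimately show thesis by (rule that)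
qed

text \<open>By \<open>HF_split\<close>, in the range where \<open>phi\<close> is not set to 0, its
  value at \<open>Suc E\<close> counts the linear forms modulo those killing \<open>U\<close>. The
  greedy monomial is at most \<open>U\<close> in the order, so \<open>U\<close> too has maximal
  exponents in its first \<open>k\<close> places and is killed by these \<open>k\<close>
  variables.\<close>

lemma phi_le:
  assumes pos: "\<And>i. i < length ds \<Longrightarrow> 1 \<le> ds ! i" and k: "k \<le> length ds" "sigma (take k ds) \<le> E"
  shows "phi TYPE('k::field) ds (Suc E) \<le> int (length ds - k)"
proof (cases "2 \<le> Suc E \<and> Suc E \<le> sigma ds")
  case False
  then have "phi TYPE('k) ds (Suc E) = 0" unfolding phi_def by (rule if_not_P)
  then show ?thesis by simp
next
  case True
  let ?h = "length ds" and ?V = "{0..<length ds}"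
  let ?X = "xd_ideal ds :: 'k mpoly set"
  define U where "U = U_mon TYPE('k) ds E"
  let ?u = "Poly_Mapping.single U (1::'k)"
  obtain m where m: "m \<in> reduced ds E" "\<And>i. i < k \<Longrightarrow> Poly_Mapping.lookup m i = ds ! i - 1"
    by (rule greedy_reduced[OF _ pos k]) (use True in auto)
  note fin = finite_reduced[of ds E]
  have UM: "U = Max (reduced ds E)" unfolding U_def using U_mon_eq_Max m(1) by blast
  then have Ur: "U \<in> reduced ds E" using Max_in[OF fin] m(1) by auto
  have "m \<le> U" using UM Max_ge[OF fin m(1)] by simp
  then have Uk: "Poly_Mapping.lookup U i = ds ! i - 1" if i: "i < k" for i
  proof (cases "m = U")
    case True then show ?thesis using m(2) i by simp
  next
    case False
    then have "m < U" using \<open>m \<le> U\<close> by simp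
    then obtain q where q: "Poly_Mapping.lookup m q < Poly_Mapping.lookup U q" "\<And>j. j < q \<Longrightarrow> Poly_Mapping.lookup m j = Poly_Mapping.lookup U j"
      unfolding less_poly_mapping.rep_eq less_fun_def by blast
    have "\<not> q < k"
    proof
      assume "q < k"
      then have "Poly_Mapping.lookup U q \<ge> ds ! q" using m(2)[of q] q(1) by simp
      moreover have "Poly_Mapping.lookup U q < ds ! q" using Ur \<open>q < k\<close> k(1) by (simp add: reduced_def)
      ultimately show False by simp
    qed
    then show ?thesis using q(2)[of i] m(2)[OF i] i by simp
  qed
  have uP: "?u \<in> PR ?V" "homog E ?u" using Ur by (auto simp: reduced_def intro: PR_single homog_single)
  have hX: "hideal ?V ?X"
  proof -
    have "list_all2 (\<lambda>g e. g \<in> PR ?V \<and> homog e g) (map (\<lambda>i. xpow i (ds ! i) :: 'k mpoly) [0..<?h]) ds"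
      by (auto simp: list_all2_conv_all_nth intro: xpow_PR homog_xpow)
    then have "hideal ?V (idl ?V (map (\<lambda>i. xpow i (ds ! i) :: 'k mpoly) [0..<?h]))" using idl_graded_piece by blast
    then show ?thesis by (simp add: xd_ideal_def)
  qed
  have iX: "is_ideal ?V ?X" using hX by simp
  have L: "(L_ideal ds E :: 'k mpoly set) = iadd ?V ?X ?u"
    unfolding L_ideal_def U_def[symmetric] ideal_gen_insert xd_ideal_def ..
  let ?C = "colon ?V ?X ?u"
  have "HF ?V ?X (1 + E) = HF ?V (iadd ?V ?X ?u) (1 + E) + HF ?V ?C 1"
    by (rule HF_split[OF _ hX uP]) simp
  then have p: "phi TYPE('k) ds (Suc E) = int (HF ?V ?C 1)" using True by (simp add: phi_def L)
  let ?B = "(\<lambda>v. Poly_Mapping.single v (1::'k)) ` ((\<lambda>i. Poly_Mapping.single i (1::nat)) ` {..<k})"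
  have "?B \<subseteq> ?C \<inter> graded_piece ?V 1"
  proof
    fix b assume "b \<in> ?B"
    then obtain i where i: "i < k" "b = xpow i 1" by (auto simp: xpow_def)
    have iV: "i \<in> ?V" using i k by simp
    have "b * ?u = Poly_Mapping.single (Poly_Mapping.single i 1 + U) 1" unfolding i(2) xpow_def mult_single by simp
    moreover have "Poly_Mapping.single (Poly_Mapping.single i 1 + U) (1::'k) \<in> ?X"
      using Ur iV Uk[OF i(1)] pos[of i]
      by (subst monomial_mem_xd_ideal) (auto simp: keys_add_nat reduced_def lookup_add intro!: exI[of _ i])
    ultimately show "b \<in> ?C \<inter> graded_piece ?V 1"
      unfolding i(2) by (simp add: colon_def graded_piece_iff xpow_PR[OF iV] homog_xpow del: One_nat_def)
  qed
  then have "card ?B \<le> pm.dim (?C \<inter> graded_piece ?V 1)"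
    by (intro pm.fin_span_independent(2)[OF _ _ independent_monomials] pm.fin_span_mono[OF fin_span_graded_piece[of ?V 1]]) auto
  moreover have "card ?B = k"
  proof -
    have "inj_on (\<lambda>i. Poly_Mapping.single i (1::nat)) {..<k}"
      by (rule inj_onI) (metis keys_single singleton_inject zero_neq_one)
    then show ?thesis by (simp add: card_image inj_single1 del: One_nat_def)
  qed
  moreover have "HF ?V ?C 1 + kdim (?C \<inter> graded_piece ?V 1) = ?h"
    using HF_add[of ?V ?C 1] kdim_graded_piece[of ?V 1, where 'k='k] card_mons_1[of ?V] by simp
  ultimately show ?thesis unfolding p kdim_def by linarith
qed

subsection \<open>Chains of primes\<close>

text \<open>A homogeneous ideal maximal among those whose growth is not bounded by \<open>t\<close>
  is prime by \<open>growth_split\<close>. Adding a variable outside it lowers the growth by at most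
  one, and the chain continues from there. Thus the degree of the Hilbert polynomial bounds the
  Krull dimension from below.\<close>

lemma prime_chain_of_growth:
  fixes I :: "'k::field mpoly set"
  assumes V: "finite V" and I: "hideal V I" "I \<noteq> PR V" and g: "\<And>s. s < t \<Longrightarrow> \<not> growth_le V I s"
  shows "\<exists>c. (\<forall>i\<le>t. prime_ideal V (c i) \<and> I \<subseteq> c i) \<and> (\<forall>i<t. c i \<subset> c (Suc i))"
  using I g
proof (induction t arbitrary: I)
  case 0
  have ii: "is_ideal V I" using 0 by simp
  have "1 \<notin> I" using 0 ideal_eq_PR_iff[OF ii] by simp
  then obtain J where J: "hideal V J" "I \<subseteq> J" "1 \<notin> J" "\<And>K. hideal V K \<Longrightarrow> J \<subset> K \<Longrightarrow> \<not> 1 \<notin> K"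
    using hideal_maximal[where P = "\<lambda>J. 1 \<notin> J", OF V 0(1)] by blast
  have artinian_is_ideal: "is_ideal V J" using J by simp
  have "prime_ideal V J"
  proof (rule prime_ideal_of_homog[OF J(1)])
    show "J \<noteq> PR V" using J(3) by auto
    fix a b d e assume ab: "a \<in> PR V" "homog d a" "b \<in> PR V" "homog e b" "a * b \<in> J"
    show "a \<in> J \<or> b \<in> J"
    proof (rule ccontr)
      assume "\<not> (a \<in> J \<or> b \<in> J)"
      then have "J \<subset> iadd V J a" "J \<subset> iadd V J b" using iadd_superset iadd_mem[OF artinian_is_ideal] by blast+
      then have "1 \<in> iadd V J a" "1 \<in> iadd V J b" using J(4) hideal_iadd[OF J(1)] ab by blast+
      then obtain p r q s where e: "1 = p + r * a" "p \<in> J" "r \<in> PR V" "1 = q + s * b" "q \<in> J" "s \<in> PR V"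
        by (auto elim!: iaddE)
      have P: "q + s * b \<in> PR V" using e(4) PR_1 by metis
      have "1 = (p + r * a) * (q + s * b)" using e(1,4) by simp
      also have "\<dots> = p * (q + s * b) + ((r * a) * q + (r * s) * (a * b))" by (simp add: algebra_simps)
      also have "\<dots> \<in> J" 
        by (intro is_idealD(3)[OF artinian_is_ideal] is_idealD(7)[OF artinian_is_ideal P e(2)] is_idealD(4)[OF artinian_is_ideal PR_mult[OF e(3) ab(1)] e(5)]
          is_idealD(4)[OF artinian_is_ideal PR_mult[OF e(3,6)] ab(5)])
      finally show False using J(3) by simp
    qed
  qed
  then show ?case using J by (intro exI[of _ "\<lambda>_. J"]) auto
next
  case (Suc t)
  have ng: "\<not> growth_le V I t" using Suc.prems by simp
  obtain J where J: "hideal V J" "I \<subseteq> J" "\<not> growth_le V J t" "\<And>K. hideal V K \<Longrightarrow> J \<subset> K \<Longrightarrow> \<not> \<not> growth_le V K t"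
    using hideal_maximal[where P = "\<lambda>J. \<not> growth_le V J t", OF V Suc.prems(1) ng] by blast
  have artinian_is_ideal: "is_ideal V J" using J by simp
  have JP: "J \<noteq> PR V"
  proof
    assume "J = PR V"
    then have "growth_le V J 0" by (intro growth_0_of_variables artinian_is_ideal) (auto intro: xpow_PR)
    then show False using J(3) growth_mono by blast
  qed
  have pJ: "prime_ideal V J"
  proof (rule prime_ideal_of_homog[OF J(1) JP])
    fix a b d e assume ab: "a \<in> PR V" "homog d a" "b \<in> PR V" "homog e b" "a * b \<in> J"
    show "a \<in> J \<or> b \<in> J"
    proof (rule ccontr)
      assume n: "\<not> (a \<in> J \<or> b \<in> J)"
      then have "J \<subset> iadd V J a" "J \<subset> colon V J a"
        using iadd_superset iadd_mem[OF artinian_is_ideal] colon_superset[OF artinian_is_ideal ab(1)] ab by (auto simp: colon_def mult.commute)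
      then have "growth_le V (iadd V J a) t" "growth_le V (colon V J a) t"
        using J(4) hideal_iadd[OF J(1) ab(1,2)] hideal_colon[OF J(1) ab(2)] by blast+
      then show False using growth_split[OF V J(1) ab(1,2)] J(3) by blast
    qed
  qed
  obtain v where v: "v \<in> V" "xpow v 1 \<notin> J" using growth_0_of_variables[OF artinian_is_ideal] growth_mono J(3) by blast
  define x :: "'k mpoly" where "x = xpow v 1"
  have x: "x \<in> PR V" "homog 1 x" "x \<notin> J" unfolding x_def using v xpow_PR homog_xpow by auto
  let ?K = "iadd V J x"
  have hK: "hideal V ?K" by (rule hideal_iadd[OF J(1) x(1,2)])
  have "?K \<noteq> PR V"
  proof
    assume "?K = PR V"
    then have "1 \<in> ?K" by simp
    then obtain p r where pr: "1 = p + r * x" "p \<in> J" by (rule iaddE)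
    have "hcomp 0 (1 :: 'k mpoly) = hcomp 0 p" unfolding pr(1) hcomp_add hcomp_mult_left[OF x(2)] by simp
    then have "1 \<in> J" using hideal_hcomp[OF J(1) pr(2), of 0] hcomp_homog[OF homog_1, of 0, where 'a='k] by simp
    then show False using JP ideal_eq_PR_iff[OF artinian_is_ideal] by simp
  qed
  moreover have "\<not> growth_le V ?K s" if "s < t" for s
    using growth_of_iadd[OF V J(1) x(1,2)] J(3) that growth_mono by (metis Suc_leI order_refl)
  ultimately obtain c where c: "\<forall>i\<le>t. prime_ideal V (c i) \<and> ?K \<subseteq> c i" "\<forall>i<t. c i \<subset> c (Suc i)"
    using Suc.IH[OF hK] by blast
  have sub: "J \<subset> c 0" using c(1) iadd_superset iadd_mem[OF artinian_is_ideal, of x] x(3) by blast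
  have K: "I \<subseteq> ?K" using J(2) iadd_superset by blast
  let ?c = "\<lambda>i. case i of 0 \<Rightarrow> J | Suc i \<Rightarrow> c i"
  have "\<forall>i\<le>Suc t. prime_ideal V (?c i) \<and> I \<subseteq> ?c i" using pJ J(2) c(1) K by (auto split: nat.split)
  moreover have "\<forall>i<Suc t. ?c i \<subset> ?c (Suc i)" using sub c(2) by (auto split: nat.split)
  ultimately show ?case by blast
qed

text \<open>Primes in a chain for \<open>krull_dim_quot\<close> need not be homogeneous, so the
  filtration by degree takes the place of graded pieces.\<close>

definition upto_piece :: "nat set \<Rightarrow> nat \<Rightarrow> 'k::field mpoly set" where
  "upto_piece V j = {p \<in> PR V. \<forall>m\<in>Poly_Mapping.keys p. mdeg m \<le> j}"

text \<open>For primes \<open>P \<subset> Q\<close> and \<open>q \<in> Q - P\<close> of degree at most \<open>e\<close>, multiplication by \<open>q\<close> embeds \<open>S/P\<close> into \<open>Q/P\<close>; hence the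
  codimensions \<open>F P j\<close> in degrees at most \<open>j\<close> satisfy \<open>F P (j + e) \<ge> F P j + F Q (j + e)\<close>.\<close>
lemma prime_chain_bound:
  fixes c :: "nat \<Rightarrow> 'k::field mpoly set"
  assumes V: "finite V" and c: "\<And>i. i \<le> l \<Longrightarrow> prime_ideal V (c i)" "\<And>i. i < l \<Longrightarrow> c i \<subset> c (Suc i)"
  shows "l \<le> card V"
proof -
  let ?S = "\<lambda>j. upto_piece V j :: 'k mpoly set"
  let ?M = "\<lambda>j. (\<lambda>m. Poly_Mapping.single m (1::'k)) ` {m. Poly_Mapping.keys m \<subseteq> V \<and> mdeg m \<le> j}"
  have SM: "?S j \<subseteq> pm.span (?M j)" for j
    by (auto intro!: in_span_keys simp: upto_piece_def PR_def)
  have fS: "pm.fin_span (?S j)" for j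
    unfolding pm.fin_span_def using SM[of j] mons_le_bound(1)[OF V, of j] by (intro exI[of _ "?M j"]) auto
  have dS: "pm.dim (?S j) \<le> (j + 1) ^ card V" for j
  proof -
    have "pm.dim (?S j) \<le> card (?M j)" using SM[of j] mons_le_bound(1)[OF V, of j] by (intro pm.dim_le_card) auto
    also have "\<dots> \<le> card {m. Poly_Mapping.keys m \<subseteq> V \<and> mdeg m \<le> j}" using mons_le_bound(1)[OF V, of j] by (rule card_image_le)
    finally show ?thesis using mons_le_bound(2)[OF V, of j] by simp
  qed
  have sS: "pm.subspace (?S j)" for j
  proof -
    have "Poly_Mapping.keys (pscale r x) \<subseteq> Poly_Mapping.keys x" for r and x :: "'k mpoly"
      by (auto simp: in_keys_iff lookup_pscale)
    then show ?thesis unfolding pm.subspace_def upto_piece_def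
      using keys_add PR_add PR_pscale by (fastforce simp: subset_iff)
  qed
  define F where "F I j = pm.dim (?S j) - pm.dim (I \<inter> ?S j)" for I j
  have Fadd: "F I j + pm.dim (I \<inter> ?S j) = pm.dim (?S j)" for I j
    unfolding F_def using pm.dim_mono_fin[OF fS, of "I \<inter> ?S j" j] by simp
  have "\<exists>q e. q \<in> c (Suc i) - c i \<and> (\<forall>e'\<ge>e. q \<in> ?S e')" if "i < l" for i
  proof -
    obtain q where q: "q \<in> c (Suc i) - c i" using c(2)[OF \<open>i < l\<close>] by blast
    then have "q \<in> PR V" using is_idealD(1)[OF prime_idealD(1)[OF c(1)[of "Suc i"]]] \<open>i < l\<close> by auto
    then have "\<forall>e'\<ge>Max (insert 0 (mdeg ` Poly_Mapping.keys q)). q \<in> ?S e'" by (auto simp: upto_piece_def)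
    then show ?thesis using q by blast
  qed
  then obtain q e0 where q: "\<And>i. i < l \<Longrightarrow> q i \<in> c (Suc i) - c i" "\<And>i e'. i < l \<Longrightarrow> e0 i \<le> e' \<Longrightarrow> q i \<in> ?S e'"
    by metis
  \<comment> \<open>A common degree bound for all the chosen \<open>q i\<close>, so that every step
    shifts by the same amount.\<close>
  define e where "e = Max (insert 0 (e0 ` {..<l}))"
  have qe: "q i \<in> ?S e" if "i < l" for i using that q(2)[of i e] unfolding e_def by auto
  have step: "F (c i) j + F (c (Suc i)) (j + e) \<le> F (c i) (j + e)" if i: "i < l" for i j
  proof -
    let ?P = "c i" and ?Q = "c (Suc i)"
    have P: "prime_ideal V ?P" and Q: "prime_ideal V ?Q" using c(1) i by auto
    note iP = prime_idealD(1)[OF P] and iQ = prime_idealD(1)[OF Q]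
    have PQ: "?P \<subset> ?Q" using c(2) i by blast
    have qi: "q i \<in> ?Q" "q i \<notin> ?P" "q i \<in> PR V" using q(1)[OF i] is_idealD(1)[OF iQ] by auto
    have mult: "q i * x \<in> ?S (j + e)" if x: "x \<in> ?S j" for x
    proof -
      have "mdeg m \<le> j + e" if "m \<in> Poly_Mapping.keys (q i * x)" for m
      proof -
        obtain a b where "m = a + b" "a \<in> Poly_Mapping.keys (q i)" "b \<in> Poly_Mapping.keys x"
          using keys_mult[of "q i" x] \<open>m \<in> _\<close> by blast
        then show ?thesis using x qe[OF i] by (auto simp: upto_piece_def add.commute intro: add_mono)
      qed
      then show ?thesis using x qi(3) by (auto simp: upto_piece_def intro: PR_mult)
    qed
    have "pm.dim (?S j) + pm.dim (?P \<inter> ?S (j + e)) \<le> pm.dim (?Q \<inter> ?S (j + e)) + pm.dim (?P \<inter> ?S j)"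
    proof (rule pm.codim_le_of_inj[OF linear_mult[of "q i"] fS _ sS])
      show "pm.fin_span (?Q \<inter> ?S (j + e))" by (rule pm.fin_span_mono[OF fS[of "j + e"]]) simp
      show "pm.subspace (?P \<inter> ?S (j + e))" by (intro pm.subspace_inter subspace_ideal[OF iP] sS)
      show "?P \<inter> ?S (j + e) \<subseteq> ?Q \<inter> ?S (j + e)" using PQ by blast
      fix x assume x: "x \<in> ?S j"
      then have xP: "x \<in> PR V" by (simp add: upto_piece_def)
      show "q i * x \<in> ?Q \<inter> ?S (j + e)" using mult[OF x] is_idealD(7)[OF iQ xP qi(1)] by simp
      show "x \<in> ?P \<inter> ?S j" if "q i * x \<in> ?P \<inter> ?S (j + e)"
        using prime_idealD(3)[OF P qi(3) xP] that qi(2) x by blast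
    qed simp
    then show ?thesis using Fadd[of ?P j] Fadd[of ?P "j + e"] Fadd[of ?Q "j + e"] by linarith
  qed
  \<comment> \<open>Pascal's rule turns the recursion \<open>step\<close> into a binomial lower
    bound, starting from the last prime of the chain, which is proper.\<close>
  have low: "k choose i \<le> F (c (l - i)) (e * k)" if "i \<le> l" for i k
    using that
  proof (induction i arbitrary: k)
    case 0
    have n1: "1 \<notin> c l" using prime_idealD(2)[OF c(1)[of l]] by simp
    have "c l \<inter> ?S (e * k) \<noteq> ?S (e * k)" using n1 by (auto simp: upto_piece_def set_eq_iff)
    moreover have "pm.subspace (c l \<inter> ?S (e * k))"
      by (intro pm.subspace_inter subspace_ideal[OF prime_idealD(1)[OF c(1)]] sS) simp
    ultimately have "\<not> pm.dim (?S (e * k)) \<le> pm.dim (c l \<inter> ?S (e * k))"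
      using pm.subspace_eq_of_dim[OF fS[of "e * k"], of "c l \<inter> ?S (e * k)"] by blast
    then show ?case unfolding F_def by simp
  next
    case (Suc i)
    note outer = Suc.IH
    show ?case
    proof (induction k)
      case (Suc k)
      have il: "l - Suc i < l" "Suc (l - Suc i) = l - i" using \<open>Suc i \<le> l\<close> by auto
      have "Suc k choose Suc i = (k choose Suc i) + (k choose i)" by simp
      also have "k choose i \<le> Suc k choose i" by (cases i) auto
      also have "Suc k choose i \<le> F (c (l - i)) (e * Suc k)" by (rule outer) (use \<open>Suc i \<le> l\<close> in simp)
      also have "k choose Suc i \<le> F (c (l - Suc i)) (e * k)" by (rule Suc.IH)
      also have "F (c (l - Suc i)) (e * k) + F (c (l - i)) (e * Suc k) \<le> F (c (l - Suc i)) (e * Suc k)"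
        using step[OF il(1), of "e * k"] unfolding il(2) by (simp add: add.commute)
      finally show ?case by simp
    qed simp
  qed
  have bnd: "k choose l \<le> (e * k + 1) ^ card V" for k
    using low[of l k] order.trans[OF diff_le_self dS] unfolding F_def by (meson le_trans order_refl)
  show ?thesis
  proof (rule ccontr)
    assume "\<not> l \<le> card V"
    then have ln: "card V < l" by simp
    \<comment> \<open>At \<open>k = l * M\<close> the binomial is at least \<open>M ^ l\<close>,
      while the upper bound is at most \<open>(M - 1) * M ^ card V\<close>; \<open>M\<close> is
      chosen to make these incompatible.\<close>
    define M where "M = (e * l + 1) ^ card V + 1"
    have M1: "M \<ge> 1" "(e * l + 1) ^ card V = M - 1" unfolding M_def by simp_all
    have "real (M ^ l) = (real (l * M) / real l) ^ l" using ln by simp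
    also have "\<dots> \<le> real ((l * M) choose l)" using M1 by (intro binomial_ge_n_over_k_pow_k) simp
    also have "\<dots> \<le> real ((e * (l * M) + 1) ^ card V)" using bnd of_nat_le_iff by blast
    finally have "M ^ l \<le> (e * (l * M) + 1) ^ card V" by (simp only: of_nat_le_iff)
    also have "\<dots> \<le> ((e * l + 1) * M) ^ card V" using M1 by (intro power_mono) (auto simp: algebra_simps)
    also have "\<dots> = (M - 1) * M ^ card V" unfolding power_mult_distrib M1(2) ..
    also have "\<dots> < M * M ^ card V" using M1 by simp
    also have "\<dots> \<le> M ^ l" using power_increasing[of "Suc (card V)" l M] ln M1 by simp
    finally show False by simp
  qed
qed

text \<open>Localisation in disguise: \<open>M\<close> is generated by \<open>a\<close> and the
  complement of \<open>P\<close>, and it avoids \<open>I\<close> because \<open>a\<close> is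
  regular. An ideal maximal among those containing \<open>I\<close> and avoiding \<open>M\<close> is
  prime, lies in \<open>P\<close> and omits \<open>a\<close>. It comes from Zorn's lemma since the
  ideals here need not be homogeneous.\<close>

lemma smaller_prime_of_nzd:
  fixes I :: "'k::field mpoly set"
  assumes I: "is_ideal V I" and P: "prime_ideal V P" "I \<subseteq> P" and a: "a \<in> P" "colon V I a = I"
  obtains Q where "prime_ideal V Q" "I \<subseteq> Q" "Q \<subset> P"
proof -
  note iP = prime_idealD(1)[OF P(1)]
  have aP: "a \<in> PR V" using a(1) is_idealD(1)[OF iP] by blast
  define M where "M = {a ^ k * s | k s. s \<in> PR V \<and> s \<notin> P}"
  have MI: "x * y \<in> M" if xy: "x \<in> M" "y \<in> M" for x y
  proof -
    obtain k s k' s' where e: "x = a ^ k * s" "s \<in> PR V" "s \<notin> P" "y = a ^ k' * s'" "s' \<in> PR V" "s' \<notin> P"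
      using xy unfolding M_def by blast
    have "x * y = a ^ (k + k') * (s * s')" using e by (simp add: power_add mult_ac)
    moreover have "s * s' \<notin> P" using prime_idealD(3)[OF P(1) e(2,5)] e by blast
    ultimately show ?thesis using e PR_mult unfolding M_def by blast
  qed
  have sM: "s \<in> M" if "s \<in> PR V" "s \<notin> P" for s
    unfolding M_def using that by (intro CollectI exI[of _ 0] exI[of _ s]) simp
  have aM: "a \<in> M" unfolding M_def using prime_idealD(2)[OF P(1)]
    by (intro CollectI exI[of _ 1] exI[of _ 1]) simp
  have "a ^ k * s \<in> I \<Longrightarrow> s \<in> PR V \<Longrightarrow> s \<in> I" for k s
  proof (induction k)
    case (Suc k)
    have "(a ^ k * s) * a \<in> I" using Suc.prems(1) by (simp add: mult_ac)
    then have "a ^ k * s \<in> colon V I a" using Suc.prems(2) aP by (simp add: colon_def PR_mult PR_power)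
    then show ?case using Suc a(2) by blast
  qed simp
  then have IM: "I \<inter> M = {}" using P(2) unfolding M_def by blast
  define A where "A = {J. is_ideal V J \<and> I \<subseteq> J \<and> J \<inter> M = {}}"
  have "\<exists>Q\<in>A. \<forall>X\<in>A. Q \<subseteq> X \<longrightarrow> X = Q"
  proof (rule subset_Zorn_nonempty)
    show "A \<noteq> {}" using I IM unfolding A_def by blast
    fix C assume C: "C \<noteq> {}" "subset.chain A C"
    have CA: "\<And>J. J \<in> C \<Longrightarrow> is_ideal V J \<and> I \<subseteq> J \<and> J \<inter> M = {}" using C(2) unfolding subset.chain_def A_def by blast
    have tot: "\<And>J K. J \<in> C \<Longrightarrow> K \<in> C \<Longrightarrow> J \<subseteq> K \<or> K \<subseteq> J" using C(2) unfolding subset.chain_def by blast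
    have "is_ideal V (\<Union>C)" unfolding is_ideal_def
    proof (intro conjI ballI)
      show "\<Union>C \<subseteq> PR V" using CA is_idealD(1) by blast
      show "0 \<in> \<Union>C" using C(1) CA is_idealD(2) by blast
      show "x + y \<in> \<Union>C" if xy: "x \<in> \<Union>C" "y \<in> \<Union>C" for x y
      proof -
        obtain J K where JK: "J \<in> C" "x \<in> J" "K \<in> C" "y \<in> K" using xy by blast
        then obtain L where "L \<in> C" "x \<in> L" "y \<in> L" using tot[OF JK(1,3)] by blast
        then show ?thesis using CA is_idealD(3) by blast
      qed
      show "r * x \<in> \<Union>C" if "r \<in> PR V" "x \<in> \<Union>C" for r x using that CA is_idealD(4) by blast
    qed
    then show "\<Union>C \<in> A" using C(1) CA unfolding A_def by blast
  qed
  then obtain Q where Q: "Q \<in> A" "\<And>X. X \<in> A \<Longrightarrow> Q \<subseteq> X \<Longrightarrow> X = Q" by blast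
  have iQ: "is_ideal V Q" "I \<subseteq> Q" "Q \<inter> M = {}" using Q(1) unfolding A_def by auto
  have "prime_ideal V Q" unfolding prime_ideal_def
  proof (intro conjI ballI impI iQ(1))
    show "Q \<noteq> PR V" using aM aP iQ(3) by blast
    fix x y assume xy: "x \<in> PR V" "y \<in> PR V" "x * y \<in> Q"
    have meet: "\<exists>r\<in>PR V. \<exists>q\<in>Q. q + r * z \<in> M" if z: "z \<in> PR V" "z \<notin> Q" for z
    proof -
      have "iadd V Q z \<notin> A"
        using Q(2)[of "iadd V Q z"] iadd_superset[of Q V z] iadd_mem[OF iQ(1), of z] z(2) by auto
      then have "iadd V Q z \<inter> M \<noteq> {}"
        unfolding A_def using is_ideal_iadd[OF iQ(1) z(1)] iadd_superset[of Q V z] iQ(2) by blast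
      then show ?thesis by (auto elim!: iaddE)
    qed
    show "x \<in> Q \<or> y \<in> Q"
    proof (rule ccontr)
      assume n: "\<not> (x \<in> Q \<or> y \<in> Q)"
      obtain r q where rq: "r \<in> PR V" "q \<in> Q" "q + r * x \<in> M" using meet[OF xy(1)] n by blast
      obtain s w where sw: "s \<in> PR V" "w \<in> Q" "w + s * y \<in> M" using meet[OF xy(2)] n by blast
      have "(q + r * x) * (w + s * y) = q * (w + s * y) + ((r * x) * w + (r * s) * (x * y))" by (simp add: algebra_simps)
      also have "\<dots> \<in> Q"

      proof -
        have "w \<in> PR V" using sw(2) is_idealD(1)[OF iQ(1)] by blast
        then have P: "w + s * y \<in> PR V" using PR_add PR_mult[OF sw(1) xy(2)] by blast
        show ?thesis
          by (intro is_idealD(3)[OF iQ(1)] is_idealD(7)[OF iQ(1) P rq(2)] is_idealD(4)[OF iQ(1) PR_mult[OF rq(1) xy(1)] sw(2)]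
            is_idealD(4)[OF iQ(1) PR_mult[OF rq(1) sw(1)] xy(3)])
      qed
      finally show False using MI[OF rq(3) sw(3)] iQ(3) by blast
    qed
  qed
  moreover have "Q \<subset> P" using sM iQ(3) is_idealD(1)[OF iQ(1)] aM a(1) by blast
  ultimately show thesis using that iQ(2) by blast
qed

definition prime_chain :: "nat set \<Rightarrow> nat \<Rightarrow> 'k::field mpoly set \<Rightarrow> bool" where
  "prime_chain V l P \<longleftrightarrow> (\<exists>c. (\<forall>i\<le>l. prime_ideal V (c i)) \<and> (\<forall>i<l. c i \<subset> c (Suc i)) \<and> c l = P)"

lemma prime_chain_0: "prime_ideal V P \<Longrightarrow> prime_chain V 0 P"
  unfolding prime_chain_def by (intro exI[of _ "\<lambda>_. P"]) auto

lemma prime_chain_Suc: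
  assumes "prime_chain V l Q" "prime_ideal V P" "Q \<subset> P"
  shows "prime_chain V (Suc l) P"
proof -
  obtain c where c: "\<forall>i\<le>l. prime_ideal V (c i)" "\<forall>i<l. c i \<subset> c (Suc i)" "c l = Q"
    using assms(1) unfolding prime_chain_def by blast
  let ?c = "\<lambda>i. if i \<le> l then c i else P"
  have "?c i \<subset> ?c (Suc i)" if "i < Suc l" for i
    using c(2,3) assms(3) that by (cases "i = l") auto
  then show ?thesis unfolding prime_chain_def using c(1) assms(2) by (intro exI[of _ ?c]) auto
qed

lemma prime_chain_le_height: "prime_chain V l P \<Longrightarrow> enat l \<le> height_prime V P"
  unfolding prime_chain_def height_prime_def by (intro Sup_upper) blast

text \<open>Each regular element lets the prime be replaced by a strictly smaller one that still
  contains the preceding part of the sequence; this bounds heights from below.\<close>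

lemma prime_chain_of_regular_seq:
  fixes fs :: "'k::field mpoly list"
  assumes nzd: "\<And>i. i < length fs \<Longrightarrow> colon V (idl V (take i fs)) (fs ! i) = idl V (take i fs)"
    and ideal: "\<And>i. i \<le> length fs \<Longrightarrow> is_ideal V (idl V (take i fs))"
    and "i \<le> length fs" "prime_ideal V Q" "idl V (take i fs) \<subseteq> Q"
  shows "prime_chain V i Q"
  using assms(3-)
proof (induction i arbitrary: Q)
  case 0 then show ?case using prime_chain_0 by blast
next
  case (Suc i)
  let ?I = "idl V (take i fs)"
  have i: "i < length fs" using Suc.prems by simp
  have e: "idl V (take (Suc i) fs) = iadd V ?I (fs ! i)"
    using i by (simp add: take_Suc_conv_app_nth ideal_gen_insert)
  have ii: "is_ideal V ?I" using ideal i by simp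
  have s: "?I \<subseteq> Q" "fs ! i \<in> Q" using Suc.prems(3) iadd_superset iadd_mem[OF ii] unfolding e by blast+
  obtain Q' where Q': "prime_ideal V Q'" "?I \<subseteq> Q'" "Q' \<subset> Q"
    using smaller_prime_of_nzd[OF ii Suc.prems(2) s(1,2) nzd[OF i]] .
  show ?case using prime_chain_Suc[OF Suc.IH[OF _ Q'(1,2)] Suc.prems(2) Q'(3)] i by simp
qed

subsection \<open>Multiplicity\<close>

text \<open>The equation for \<open>m\<close> is asked only eventually, since it is applied to
  \<open>j - b + t\<close> with truncated subtraction.\<close>

lemma tendsto_choose_div_power:
  assumes "\<forall>\<^sub>F j in sequentially. real (m j) = real j + r"
  shows "(\<lambda>j. real (m j choose t) / real j ^ t) \<longlonglongrightarrow> 1 / fact t"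
proof -
  have "(\<lambda>j. (\<Prod>i<t. 1 + (r - real i) * (1 / real j)) / fact t) \<longlonglongrightarrow> (\<Prod>i<t. 1 + (r - real i) * 0) / fact t"
    by (intro tendsto_intros lim_1_over_n) auto
  moreover have "\<forall>\<^sub>F j in sequentially. (\<Prod>i<t. 1 + (r - real i) * (1 / real j)) / fact t = real (m j choose t) / real j ^ t"
    using assms eventually_gt_at_top[of 0]
  proof eventually_elim
    case (elim j)
    have "real (m j choose t) = (\<Prod>i<t. real (m j) - real i) / fact t"
      by (simp add: binomial_gbinomial gbinomial_prod_rev atLeast0LessThan)
    also have "(\<Prod>i<t. real (m j) - real i) = (\<Prod>i<t. real j * (1 + (r - real i) * (1 / real j)))"
      using elim by (intro prod.cong) (auto simp: field_simps)
    also have "\<dots> = real j ^ t * (\<Prod>i<t. 1 + (r - real i) * (1 / real j))" by (simp add: prod.distrib)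
    finally show ?case using elim(2) by simp
  qed
  ultimately have "(\<lambda>j. real (m j choose t) / real j ^ t) \<longlonglongrightarrow> (\<Prod>i<t. 1 + (r - real i) * 0) / fact t"
    by (rule Lim_transform_eventually)
  then show ?thesis by simp
qed

lemma not_gr_of_choose_growth:
  assumes N: "1 \<le> N" "\<And>j. N * ((j + t) choose t) \<le> HF_sum V K (j + c)" and s: "s < t"
  shows "\<not> growth_le V K s"
proof
  assume "growth_le V K s"
  then obtain C where C: "C \<ge> 0" "\<And>j. real (HF_sum V K j) \<le> C * (real j + 1) ^ s" using growth_bound by blast
  let ?P = "smult C ([:real c + 1, 1:] ^ s)"
  have "degree ?P \<le> s" by (intro order.trans[OF degree_smult_le] order.trans[OF degree_power_le]) simp
  then have P: "degree ?P \<le> t" "coeff ?P t = 0" using s by (auto intro: coeff_eq_0)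
  have 1: "(\<lambda>j. poly ?P (real j) / real j ^ t) \<longlonglongrightarrow> 0" using tendsto_poly_div_power[OF P(1)] P(2) by metis
  have 2: "(\<lambda>j. real ((j + t) choose t) / real j ^ t) \<longlonglongrightarrow> 1 / fact t"
    by (rule tendsto_choose_div_power[where r = "real t"]) simp
  have "real ((j + t) choose t) / real j ^ t \<le> poly ?P (real j) / real j ^ t" for j
  proof (rule divide_right_mono)
    have "(j + t) choose t \<le> N * ((j + t) choose t)" using N(1) by simp
    also have "\<dots> \<le> HF_sum V K (j + c)" by (rule N(2))
    finally have "real ((j + t) choose t) \<le> real (HF_sum V K (j + c))" by simp
    also have "\<dots> \<le> poly ?P (real j)" using C(2)[of "j + c"] by (simp add: add_ac)
    finally show "real ((j + t) choose t) \<le> poly ?P (real j)" .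
  qed simp
  then have "1 / fact t \<le> (0::real)" by (intro LIMSEQ_le[OF 2 1]) auto
  moreover have "0 < 1 / (fact t :: real)" by simp
  ultimately show False by linarith
qed

text \<open>\<open>the_enat\<close> is meaningful only for a finite dimension, so the supremum is
  first bounded by \<open>prime_chain_bound\<close>.\<close>

lemma krull_dim_ge:
  fixes I :: "'k::field mpoly set"
  assumes V: "finite V" and c: "\<And>i. i \<le> t \<Longrightarrow> prime_ideal V (c i) \<and> I \<subseteq> c i" "\<And>i. i < t \<Longrightarrow> c i \<subset> c (Suc i)"
  shows "t \<le> the_enat (krull_dim_quot V I)"
proof -
  let ?A = "{l. \<exists>c :: nat \<Rightarrow> 'k mpoly set. (\<forall>i\<le>l. prime_ideal V (c i) \<and> I \<subseteq> c i) \<and> (\<forall>i<l. c i \<subset> c (Suc i))}"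
  have "Sup (enat ` ?A) \<le> enat (card V)"
  proof (rule Sup_least)
    fix x assume "x \<in> enat ` ?A"
    then obtain l where l: "x = enat l" "l \<in> ?A" by blast
    then obtain c where c: "\<forall>i\<le>l. prime_ideal V (c i) \<and> I \<subseteq> c i" "\<forall>i<l. c i \<subset> c (Suc i)" by blast
    then show "x \<le> enat (card V)" using prime_chain_bound[OF V, of l c] l(1) by simp
  qed
  then obtain d where d: "krull_dim_quot V I = enat d" unfolding krull_dim_quot_def
    by (metis (no_types, lifting) enat_ile)
  have "t \<in> ?A" using c by blast
  then have "enat t \<le> krull_dim_quot V I" unfolding krull_dim_quot_def by (intro Sup_upper) blast
  then show ?thesis unfolding d by simp
qed

text \<open>\<open>homog_regular_seq\<close> allows degree 0 in its format; such forms are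
  impossible because the constant 0 is regular only modulo the unit ideal and a nonzero constant
  generates it. Each regular form then lowers the growth bound by one, which also yields
  \<open>length fs \<le> card V\<close>.\<close>

lemma regular_seq_homog_gens:
  fixes fs :: "'k::field mpoly list"
  assumes V: "finite V" and reg: "homog_regular_seq V fs ds"
  shows "homog_gens V fs ds" "\<And>i. i < length fs \<Longrightarrow> colon V (idl V (take i fs)) (fs ! i) = idl V (take i fs)"
    "length fs \<le> card V" "growth_le V (idl V fs) (card V - length fs)"
proof -
  have r: "length fs = length ds" "\<And>i. i < length fs \<Longrightarrow> fs ! i \<in> PR V \<and> homog (ds ! i) (fs ! i)"
    "idl V fs \<noteq> PR V"
    "\<And>i g. i < length fs \<Longrightarrow> g \<in> PR V \<Longrightarrow> fs ! i * g \<in> idl V (take i fs) \<Longrightarrow> g \<in> idl V (take i fs)"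
    using reg unfolding homog_regular_seq_def by auto
  have la: "list_all2 (\<lambda>g e. g \<in> PR V \<and> homog e g) (take i fs) (take i ds)" for i
    using r(1,2) by (auto simp: list_all2_conv_all_nth)
  have hI: "hideal V (idl V (take i fs))" for i using idl_graded_piece[OF la] by blast
  have iI: "is_ideal V (idl V (take i fs))" for i using hI by simp
  have e: "idl V (take (Suc i) fs) = iadd V (idl V (take i fs)) (fs ! i)" if "i < length fs" for i
    using that by (simp add: take_Suc_conv_app_nth ideal_gen_insert)
  have sub: "idl V (take i fs) \<subseteq> idl V fs" for i
  proof -
    have "idl V (take i fs) \<subseteq> ideal_gen V (set fs)"
      unfolding ideal_gen_def using set_take_subset[of i fs] by blast
    then show ?thesis .
  qed
  have nP: "idl V (take i fs) \<noteq> PR V" for i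
    using sub[of i] r(3) is_idealD(1)[OF iI[of "length fs"]] by auto
  have pos: "1 \<le> ds ! i" if i: "i < length fs" for i
  proof (rule ccontr)
    assume "\<not> 1 \<le> ds ! i"
    then have h0: "homog 0 (fs ! i)" using r(2)[OF i] by (metis One_nat_def less_one not_less)
    define c where "c = Poly_Mapping.lookup (fs ! i) 0"
    have "Poly_Mapping.lookup (fs ! i) m = (if m = 0 then c else 0)" for m
      using h0 unfolding homog_def c_def by (auto simp: in_keys_iff)
    then have fc: "fs ! i = Poly_Mapping.single 0 c"
      by (intro poly_mapping_eqI) (auto simp: lookup_single when_def)
    show False
    proof (cases "c = 0")
      case True
      then have "fs ! i * 1 \<in> idl V (take i fs)" using fc is_idealD(2)[OF iI] by simp
      then have "1 \<in> idl V (take i fs)" using r(4)[OF i PR_1] by blast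
      then show False using nP[of i] ideal_eq_PR_iff[OF iI] by blast
    next
      case False
      have "fs ! i \<in> idl V (take (Suc i) fs)" unfolding e[OF i] by (rule iadd_mem[OF iI])
      then have "Poly_Mapping.single 0 (1 / c) * fs ! i \<in> idl V (take (Suc i) fs)"
        by (intro is_idealD(4)[OF iI] PR_single) auto
      then have "1 \<in> idl V (take (Suc i) fs)" using False by (simp add: fc mult_single)
      then show False using nP[of "Suc i"] ideal_eq_PR_iff[OF iI] by blast
    qed
  qed
  then show hg: "homog_gens V fs ds" using r(1,2) by (simp add: homog_gens_def list_all2_conv_all_nth)
  show nzd: "colon V (idl V (take i fs)) (fs ! i) = idl V (take i fs)" if i: "i < length fs" for i
  proof
    show "idl V (take i fs) \<subseteq> colon V (idl V (take i fs)) (fs ! i)" using colon_superset[OF iI] r(2)[OF i] by blast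
    show "colon V (idl V (take i fs)) (fs ! i) \<subseteq> idl V (take i fs)"
      using r(4)[OF i] by (auto simp: colon_def mult.commute)
  qed
  have "i \<le> card V \<and> growth_le V (idl V (take i fs)) (card V - i)" if "i \<le> length fs" for i
    using that
  proof (induction i)
    case 0
    then show ?case using linear_depth_gr[OF V linear_depth_zero[OF V]] by (simp add: ideal_gen_empty)
  next
    case (Suc i)
    then have i: "i < length fs" and IH: "i \<le> card V" "growth_le V (idl V (take i fs)) (card V - i)" by auto
    have f: "fs ! i \<in> PR V" "homog (ds ! i) (fs ! i)" using r(2)[OF i] by auto
    have "card V - i \<noteq> 0" using growth_0_drop[OF V hI f pos[OF i] nzd[OF i]] IH(2) nP by auto
    moreover have "growth_le V (iadd V (idl V (take i fs)) (fs ! i)) (card V - i - 1)" by (rule growth_drop[OF V hI f nzd[OF i] IH(2)])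
    ultimately show ?case unfolding e[OF i] by simp
  qed
  from this[of "length fs"] show "length fs \<le> card V" "growth_le V (idl V fs) (card V - length fs)" by auto
qed

text \<open>\<open>Q\<close> is an associated prime of \<open>I\<close> contained in \<open>P\<close>; it differs from \<open>P\<close> because \<open>S/Q\<close> grows faster than \<open>S/A\<close>.\<close>
lemma growth_of_height:
  fixes I A :: "'k::field mpoly set"
  assumes V: "finite V" and I: "hideal V I" and A: "I \<subseteq> A" and gA: "growth_le V A s"
    and P: "prime_ideal V P" "A \<subseteq> P"
    and unmixed: "\<And>u d. u \<in> PR V \<Longrightarrow> homog d u \<Longrightarrow> u \<notin> I \<Longrightarrow> \<not> growth_le V (colon V I u) s"
  obtains Q where "prime_ideal V Q" "I \<subseteq> Q" "Q \<subset> P"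
proof -
  have ii: "is_ideal V I" using I by simp
  note iP = prime_idealD(1)[OF P(1)]
  \<comment> \<open>Colon ideals contained in \<open>P\<close>: a maximal one corresponds to an
    associated prime after localising at \<open>P\<close>.\<close>
  let ?F = "\<lambda>J. \<exists>u d. u \<in> PR V \<and> homog d u \<and> J = colon V I u \<and> J \<subseteq> P"
  have "colon V I 1 = I" using is_idealD(1)[OF ii] by (auto simp: colon_def)
  then have "?F I" using A P(2) by (intro exI[of _ 1] exI[of _ 0]) auto
  then obtain Q where Q: "hideal V Q" "I \<subseteq> Q" "?F Q" "\<And>K. hideal V K \<Longrightarrow> Q \<subset> K \<Longrightarrow> \<not> ?F K"
    using hideal_maximal[where P = ?F, OF V I] by blast
  obtain u d where u: "u \<in> PR V" "homog d u" "Q = colon V I u" "Q \<subseteq> P" using Q(3) by blast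
  have n1: "1 \<notin> Q" using u(4) prime_idealD(2)[OF P(1)] by blast
  have "prime_ideal V Q"
  proof (rule prime_ideal_of_homog[OF Q(1)])
    show "Q \<noteq> PR V" using n1 by auto
    fix a b i j assume ab: "a \<in> PR V" "homog i a" "b \<in> PR V" "homog j b" "a * b \<in> Q"
    show "a \<in> Q \<or> b \<in> Q"
    proof (rule ccontr)
      assume n: "\<not> (a \<in> Q \<or> b \<in> Q)"
      have bu: "b * u \<in> PR V" "homog (j + d) (b * u)" using ab u by (auto intro: PR_mult homog_mult)
      let ?K = "colon V I (b * u)"
      have hK: "hideal V ?K" by (rule hideal_colon[OF I bu(2)])
      have "Q \<subseteq> ?K" unfolding u(3) using ab(3) is_idealD(4)[OF ii] by (auto simp: colon_def mult.left_commute[of _ b])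
      moreover have "a \<in> ?K" using ab u(3) by (simp add: colon_def mult.assoc)
      ultimately have "Q \<subset> ?K" using n by blast
      \<comment> \<open>By maximality \<open>K\<close> is not inside \<open>P\<close>. Multiplying
        \<open>u\<close> by an element of \<open>K\<close> outside \<open>P\<close> keeps the colon
        ideal inside \<open>P\<close>, hence equal to \<open>Q\<close>, yet puts \<open>b\<close>
        into it.\<close>
      then have "\<not> ?K \<subseteq> P" using Q(4)[OF hK] bu by blast
      then obtain x where x: "x \<in> ?K" "x \<notin> P" by blast
      obtain k where k: "hcomp k x \<notin> P" using hideal_comp_notin[OF iP x(2)] .
      let ?x = "hcomp k x"
      have xK: "?x \<in> ?K" using hideal_hcomp[OF hK x(1)] .
      have xP: "?x \<in> PR V" using xK by (simp add: colon_def)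
      have xu: "?x * u \<in> PR V" "homog (k + d) (?x * u)" using xP u by (auto intro: PR_mult homog_mult)
      let ?L = "colon V I (?x * u)"
      have hL: "hideal V ?L" by (rule hideal_colon[OF I xu(2)])
      have "Q \<subseteq> ?L" unfolding u(3) using xP is_idealD(4)[OF ii] by (auto simp: colon_def mult.left_commute[of _ ?x])
      moreover have "?L \<subseteq> P"
      proof
        fix g assume g: "g \<in> ?L"
        then have gP: "g \<in> PR V" by (simp add: colon_def)
        have "g * ?x \<in> Q" using g xP gP unfolding u(3) by (simp add: colon_def mult.assoc PR_mult)
        then show "g \<in> P" using prime_idealD(3)[OF P(1) gP xP] u(4) k by blast
      qed
      ultimately have "?L = Q" using Q(4)[OF hL] xu by blast
      moreover have "b \<in> ?L" using xK ab(3) by (simp add: colon_def mult_ac)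
      ultimately show False using n by blast
    qed
  qed
  moreover have "Q \<noteq> P"
  proof
    assume "Q = P"
    then have "growth_le V Q s" using growth_superset[OF V Q(1) gA] P(2) by simp
    moreover have "u \<notin> I" using n1 u by (auto simp: colon_def)
    ultimately show False using unmixed[OF u(1,2)] u(3) by simp
  qed
  ultimately show thesis using that Q(2) u(4) by blast
qed

lemma height_idealE:
  assumes "height_ideal V I = enat h"
  obtains P where "prime_ideal V P" "I \<subseteq> P" "height_prime V P = enat h"
proof -
  let ?A = "height_prime V ` {P. prime_ideal V P \<and> I \<subseteq> P}"
  have e: "Inf ?A = enat h" using assms unfolding height_ideal_def .
  then have "?A \<noteq> {}" by (metis Inf_empty enat.distinct(1) top_enat_def)
  then have "Inf ?A \<in> ?A" unfolding Inf_enat_def by (auto intro: LeastI)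
  then show thesis using that unfolding e by auto
qed

theorem theorem3p5:
  fixes n :: nat and fs :: "'k::field mpoly list" and G :: "'k mpoly"
    and ds :: "nat list" and D :: nat
  assumes aci: "almost_ci {0..<n} fs G ds D"
    and D_lt: "D < sigma ds"
  shows "multiplicity {0..<n} (ideal_gen {0..<n} (insert G (set fs)))
    \<le> real_of_int (int (prod_list ds)
        - (\<Sum>m\<in>{D+1..(sigma ds + D - 1) div 2}. phi TYPE('k) ds m)
        - (\<Sum>m\<in>{D+1..(sigma ds + D) div 2}. phi TYPE('k) ds m)
        - 2)"
proof -
  let ?V = "{0..<n}"
  have V: "finite ?V" by simp
  have srt: "sorted ds" and reg: "homog_regular_seq ?V fs ds" and G: "G \<in> PR ?V" "homog D G" "G \<notin> idl ?V fs"
    and ht: "height_ideal ?V (ideal_gen ?V (insert G (set fs))) = enat (length ds)"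
    using aci unfolding almost_ci_def by auto
  note rs = regular_seq_homog_gens[OF V reg]
  let ?I = "idl ?V fs"
  let ?A = "iadd ?V ?I G"
  have A: "ideal_gen ?V (insert G (set fs)) = ?A" by (rule ideal_gen_insert)
  define t where "t = n - length fs"
  have len: "length fs + t = card ?V" using rs(3) unfolding t_def by simp
  have gI: "growth_le ?V ?I t" using rs(4) unfolding t_def by simp
  have hI: "hideal ?V ?I" by (rule hideal_idl[OF rs(1)])
  have ii: "is_ideal ?V ?I" using hI by simp
  have hA: "hideal ?V ?A" by (rule hideal_iadd[OF hI G(1,2)])
  have lds: "length fs = length ds" using homog_gens_length[OF rs(1)] .
  have pos: "1 \<le> ds ! i" if "i < length ds" for i using homog_gens_nth[OF rs(1), of i] that lds by simp
  \<comment> \<open>The \<open>t\<close> leading ones contribute 0 to \<open>sigma\<close>; while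
    \<open>k \<le> t\<close> the required bound is at least the number of generators.\<close>
  have phi_bd: "phi TYPE('k) ds (Suc E) \<le> int (card ?V - k)"
    if "k \<le> card ?V" "sigma (take k (replicate t 1 @ ds)) \<le> E" for E k
  proof (cases "k \<le> t")
    case True
    have "phi TYPE('k) ds (Suc E) \<le> int (length ds - 0)" by (rule phi_le[OF pos]) (auto simp: sigma_Nil)
    then show ?thesis using True len lds by simp
  next
    case False
    have "sigma (replicate t 1) = 0" by (simp add: sigma_def sum_list_replicate)
    then have "sigma (take (k - t) ds) \<le> E" using that(2) False by (simp add: sigma_append del: One_nat_def)
    then have "phi TYPE('k) ds (Suc E) \<le> int (length ds - (k - t))" using that(1) len lds by (intro phi_le[OF pos]) auto
    then show ?thesis using False len lds by simp
  qed
  obtain N c where N: "1 \<le> N" "N \<le> prod_list ds" "\<And>j. N * ((j + t) choose t) \<le> HF_sum ?V (colon ?V ?I G) (j + c)"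
    "\<And>j. HF_sum ?V ?I j \<le> prod_list ds * ((j + t) choose t)"
    "2 + (\<Sum>m\<in>{D+1..(sigma ds + D - 1) div 2}. phi TYPE('k) ds m) + (\<Sum>m\<in>{D+1..(sigma ds + D) div 2}. phi TYPE('k) ds m) \<le> int N"
    using colon_growth[OF V rs(1) srt gI len G, of "phi TYPE('k) ds"] phi_bd D_lt by blast
  have rhs: "real (prod_list ds) - real N \<le> real_of_int (int (prod_list ds)
        - (\<Sum>m\<in>{D+1..(sigma ds + D - 1) div 2}. phi TYPE('k) ds m)
        - (\<Sum>m\<in>{D+1..(sigma ds + D) div 2}. phi TYPE('k) ds m) - 2)"
  proof -
    have "int (prod_list ds) - int N \<le> int (prod_list ds)
        - (\<Sum>m\<in>{D+1..(sigma ds + D - 1) div 2}. phi TYPE('k) ds m)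
        - (\<Sum>m\<in>{D+1..(sigma ds + D) div 2}. phi TYPE('k) ds m) - 2" using N(5) by linarith
    then have "real_of_int (int (prod_list ds) - int N) \<le> real_of_int (int (prod_list ds)
        - (\<Sum>m\<in>{D+1..(sigma ds + D - 1) div 2}. phi TYPE('k) ds m)
        - (\<Sum>m\<in>{D+1..(sigma ds + D) div 2}. phi TYPE('k) ds m) - 2)" by (simp only: of_int_le_iff)
    then show ?thesis by simp
  qed
  \<comment> \<open>Unmixedness over an arbitrary field comes from the same growth bound, applied to
    \<open>u\<close> in place of \<open>G\<close> with \<open>\<psi> = 0\<close>.\<close>
  have unmixed: "\<not> growth_le ?V (colon ?V ?I u) s" if u: "u \<in> PR ?V" "homog d u" "u \<notin> ?I" and s: "s < t" for u d s
  proof -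
    obtain N' c' where "1 \<le> N'" "\<And>j. N' * ((j + t) choose t) \<le> HF_sum ?V (colon ?V ?I u) (j + c')"
      using colon_growth[OF V rs(1) srt gI len u, of "\<lambda>_. 0"] by auto
    then show ?thesis using s by (rule not_gr_of_choose_growth)
  qed
  obtain P where P: "prime_ideal ?V P" "?A \<subseteq> P" "height_prime ?V P = enat (length ds)"
    using height_idealE[OF ht] unfolding A .
  \<comment> \<open>Here the height enters. Smaller growth would give a prime \<open>Q\<close>
    containing \<open>I\<close> and strictly inside \<open>P\<close>; as \<open>Q\<close> has height
    at least \<open>length fs\<close>, the height of \<open>P\<close> would exceed
    \<open>length ds\<close>.\<close>
  have ng: "\<not> growth_le ?V ?A s" if s: "s < t" for s
  proof
    assume gA: "growth_le ?V ?A s"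
    obtain Q where Q: "prime_ideal ?V Q" "?I \<subseteq> Q" "Q \<subset> P"
      by (rule growth_of_height[OF V hI iadd_superset gA P(1,2)]) (use unmixed s in blast)+
    have "prime_chain ?V (length fs) Q"
    proof (rule prime_chain_of_regular_seq[OF rs(2)])
      show "is_ideal ?V (idl ?V (take i fs))" for i
      proof -
        have "homog_gens ?V (take i fs) (take i ds)" using rs(1) unfolding homog_gens_def by (rule list_all2_takeI)
        then show ?thesis using hideal_idl hideal_ideal by blast
      qed
    qed (use Q in auto)
    then have "prime_chain ?V (Suc (length fs)) P" using prime_chain_Suc[OF _ P(1) Q(3)] by blast
    then show False using prime_chain_le_height P(3) lds by fastforce
  qed
  have AP: "?A \<noteq> PR ?V" using P(1,2) is_idealD(1)[OF prime_idealD(1)[OF P(1)]] by (auto simp: prime_ideal_def)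
  define d where "d = the_enat (krull_dim_quot ?V ?A)"
  have "\<exists>c. (\<forall>i\<le>t. prime_ideal ?V (c i) \<and> ?A \<subseteq> c i) \<and> (\<forall>i<t. c i \<subset> c (Suc i))"
    by (rule prime_chain_of_growth[OF V hA AP]) (rule ng)
  then obtain ch where ch: "\<forall>i\<le>t. prime_ideal ?V (ch i) \<and> ?A \<subseteq> ch i" "\<forall>i<t. ch i \<subset> ch (Suc i)"
    by (elim exE conjE) (rule that)
  have td: "t \<le> d" unfolding d_def by (rule krull_dim_ge[OF V, of t ch]) (simp_all add: ch)
  have "growth_le ?V ?A t" by (rule growth_superset[OF V hA gI iadd_superset])
  then obtain Q M where Q: "degree Q \<le> t" "\<And>j. j \<ge> M \<Longrightarrow> real (HF_sum ?V ?A j) = poly Q (real j)"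
    unfolding growth_le_def by blast
  have lim: "(\<lambda>j. real (HF_sum ?V ?A j) / real j ^ e) \<longlonglongrightarrow> coeff Q e" if "t \<le> e" for e
  proof (rule Lim_transform_eventually[OF tendsto_poly_div_power])
    show "degree Q \<le> e" using Q(1) that by simp
    show "\<forall>\<^sub>F j in sequentially. poly Q (real j) / real j ^ e = real (HF_sum ?V ?A j) / real j ^ e"
      using eventually_ge_at_top[of M] by eventually_elim (simp add: Q(2))
  qed
  have mult: "multiplicity ?V ?A = fact d * coeff Q d"
  proof -
    have "(\<lambda>j. fact d * (real (HF_sum ?V ?A j) / real j ^ d)) \<longlonglongrightarrow> fact d * coeff Q d"
      by (intro tendsto_mult tendsto_const lim td)
    moreover have "multiplicity ?V ?A = lim (\<lambda>j. fact d * (real (HF_sum ?V ?A j) / real j ^ d))"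
      unfolding multiplicity_def d_def[symmetric] Let_def HF_sum_def by simp
    ultimately show ?thesis using limI by metis
  qed
  \<comment> \<open>At this point \<open>t \<le> d\<close> is known. If \<open>d\<close> exceeds
    \<open>t\<close>, the coefficient vanishes and \<open>N \<le> prod_list ds\<close>
    suffices.\<close>
  have "fact d * coeff Q d \<le> real (prod_list ds) - real N"
  proof (cases "d = t")
    case False
    then have "coeff Q d = 0" using td Q(1) by (intro coeff_eq_0) simp
    then show ?thesis using N(2) by simp
  next
    case True
    \<comment> \<open>The degree \<open>D\<close> of \<open>G\<close> and the offset
      \<open>c\<close> shift the argument of the second binomial, which does not affect its leading
      coefficient.\<close>
    let ?b = "c + D"
    let ?r = "\<lambda>j. real (prod_list ds) * (real ((j + t) choose t) / real j ^ t)
        - real N * (real ((j - ?b + t) choose t) / real j ^ t)"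
    have l1: "(\<lambda>j. real ((j + t) choose t) / real j ^ t) \<longlonglongrightarrow> 1 / fact t"
      by (rule tendsto_choose_div_power[where r = "real t"]) simp
    have l2: "(\<lambda>j. real ((j - ?b + t) choose t) / real j ^ t) \<longlonglongrightarrow> 1 / fact t"
    proof (rule tendsto_choose_div_power[where r = "real t - real ?b"])
      show "\<forall>\<^sub>F j in sequentially. real (j - ?b + t) = real j + (real t - real ?b)"
        using eventually_ge_at_top[of ?b] by eventually_elim simp
    qed
    have lr: "?r \<longlonglongrightarrow> real (prod_list ds) * (1 / fact t) - real N * (1 / fact t)"
      by (intro tendsto_intros l1 l2)
    have "real (HF_sum ?V ?A j) / real j ^ t \<le> ?r j" if j: "j \<ge> ?b" for j
    proof -
      obtain i where i: "j = i + ?b" using j by (metis add.commute le_Suc_ex)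
      have "HF_sum ?V ?I j = HF_sum ?V ?A j + HF_sum ?V (colon ?V ?I G) (i + c)"
        using HF_sum_split(1)[OF V hI G(1,2), of "i + c"] i by (simp add: add.assoc)
      then have "HF_sum ?V ?A j + N * ((i + t) choose t) \<le> prod_list ds * ((j + t) choose t)"
        using N(3)[of i] N(4)[of j] by linarith
      then have "real (HF_sum ?V ?A j) + real N * real ((i + t) choose t) \<le> real (prod_list ds) * real ((j + t) choose t)"
        by (simp flip: of_nat_mult of_nat_add)
      then have "real (HF_sum ?V ?A j) / real j ^ t \<le> (real (prod_list ds) * real ((j + t) choose t) - real N * real ((i + t) choose t)) / real j ^ t"
        by (intro divide_right_mono) auto
      then show ?thesis using i by (simp add: diff_divide_distrib)
    qed
    then have "coeff Q t \<le> real (prod_list ds) * (1 / fact t) - real N * (1 / fact t)"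
      by (intro LIMSEQ_le[OF lim[OF order_refl] lr]) blast
    also have "\<dots> = (real (prod_list ds) - real N) / fact t" by (simp add: diff_divide_distrib)
    finally show ?thesis using True by (simp add: field_simps)
  qed
  then show ?thesis unfolding A mult using rhs by linarith
qed

end
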